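(* Let $S=k[x_1,\dots,x_n]$ be a polynomial ring over a field $k$ and let $M\subset S$ be a generic monomial ideal. Then: (a) For each integer $i$ with $\operatorname{codim}(M)<i\le \operatorname{proj-dim}_S(S/M)$ there is an embedded associated prime $P\in\operatorname{Ass}(S/M)$ with $\operatorname{codim}(P)=i$. (b) For every $P\in\operatorname{Ass}(S/M)$ there is a chain of associated primes $P=P_0\supset P_1\supset\cdots\supset P_t$ (all $P_i\in\operatorname{Ass}(S/M)$) with $\operatorname{codim}(P_i)=\operatorname{codim}(P_{i-1})-1$ for all $i$, such that $P_t$ is a minimal prime of $M$.
   Context: For a monomial $\mathbf{x}^{\mathbf a}=x_1^{a_1}\cdots x_n^{a_n}$ put $\operatorname{supp}(\mathbf{x}^{\mathbf a})=\{s: a_s\neq 0\}$. Generic: a monomial ideal $M$ with minimal monomial generators $m_1,\dots,m_r$ is called generic if for any two distinct minimal generators $m_i,m_j$ which have the same positive degree in some variable $x_s$ there exists a third minimal generator $m_l$ of $M$ which divides $m_{\{i,j\}}=\operatorname{lcm}(m_i,m_j)$ and satisfies $\operatorname{supp}(m_{\{i,j\}}/m_l)=\operatorname{supp}(m_{\{i,j\}})$. $\operatorname{codim}$ denotes the codimension (height) of an ideal, and $\operatorname{proj-dim}_S$ the projective dimension. An associated prime is embedded if it is not a minimal prime of $M$. *)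

theory Defs
  imports
    "HOL-Algebra.Algebra"
    "HOL-Algebra.Algebraic_Closure_Type"
    "HOL-Library.Poly_Mapping"
    "HOL-Library.Extended_Nat"
begin

hide_const (open) Modules.module

section \<open>Heights, minimal primes and associated primes\<close>

text \<open>The supremum of the lengths of chains of primes ending in \<open>P\<close>.\<close>

definition prime_height :: "('a, 'm) ring_scheme \<Rightarrow> 'a set \<Rightarrow> enat" where
  "prime_height R P =
     Sup {enat t | t. \<exists>Q :: nat \<Rightarrow> 'a set.
        (\<forall>i\<le>t. primeideal (Q i) R) \<and> (\<forall>i<t. Q i \<subset> Q (Suc i)) \<and> Q t = P}"

text \<open>For a prime ideal this agrees with \<^const>\<open>prime_height\<close>; the unit ideal has codimension
  \<open>\<infinity>\<close>.\<close>

definition codim :: "('a, 'm) ring_scheme \<Rightarrow> 'a set \<Rightarrow> enat" where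
  "codim R I = (INF P\<in>{P. primeideal P R \<and> I \<subseteq> P}. prime_height R P)"

definition minimal_primes :: "('a, 'm) ring_scheme \<Rightarrow> 'a set \<Rightarrow> 'a set set" where
  "minimal_primes R I =
     {P. primeideal P R \<and> I \<subseteq> P \<and>
         (\<forall>Q. primeideal Q R \<and> I \<subseteq> Q \<and> Q \<subseteq> P \<longrightarrow> Q = P)}"

definition annihilator ::
  "('a, 'm) ring_scheme \<Rightarrow> ('a, 'b, 'n) module_scheme \<Rightarrow> 'b \<Rightarrow> 'a set" where
  "annihilator R N x = {r \<in> carrier R. r \<odot>\<^bsub>N\<^esub> x = \<zero>\<^bsub>N\<^esub>}"

definition Ass ::
  "('a, 'm) ring_scheme \<Rightarrow> ('a, 'b, 'n) module_scheme \<Rightarrow> 'a set set" where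
  "Ass R N = {P. primeideal P R \<and> (\<exists>x\<in>carrier N. P = annihilator R N x)}"

text \<open>\<open>R/I\<close> as an \<open>R\<close>-module.\<close>

definition quotient_module :: "('a, 'm) ring_scheme \<Rightarrow> 'a set \<Rightarrow> ('a, 'a set) module" where
  "quotient_module R I =
     \<lparr>carrier = carrier (R Quot I), monoid.mult = (\<otimes>\<^bsub>R Quot I\<^esub>), one = \<one>\<^bsub>R Quot I\<^esub>,
      ring.zero = \<zero>\<^bsub>R Quot I\<^esub>, add = (\<oplus>\<^bsub>R Quot I\<^esub>),
      module.smult = (\<lambda>r Y. (I +>\<^bsub>R\<^esub> r) \<otimes>\<^bsub>R Quot I\<^esub> Y)\<rparr>"


section \<open>Projective dimension\<close>

definition mod_hom ::
  "('a, 'm) ring_scheme \<Rightarrow> ('a, 'b, 'n) module_scheme \<Rightarrow> ('a, 'c, 'o) module_scheme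
     \<Rightarrow> ('b \<Rightarrow> 'c) set" where
  "mod_hom R A B =
     {f \<in> hom (add_monoid A) (add_monoid B).
        \<forall>r\<in>carrier R. \<forall>x\<in>carrier A. f (r \<odot>\<^bsub>A\<^esub> x) = r \<odot>\<^bsub>B\<^esub> f x}"

text \<open>
  The lifting property against surjections \<open>g : A \<rightarrow> B\<close>. As a definition cannot quantify over
  all types, \<open>A\<close> and \<open>B\<close> range over the modules whose elements lie in \<open>'b \<Rightarrow> 'a\<close> and in \<open>'b\<close>, the
  element type of \<open>P\<close>. This is no restriction: these include \<open>B = P\<close> and, as \<open>A\<close>, the free module
  of finitely supported functions on \<open>carrier P\<close>. Lifting the identity along \<open>A \<rightarrow> P\<close> makes \<open>P\<close> a
  direct summand of a free module, and then \<open>P\<close> lifts against all surjections.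
\<close>

definition projective_module ::
  "('a, 'm) ring_scheme \<Rightarrow> ('a, 'b, 'n) module_scheme \<Rightarrow> bool" where
  "projective_module R P \<longleftrightarrow>
     module R P \<and>
     (\<forall>(A :: ('a, 'b \<Rightarrow> 'a) module) (B :: ('a, 'b) module) f g.
        module R A \<and> module R B \<and>
        g \<in> mod_hom R A B \<and> g ` carrier A = carrier B \<and> f \<in> mod_hom R P B
        \<longrightarrow> (\<exists>h\<in>mod_hom R P A. \<forall>x\<in>carrier P. g (h x) = f x))"

text \<open>\<open>\<dots> \<rightarrow> P 2 \<rightarrow> P 1 \<rightarrow> P 0 \<rightarrow> N \<rightarrow> 0\<close> exact, with maps \<open>\<delta> i : P (Suc i) \<rightarrow> P i\<close> and
  \<open>\<epsilon> : P 0 \<rightarrow> N\<close>.\<close>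

definition projective_resolution ::
  "('a, 'm) ring_scheme \<Rightarrow> ('a, 'b, 'n) module_scheme \<Rightarrow>
     (nat \<Rightarrow> ('a, 'u) module) \<Rightarrow> (nat \<Rightarrow> 'u \<Rightarrow> 'u) \<Rightarrow> ('u \<Rightarrow> 'b) \<Rightarrow> bool" where
  "projective_resolution R N P \<delta> \<epsilon> \<longleftrightarrow>
     (\<forall>i. projective_module R (P i)) \<and>
     \<epsilon> \<in> mod_hom R (P 0) N \<and>
     (\<forall>i. \<delta> i \<in> mod_hom R (P (Suc i)) (P i)) \<and>
     \<epsilon> ` carrier (P 0) = carrier N \<and>
     \<delta> 0 ` carrier (P 1) = a_kernel (P 0) N \<epsilon> \<and>
     (\<forall>i. \<delta> (Suc i) ` carrier (P (i + 2)) = a_kernel (P (Suc i)) (P i) (\<delta> i))"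

text \<open>
  The least \<open>d\<close> such that \<open>N\<close> has a projective resolution vanishing beyond degree \<open>d\<close>, and \<open>\<infinity>\<close> if
  there is none. The modules of the resolution have their elements in \<open>('a \<times> 'b) list \<Rightarrow> 'a\<close>, which
  is no restriction: that type contains the free module on any basis embedding into the infinite
  type \<open>('a \<times> 'b) list\<close>, such as \<open>carrier N\<close>, and that free module again has at most as many
  elements as there are lists. So \<open>N\<close> has a free resolution inside this type, and if \<open>N\<close> has
  projective dimension at most \<open>d\<close>, truncating it at the \<open>d\<close>-th syzygy (which is then projective)
  gives a resolution of length \<open>d\<close> inside this type.
\<close>

definition proj_dim ::
  "('a, 'm) ring_scheme \<Rightarrow> ('a, 'b, 'n) module_scheme \<Rightarrow> enat" where
  "proj_dim R N =
     Inf {enat d | d.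
       \<exists>(P :: nat \<Rightarrow> ('a, ('a \<times> 'b) list \<Rightarrow> 'a) module) \<delta> \<epsilon>.
         projective_resolution R N P \<delta> \<epsilon> \<and> (\<forall>i>d. carrier (P i) = {\<zero>\<^bsub>P i\<^esub>})}"


section \<open>Generic monomial ideals\<close>

text \<open>
  The variables \<open>x\<^sub>1, \<dots>, x\<^sub>n\<close> are indexed by a finite type \<open>'n\<close> with \<open>n = CARD('n)\<close>, and the monomial
  \<open>x\<^sup>a\<close> is represented by its exponent vector \<open>a :: 'n \<Rightarrow>\<^sub>0 nat\<close>. Hence
  \<^term>\<open>Poly_Mapping.keys a\<close> is its support and \<open>+\<close> is multiplication of monomials.
\<close>

type_synonym ('n, 'k) mpoly = "('n \<Rightarrow>\<^sub>0 nat) \<Rightarrow>\<^sub>0 'k"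

abbreviation mpoly_ring :: "('n::finite, 'k::field) mpoly ring" where
  "mpoly_ring \<equiv> ring_of_type_algebra"

definition monom_of :: "('n::finite \<Rightarrow>\<^sub>0 nat) \<Rightarrow> ('n, 'k::field) mpoly" where
  "monom_of a = Poly_Mapping.single a 1"

lift_definition monom_lcm :: "('n::finite \<Rightarrow>\<^sub>0 nat) \<Rightarrow> ('n \<Rightarrow>\<^sub>0 nat) \<Rightarrow> ('n \<Rightarrow>\<^sub>0 nat)"
  is "\<lambda>a b s. max (a s) (b s)"
  by simp

text \<open>\<open>M\<close> is the monomial ideal with set of minimal monomial generators \<open>G\<close>.\<close>

definition minimal_monomial_generators ::
  "('n::finite, 'k::field) mpoly set \<Rightarrow> ('n \<Rightarrow>\<^sub>0 nat) set \<Rightarrow> bool" where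
  "minimal_monomial_generators M G \<longleftrightarrow>
     finite G \<and> M = genideal mpoly_ring (monom_of ` G) \<and>
     (\<forall>H. H \<subset> G \<longrightarrow> genideal mpoly_ring (monom_of ` H) \<noteq> M)"

text \<open>
  Here \<open>d\<close> is the quotient \<open>lcm(a, b) / c\<close>. Every monomial ideal has exactly one set of
  minimal monomial generators, so \<open>\<exists>G\<close> merely names it.
\<close>

definition generic_monomial_ideal :: "('n::finite, 'k::field) mpoly set \<Rightarrow> bool" where
  "generic_monomial_ideal M \<longleftrightarrow>
     (\<exists>G. minimal_monomial_generators M G \<and>
       (\<forall>a\<in>G. \<forall>b\<in>G. a \<noteq> b \<and>
          (\<exists>s. Poly_Mapping.lookup a s = Poly_Mapping.lookup b s \<and> Poly_Mapping.lookup a s > 0)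
        \<longrightarrow> (\<exists>c\<in>G. c \<noteq> a \<and> c \<noteq> b \<and>
              (\<exists>d. monom_lcm a b = c + d \<and>
                   Poly_Mapping.keys d = Poly_Mapping.keys (monom_lcm a b)))))"

end

(*
  Let D bound all exponents of the generators and call an exponent vector a a corner if
  x^a is not in M, but x_s x^a is in M for every s with a_s < D (so coordinates >= D stand for
  infinity). The associated primes are exactly the P_F with F = {s. a_s < D}, a a corner.

  Everything rests on recursion along one variable x. Corners with a_x >= D are those of the ideal
  obtained by setting x = 1; a corner with a_x < D is stopped in direction x by a generator alpha,
  and the corners stopped by alpha are those of a colon ideal ("link") not involving x. Both kinds
  of ideals are again generic. Exchanging x against another variable leads from the corners of one
  link to corners with larger a_x, changing F by at most one element. Hence if no corner of size i
  lies directly above one of size i - 1, then all corners have size >= i or all have size < i.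
  With i between codim M and the largest size this gives (a); applied to the corners inside a
  given F, it gives (b).

  The same recursion yields a filtration of S/M whose quotients are S/(J + (x^j)), J the ideal of
  a link, and S/M' with M' the ideal where x = 1. By induction, the projective dimension of S/M is
  at most the largest size of a corner.

  For the height of P_F, choose in each step of a chain of primes an element of the larger prime
  outside the smaller one: these elements are algebraically independent, and counting monomials
  of bounded degree shows that there are at most n of them.
*)

theory Submission
  imports Defs "HOL-Library.Function_Algebras"
begin

section \<open>Corners of a generic set of exponents\<close>

text \<open>The recursion should lower the number of variables, but the index type \<open>'n\<close>
  is fixed. A removed variable therefore stays present, with coordinate at least D in every corner,
  and inductions run over a set V that carries all generators.

  The obstacle to comparing corners is that those stopped in direction x by different generators lie
  in different links, about whose relation the induction hypothesis is silent. Genericity builds the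
  bridge. If y is a further variable of \<alpha>, one may stay just below \<alpha> in x or just
  below it in y. The generators that could spoil this exchange share the x- or the y-exponent of
  \<alpha>; each of them can be traded for a third one that is strictly smaller there. The exchange
  is impossible only if \<alpha> is a pure power of x, and then the smallest pure power is the only
  one that can stop a corner.

  A threshold on the size suits the recursion because passing to a link lowers all sizes by exactly
  one. The filtration uses genericity in the same manner: generators with the x-exponent of \<alpha>
  add nothing to the colon ideal by \<alpha>.\<close>

definition upset :: "('n \<Rightarrow> nat) set \<Rightarrow> ('n \<Rightarrow> nat) set" where
  "upset G = {a. \<exists>g\<in>G. g \<le> a}"

text \<open>That lcm/c has full support means that c is strictly below the maximum wherever the
  maximum is positive. At the coordinate \<open>s\<close> this puts c strictly below both a and b,
  so c is a third element by itself. G is an arbitrary set, as \<open>drop_var\<close> and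
  \<open>link\<close> may create redundant generators.\<close>

definition generic :: "('n \<Rightarrow> nat) set \<Rightarrow> bool" where
  "generic G \<longleftrightarrow> (\<forall>a\<in>G. \<forall>b\<in>G. a \<noteq> b \<and> (\<exists>s. a s = b s \<and> a s > 0) \<longrightarrow>
     (\<exists>c\<in>G. \<forall>t. c t < max (a t) (b t) \<or> c t = 0))"

text \<open>If D bounds the exponents of G, then \<open>a\<close> encodes an irreducible component
  of the ideal: the one generated by the powers of x_s with exponent \<open>a s + 1\<close>, for
  \<open>a s < D\<close>. Infinite coordinates are not normalised, so a component is encoded by many
  corners.\<close>

definition corner :: "nat \<Rightarrow> ('n \<Rightarrow> nat) set \<Rightarrow> ('n \<Rightarrow> nat) \<Rightarrow> bool" where
  "corner D G a \<longleftrightarrow> a \<notin> upset G \<and> (\<forall>s. a s < D \<longrightarrow> a(s := Suc (a s)) \<in> upset G)"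

definition low :: "nat \<Rightarrow> ('n \<Rightarrow> nat) \<Rightarrow> 'n set" where
  "low D a = {s. a s < D}"

definition bounded_by :: "nat \<Rightarrow> ('n \<Rightarrow> nat) set \<Rightarrow> bool" where
  "bounded_by D G \<longleftrightarrow> (\<forall>g\<in>G. \<forall>s. g s \<le> D)"

definition drop_var :: "'n \<Rightarrow> ('n \<Rightarrow> nat) set \<Rightarrow> ('n \<Rightarrow> nat) set" where
  "drop_var x G = (\<lambda>g. g(x := 0)) ` G"

text \<open>For \<alpha> in G divisible by x, the colon ideal of M by the monomial \<alpha>/x is
  generated by x and by \<open>link x \<alpha> G\<close>. The truncated subtraction is division by
  the gcd with \<alpha>.\<close>

definition link :: "'n \<Rightarrow> ('n \<Rightarrow> nat) \<Rightarrow> ('n \<Rightarrow> nat) set \<Rightarrow> ('n \<Rightarrow> nat) set" where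
  "link x \<alpha> G = (\<lambda>g. (\<lambda>s. g s - \<alpha> s)(x := 0)) ` {g \<in> G. g x < \<alpha> x}"

definition supported_in :: "'n set \<Rightarrow> ('n \<Rightarrow> nat) set \<Rightarrow> bool" where
  "supported_in V G \<longleftrightarrow> (\<forall>g\<in>G. \<forall>s. s \<notin> V \<longrightarrow> g s = 0)"

lemma genericE:
  assumes "generic G" "a \<in> G" "b \<in> G" "a \<noteq> b" "a s = b s" "a s > 0"
  obtains c where "c \<in> G" "\<And>t. c t < max (a t) (b t) \<or> c t = 0"
  using assms unfolding generic_def by metis

lemma upset_mono: "a \<in> upset G \<Longrightarrow> a \<le> b \<Longrightarrow> b \<in> upset G"
  unfolding upset_def by (blast intro: order_trans)

lemma generic_drop_var: "generic G \<Longrightarrow> generic (drop_var x G)"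
proof -
  assume G: "generic G"
  show ?thesis
    unfolding generic_def
  proof (intro ballI impI, elim conjE exE)
    fix a b s
    assume "a \<in> drop_var x G" "b \<in> drop_var x G" and ne: "a \<noteq> b" and s: "a s = b s" "0 < a s"
    then obtain g h where g: "g \<in> G" "a = g(x := 0)" and h: "h \<in> G" "b = h(x := 0)"
      by (auto simp: drop_var_def)
    have "s \<noteq> x" using s g by auto
    then have "g \<noteq> h" "g s = h s" "g s > 0" using s g h ne by auto
    then obtain c where c: "c \<in> G" "\<And>t. c t < max (g t) (h t) \<or> c t = 0"
      using genericE[OF G g(1) h(1)] by blast
    show "\<exists>c\<in>drop_var x G. \<forall>t. c t < max (a t) (b t) \<or> c t = 0"
      using c g h by (intro bexI[of _ "c(x := 0)"]) (auto simp: drop_var_def)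
  qed
qed

text \<open>Equal positive differences at s come from equal positive exponents, so genericity of G
  yields c. As both generators are below \<alpha> in x, so is c, and its image is in the link.
  Truncated subtraction keeps a strict inequality or makes the smaller side 0.\<close>

lemma generic_link: "generic G \<Longrightarrow> generic (link x \<alpha> G)"
proof -
  assume G: "generic G"
  show ?thesis
    unfolding generic_def
  proof (intro ballI impI, elim conjE exE)
    fix a b s
    assume "a \<in> link x \<alpha> G" "b \<in> link x \<alpha> G" and ne: "a \<noteq> b" and s: "a s = b s" "0 < a s"
    then obtain g h where g: "g \<in> G" "g x < \<alpha> x" "a = (\<lambda>s. g s - \<alpha> s)(x := 0)"
      and h: "h \<in> G" "h x < \<alpha> x" "b = (\<lambda>s. h s - \<alpha> s)(x := 0)"
      by (auto simp: link_def)
    have "s \<noteq> x" using s g by auto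
    then have "g \<noteq> h" "g s = h s" "g s > 0" using s g h ne by auto
    then obtain c where c: "c \<in> G" "\<And>t. c t < max (g t) (h t) \<or> c t = 0"
      using genericE[OF G g(1) h(1)] by blast
    have cx: "c x < \<alpha> x" using c(2)[of x] g h by auto
    have "(\<lambda>s. c s - \<alpha> s)(x := 0) \<in> link x \<alpha> G" using c cx by (auto simp: link_def)
    moreover have "((\<lambda>s. c s - \<alpha> s)(x := 0)) t < max (a t) (b t) \<or> ((\<lambda>s. c s - \<alpha> s)(x := 0)) t = 0" for t
      using c(2)[of t] g h by auto
    ultimately show "\<exists>c\<in>link x \<alpha> G. \<forall>t. c t < max (a t) (b t) \<or> c t = 0" by blast
  qed
qed

lemma bounded_drop_var: "bounded_by D G \<Longrightarrow> bounded_by D (drop_var x G)"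
  by (auto simp: bounded_by_def drop_var_def)

lemma bounded_link: "bounded_by D G \<Longrightarrow> bounded_by D (link x \<alpha> G)"
  by (fastforce simp: bounded_by_def link_def le_diff_conv trans_le_add1)

lemma supported_drop_var: "supported_in V G \<Longrightarrow> supported_in (V - {x}) (drop_var x G)"
  by (auto simp: supported_in_def drop_var_def)

lemma supported_link: "supported_in V G \<Longrightarrow> supported_in (V - {x}) (link x \<alpha> G)"
  by (auto simp: supported_in_def link_def)

text \<open>A generator that stops a corner in direction s has a positive exponent there; a variable
  occurring in no generator is thus infinite in every corner.\<close>

lemma corner_ge:
  assumes "corner D G a" "supported_in V G" "s \<notin> V"
  shows "a s \<ge> D"
proof (rule ccontr)
  assume "\<not> a s \<ge> D"
  then obtain g where g: "g \<in> G" "g \<le> a(s := Suc (a s))"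
  proof -
    have "a(s := Suc (a s)) \<in> upset G" using assms(1) \<open>\<not> a s \<ge> D\<close> by (simp add: corner_def)
    then show ?thesis using that by (auto simp: upset_def)
  qed
  have "g \<le> a"
  proof (rule le_funI)
    fix t show "g t \<le> a t"
      using le_funD[OF g(2), of t] g(1) assms(2,3) by (cases "t = s") (auto simp: supported_in_def)
  qed
  then show False using g assms(1) by (auto simp: corner_def upset_def)
qed

lemma low_subset: "corner D G a \<Longrightarrow> supported_in V G \<Longrightarrow> low D a \<subseteq> V"
  using corner_ge[of D G a V] by (auto simp: low_def not_le[symmetric])

text \<open>Among the vectors above \<open>a\<close> with coordinates at most D that avoid the
  upset, one of greatest total degree cannot be raised in any direction with room left.\<close>

lemma corner_exists_above:
  fixes a :: "'n::finite \<Rightarrow> nat"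
  assumes "a \<notin> upset G" "\<And>s. a s \<le> D"
  obtains b where "corner D G b" "a \<le> b"
proof -
  let ?S = "{b. a \<le> b \<and> b \<notin> upset G \<and> (\<forall>s. b s \<le> D)}"
  have "\<exists>b. b \<in> ?S \<and> (\<forall>c. c \<in> ?S \<longrightarrow> sum c UNIV \<le> sum b UNIV)"
  proof (rule ex_has_greatest_nat[where k = a])
    show "a \<in> ?S" using assms by auto
    show "\<forall>c. c \<in> ?S \<longrightarrow> sum c UNIV < Suc (card (UNIV :: 'n set) * D)"
    proof (intro allI impI)
      fix c assume "c \<in> ?S"
      then have "sum c UNIV \<le> of_nat (card (UNIV :: 'n set)) * D" by (intro sum_bounded_above) auto
      then show "sum c UNIV < Suc (card (UNIV :: 'n set) * D)" by simp
    qed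
  qed
  then obtain b where b: "b \<in> ?S" and mx: "\<And>c. c \<in> ?S \<Longrightarrow> sum c UNIV \<le> sum b UNIV" by blast
  have "b(s := Suc (b s)) \<in> upset G" if "b s < D" for s
  proof (rule ccontr)
    assume "b(s := Suc (b s)) \<notin> upset G"
    moreover have "b \<le> b(s := Suc (b s))" by (auto simp: le_fun_def)
    ultimately have "b(s := Suc (b s)) \<in> ?S" using b that order_trans by fastforce
    from mx[OF this] show False
      by (simp add: sum.remove[of UNIV s])
  qed
  then have "corner D G b" using b by (auto simp: corner_def)
  then show ?thesis using b that by auto
qed

lemma corner_exists:
  fixes G :: "('n::finite \<Rightarrow> nat) set"
  assumes "(\<lambda>_. 0) \<notin> G"
  obtains b where "corner D G b"
proof -
  have "(\<lambda>_. 0) \<notin> upset G"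
  proof
    assume "(\<lambda>_. 0) \<in> upset G"
    then obtain g where "g \<in> G" "g \<le> (\<lambda>_. 0)" by (auto simp: upset_def)
    then have "g = (\<lambda>_. 0)" by (auto simp: le_fun_def)
    with \<open>g \<in> G\<close> assms show False by simp
  qed
  then show ?thesis using corner_exists_above[of "\<lambda>_. 0" G D] that by auto
qed

section \<open>Recursion along one variable: corners at infinity and corners of links\<close>

lemma upset_drop_var:
  assumes "bounded_by D G" "a x \<ge> D"
  shows "a \<in> upset (drop_var x G) \<longleftrightarrow> a \<in> upset G"
proof
  assume "a \<in> upset (drop_var x G)"
  then obtain g where g: "g \<in> G" "g(x := 0) \<le> a" by (auto simp: upset_def drop_var_def)
  have "g \<le> a"
  proof (rule le_funI)
    fix t show "g t \<le> a t"
      using le_funD[OF g(2), of t] g(1) assms by (cases "t = x") (force simp: bounded_by_def dest: le_trans)+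
  qed
  then show "a \<in> upset G" using g by (auto simp: upset_def)
next
  assume "a \<in> upset G"
  then obtain g where "g \<in> G" "g \<le> a" by (auto simp: upset_def)
  then show "a \<in> upset (drop_var x G)"
    by (auto simp: upset_def drop_var_def le_fun_def intro!: bexI[of _ g])
qed

text \<open>The variable x no longer occurs in \<open>drop_var x G\<close>, which makes it infinite
  in the corners. Conversely, no generator exceeds D, so for \<open>a x \<ge> D\<close> the two
  upsets cannot be told apart.\<close>

lemma corner_drop_var:
  assumes "bounded_by D G"
  shows "corner D (drop_var x G) a \<longleftrightarrow> corner D G a \<and> a x \<ge> D"
proof -
  have "supported_in (UNIV - {x}) (drop_var x G)" by (auto simp: supported_in_def drop_var_def)
  then have 1: "a x \<ge> D" if "corner D (drop_var x G) a" using corner_ge[OF that, of "UNIV - {x}" x] by (simp add: \<open>supported_in _ _\<close>)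
  have 2: "corner D (drop_var x G) a \<longleftrightarrow> corner D G a" if x: "a x \<ge> D"
  proof -
    have "a(s := Suc (a s)) \<in> upset (drop_var x G) \<longleftrightarrow> a(s := Suc (a s)) \<in> upset G" for s
      by (rule upset_drop_var[OF assms]) (use x in auto)
    then show ?thesis using upset_drop_var[OF assms, of a x] x by (simp add: corner_def)
  qed
  from 1 2 show ?thesis by blast
qed

text \<open>Height \<open>\<alpha> x - 1\<close> in direction x is the last one below \<alpha>. Only
  generators with smaller x-exponent can divide there, and these are the ones kept in the link. The
  x-coordinate of \<open>b\<close> is overwritten, so the link does not see it.\<close>

lemma upset_link:
  assumes "\<alpha> x > 0"
  shows "b \<in> upset (link x \<alpha> G) \<longleftrightarrow> (\<lambda>s. b s + \<alpha> s)(x := \<alpha> x - 1) \<in> upset G"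
proof
  assume "b \<in> upset (link x \<alpha> G)"
  then obtain g where g: "g \<in> G" "g x < \<alpha> x" "(\<lambda>s. g s - \<alpha> s)(x := 0) \<le> b"
    by (auto simp: upset_def link_def)
  have "g \<le> (\<lambda>s. b s + \<alpha> s)(x := \<alpha> x - 1)"
  proof (rule le_funI)
    fix t show "g t \<le> ((\<lambda>s. b s + \<alpha> s)(x := \<alpha> x - 1)) t"
      using le_funD[OF g(3), of t] g(2) by (cases "t = x") auto
  qed
  then show "(\<lambda>s. b s + \<alpha> s)(x := \<alpha> x - 1) \<in> upset G" using g by (auto simp: upset_def)
next
  assume "(\<lambda>s. b s + \<alpha> s)(x := \<alpha> x - 1) \<in> upset G"
  then obtain g where g: "g \<in> G" "g \<le> (\<lambda>s. b s + \<alpha> s)(x := \<alpha> x - 1)" by (auto simp: upset_def)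
  have "g x < \<alpha> x" using le_funD[OF g(2), of x] assms by auto
  moreover have "(\<lambda>s. g s - \<alpha> s)(x := 0) \<le> b"
  proof (rule le_funI)
    fix t show "((\<lambda>s. g s - \<alpha> s)(x := 0)) t \<le> b t"
      using le_funD[OF g(2), of t] by (cases "t = x") auto
  qed
  ultimately show "b \<in> upset (link x \<alpha> G)" using g by (auto simp: upset_def link_def)
qed

text \<open>Adding \<alpha> back must not turn a finite coordinate into an infinite one. The
  generator behind the element stopping \<open>b\<close> in direction s has an exponent above
  \<open>b s + \<alpha> s\<close>, and that exponent is at most D.\<close>

lemma corner_link_less:
  assumes "bounded_by D G" "corner D (link x \<alpha> G) b" "b s < D"
  shows "b s + \<alpha> s < D"
proof -
  have "b(s := Suc (b s)) \<in> upset (link x \<alpha> G)" using assms by (auto simp: corner_def)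
  then obtain h where h: "h \<in> link x \<alpha> G" "h \<le> b(s := Suc (b s))" by (auto simp: upset_def)
  have "\<not> h \<le> b" using assms h by (auto simp: corner_def upset_def)
  then obtain t where "h t > b t" by (auto simp: le_fun_def not_le)
  moreover have "h t \<le> (b(s := Suc (b s))) t" using h(2) by (rule le_funD)
  ultimately have hs: "h s > b s" by (cases "t = s") auto
  obtain g where g: "g \<in> G" "h = (\<lambda>s. g s - \<alpha> s)(x := 0)" using h by (auto simp: link_def)
  have "g s - \<alpha> s > b s" using hs g by (cases "s = x") auto
  moreover have "g s \<le> D" using g assms by (auto simp: bounded_by_def)
  ultimately show ?thesis by linarith
qed

text \<open>Direction x is stopped by \<alpha> itself, any other finite direction by the generator
  that stops \<open>b\<close> in the link. Since x is infinite in \<open>b\<close>, the size grows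
  by exactly one.\<close>

lemma corner_of_link:
  assumes "bounded_by D G" "\<alpha> \<in> G" "\<alpha> x > 0" and b: "corner D (link x \<alpha> G) b"
  defines "a \<equiv> (\<lambda>s. b s + \<alpha> s)(x := \<alpha> x - 1)"
  shows "corner D G a" "low D a = insert x (low D b)" "x \<notin> low D b"
proof -
  have bx: "b x \<ge> D"
    using corner_ge[OF b, of "UNIV - {x}" x] by (auto simp: supported_in_def link_def)
  have aD: "\<alpha> x \<le> D" using assms by (auto simp: bounded_by_def)
  have lw: "a s < D \<longleftrightarrow> b s < D" if "s \<noteq> x" for s
    using corner_link_less[OF assms(1) b, of s] that by (auto simp: a_def)
  show "corner D G a"
    unfolding corner_def
  proof (intro conjI allI impI)
    show "a \<notin> upset G"
      using b upset_link[of \<alpha> x b G, OF assms(3)] by (simp add: corner_def a_def)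
    fix s assume s: "a s < D"
    show "a(s := Suc (a s)) \<in> upset G"
    proof (cases "s = x")
      case True
      have "\<alpha> \<le> a(s := Suc (a s))" using True assms(3) by (auto simp: a_def le_fun_def)
      then show ?thesis using assms(2) by (auto simp: upset_def)
    next
      case False
      then have "b(s := Suc (b s)) \<in> upset (link x \<alpha> G)" using lw s b by (auto simp: corner_def)
      then have "(\<lambda>t. (b(s := Suc (b s))) t + \<alpha> t)(x := \<alpha> x - 1) \<in> upset G"
        using upset_link[of \<alpha> x "b(s := Suc (b s))" G] False assms(3) by simp
      also have "(\<lambda>t. (b(s := Suc (b s))) t + \<alpha> t)(x := \<alpha> x - 1) = a(s := Suc (a s))"
        using False by (auto simp: a_def)
      finally show ?thesis .
    qed
  qed
  show "low D a = insert x (low D b)" using lw aD assms(3) by (auto simp: low_def a_def)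
  show "x \<notin> low D b" using bx by (simp add: low_def)
qed

lemma corner_over:
  assumes "corner D G a" "a x < D"
  obtains \<alpha> where "\<alpha> \<in> G" "\<alpha> x = Suc (a x)" "\<alpha> \<le> a(x := Suc (a x))"
proof -
  have "a(x := Suc (a x)) \<in> upset G" using assms by (auto simp: corner_def)
  then obtain \<alpha> where \<alpha>: "\<alpha> \<in> G" "\<alpha> \<le> a(x := Suc (a x))" by (auto simp: upset_def)
  have "\<not> \<alpha> \<le> a" using assms \<alpha> by (auto simp: corner_def upset_def)
  then obtain t where "\<alpha> t > a t" by (auto simp: le_fun_def not_le)
  then have "\<alpha> x = Suc (a x)" using le_funD[OF \<alpha>(2), of t] le_funD[OF \<alpha>(2), of x]
    by (cases "t = x") auto
  then show ?thesis using that \<alpha> by blast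
qed

text \<open>Converse passage to \<open>corner_of_link\<close>: off x, \<alpha> divides the corner it
  stops, so it can be subtracted from the finite coordinates without truncation.\<close>

lemma corner_to_link:
  assumes "bounded_by D G" and a: "corner D G a" and "a x < D"
    and \<alpha>: "\<alpha> \<in> G" "\<alpha> \<le> a(x := Suc (a x))" and ax: "\<alpha> x = Suc (a x)"
  obtains b where "corner D (link x \<alpha> G) b" "low D a = insert x (low D b)" "x \<notin> low D b"
proof -
  have al: "\<alpha> s \<le> a s" if "s \<noteq> x" for s using le_funD[OF \<alpha>(2), of s] that by auto
  \<comment> \<open>Infinite coordinates are reset to D, because subtracting \<alpha> could bring
    them below D.\<close>
  define b where "b = (\<lambda>s. if s = x \<or> a s \<ge> D then D else a s - \<alpha> s)"
  \<comment> \<open>The case k = 0 will show that \<open>b\<close> is outside the link, k = 1 that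
    its finite directions are stopped. The vectors compared may differ in infinite coordinates, but
    generators with exponents at most D do not notice.\<close>
  have key: "(b(s := b s + k)) \<in> upset (link x \<alpha> G) \<longleftrightarrow> a(s := a s + k) \<in> upset G"
    if s: "s \<noteq> x" "a s < D \<or> k = 0" for s k
  proof -
    let ?c = "(\<lambda>t. (b(s := b s + k)) t + \<alpha> t)(x := \<alpha> x - 1)"
    have "(b(s := b s + k)) \<in> upset (link x \<alpha> G) \<longleftrightarrow> ?c \<in> upset G"
      by (rule upset_link) (use ax in auto)
    also have "\<dots> \<longleftrightarrow> a(s := a s + k) \<in> upset G"
    proof -
      have "g \<le> ?c \<longleftrightarrow> g \<le> a(s := a s + k)" if "g \<in> G" for g
      proof -
        have gD: "g t \<le> D" for t using that assms by (auto simp: bounded_by_def)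
        have "g t \<le> ?c t \<longleftrightarrow> g t \<le> (a(s := a s + k)) t" for t
          using al[of t] gD[of t] s ax by (auto simp: b_def)
        then show ?thesis by (simp add: le_fun_def del: fun_upd_apply)
      qed
      then show ?thesis by (auto simp: upset_def)
    qed
    finally show ?thesis .
  qed
  have lw: "b s < D \<longleftrightarrow> s \<noteq> x \<and> a s < D" for s by (auto simp: b_def)
  have "corner D (link x \<alpha> G) b"
    unfolding corner_def
  proof (intro conjI allI impI)
    show "b \<notin> upset (link x \<alpha> G)"
    \<comment> \<open>\<open>key\<close> has to name a coordinate other than x, hence the separate
      case of a single variable.\<close>
    proof (cases "\<exists>s. s \<noteq> x")
      case True
      then obtain s where "s \<noteq> x" by blast
      from key[of s 0] this show ?thesis using a by (simp add: corner_def)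
    next
      case False
      have "(\<lambda>s. b s + \<alpha> s)(x := \<alpha> x - 1) = a"
      proof
        fix s have "s = x" using False by blast
        then show "((\<lambda>s. b s + \<alpha> s)(x := \<alpha> x - 1)) s = a s" using ax by simp
      qed
      then show ?thesis using upset_link[of \<alpha> x b G] ax a by (simp add: corner_def)
    qed
    fix s assume "b s < D"
    then have s: "s \<noteq> x" "a s < D" using lw by auto
    then show "b(s := Suc (b s)) \<in> upset (link x \<alpha> G)"
      using key[of s 1] a by (simp add: corner_def)
  qed
  moreover have "low D a = insert x (low D b)" "x \<notin> low D b" using lw assms(3) by (auto simp: low_def)
  ultimately show ?thesis using that by blast
qed

text \<open>Two adjacent corners: raising the \<open>x\<close>-exponent across \<open>\<alpha>\<close> is paid for by lowering the
  \<open>y\<close>-exponent just below that of \<open>\<alpha>\<close>. Genericity guarantees that the generators blocking the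
  other directions survive this exchange.\<close>

lemma adjacent_corners:
  fixes G :: "('n::finite \<Rightarrow> nat) set"
  assumes gen: "generic G" and bnd: "bounded_by D G"
    and \<alpha>: "\<alpha> \<in> G" "\<alpha> x > 0" "\<alpha> y > 0" "y \<noteq> x" and ne: "(\<lambda>_. 0) \<notin> link x \<alpha> G"
  obtains a b W where "corner D (link x \<alpha> G) a" "x \<notin> W" "y \<notin> W" "low D a = W \<or> low D a = insert y W"
    "corner D G b" "b x \<ge> \<alpha> x" "low D b = insert y W \<or> low D b = insert x (insert y W)"
proof -
  let ?J = "link x \<alpha> G" and ?I = "{g \<in> link x \<alpha> G. g y = 0}"
  \<comment> \<open>The part of the link free of y involves neither x nor y, so both are infinite in
    its corner f. The finite directions W of f are shared by the two corners to be built.\<close>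
  obtain f where f: "corner D ?I f" using corner_exists[of ?I D] ne by auto
  have "supported_in (UNIV - {x, y}) ?I" by (auto simp: supported_in_def link_def)
  then have fxy: "f x \<ge> D" "f y \<ge> D" using corner_ge[OF f] by blast+
  define W where "W = low D f"
  have xyW: "x \<notin> W" "y \<notin> W" using fxy by (auto simp: W_def low_def)
  have f_notin: "f \<notin> upset ?I" and f_step: "\<And>s. f s < D \<Longrightarrow> f(s := Suc (f s)) \<in> upset ?I"
    using f by (auto simp: corner_def)
  have \<alpha>D: "\<alpha> s \<le> D" for s using bnd \<alpha>(1) by (auto simp: bounded_by_def)
  \<comment> \<open>Source of the contradictions below: such a generator c yields an element of the
    link that is free of y and lies below f, whereas f is a corner of that part.\<close>
  have J0_I: "f \<in> upset ?I" if "c \<in> G" "c x < \<alpha> x" "c y \<le> \<alpha> y"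
    "\<And>t. t \<noteq> x \<Longrightarrow> t \<noteq> y \<Longrightarrow> c t \<le> f t + \<alpha> t" for c
  proof -
    have "(\<lambda>s. c s - \<alpha> s)(x := 0) \<in> ?I" using that by (auto simp: link_def)
    moreover have "(\<lambda>s. c s - \<alpha> s)(x := 0) \<le> f"
    proof (rule le_funI)
      fix t show "((\<lambda>s. c s - \<alpha> s)(x := 0)) t \<le> f t"
        using that(3) that(4)[of t] by (cases "t = x"; cases "t = y") auto
    qed
    ultimately show ?thesis by (auto simp: upset_def)
  qed

  \<comment> \<open>The corner of the link arises from f by lowering y to the largest
    \<open>i \<le> D\<close> that stays outside the link; \<open>i = D\<close> leaves y
    infinite.\<close>
  have ex1: "\<exists>i. (i \<le> D \<and> f(y := i) \<notin> upset ?J) \<and> (\<forall>i'. i' \<le> D \<and> f(y := i') \<notin> upset ?J \<longrightarrow> i' \<le> i)"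
  proof (rule ex_has_greatest_nat[where f = "\<lambda>i. i" and k = 0 and b = "Suc D"])
    show "0 \<le> D \<and> f(y := 0) \<notin> upset ?J"
    proof (intro conjI notI)
      assume "f(y := 0) \<in> upset ?J"
      then obtain g where g: "g \<in> ?J" "g \<le> f(y := 0)" by (auto simp: upset_def)
      have "g y = 0" using le_funD[OF g(2), of y] by simp
      moreover have "g \<le> f"
      proof (rule le_funI)
        fix t show "g t \<le> f t" using le_funD[OF g(2), of t] by (cases "t = y") auto
      qed
      ultimately show False using g f_notin by (auto simp: upset_def)
    qed simp
  qed auto
  then obtain i where i: "i \<le> D" "f(y := i) \<notin> upset ?J"
    and i_max: "\<And>i'. i' \<le> D \<Longrightarrow> f(y := i') \<notin> upset ?J \<Longrightarrow> i' \<le> i" by blast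
  define a where "a = f(y := i)"
  have a: "corner D ?J a"
    unfolding corner_def
  proof (intro conjI allI impI)
    show "a \<notin> upset ?J" using i by (simp add: a_def)
    fix s assume s: "a s < D"
    show "a(s := Suc (a s)) \<in> upset ?J"
    proof (cases "s = y")
      case True
      then have "a(s := Suc (a s)) = f(y := Suc i)" by (simp add: a_def)
      moreover have "f(y := Suc i) \<in> upset ?J" using i_max[of "Suc i"] s True by (auto simp: a_def)
      ultimately show ?thesis by simp
    next
      case False
      then have "f s < D" using s by (simp add: a_def)
      from f_step[OF this] obtain g where g: "g \<in> ?J" "g y = 0" "g \<le> f(s := Suc (f s))"
        by (auto simp: upset_def)
      have "g \<le> a(s := Suc (a s))"
      proof (rule le_funI)
        fix t show "g t \<le> (a(s := Suc (a s))) t"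
          using le_funD[OF g(3), of t] g(2) False by (cases "t = y") (auto simp: a_def split: if_splits)
      qed
      then show ?thesis using g by (auto simp: upset_def)
    qed
  qed
  have low_a: "low D a = W \<or> low D a = insert y W"
  proof (cases "i < D")
    case True
    then have "low D a = insert y W" using fxy by (auto simp: a_def low_def W_def split: if_splits)
    then show ?thesis ..
  next
    case False
    then have "low D a = W" using fxy by (auto simp: a_def low_def W_def split: if_splits)
    then show ?thesis ..
  qed

  \<comment> \<open>Multiply back by \<alpha>, stay one below \<alpha> in y, and let x rise from
    \<open>\<alpha> x\<close>: whatever the height k, \<alpha> does not divide, and it stops
    direction y.\<close>
  define h where "h k = (\<lambda>s. f s + \<alpha> s)(y := \<alpha> y - 1, x := k)" for k
  have ex2: "\<exists>k. (\<alpha> x \<le> k \<and> k \<le> D \<and> h k \<notin> upset G) \<and>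
      (\<forall>k'. \<alpha> x \<le> k' \<and> k' \<le> D \<and> h k' \<notin> upset G \<longrightarrow> k' \<le> k)"
  proof (rule ex_has_greatest_nat[where f = "\<lambda>i. i" and k = "\<alpha> x" and b = "Suc D"])
    have "h (\<alpha> x) \<notin> upset G"
    proof
      assume "h (\<alpha> x) \<in> upset G"
      then obtain g where g: "g \<in> G" "g \<le> h (\<alpha> x)" by (auto simp: upset_def)
      have gx: "g x \<le> \<alpha> x" using le_funD[OF g(2), of x] by (simp add: h_def)
      have gy: "g y < \<alpha> y" using le_funD[OF g(2), of y] \<alpha> by (simp add: h_def)
      have gt: "g t \<le> f t + \<alpha> t" if "t \<noteq> x" "t \<noteq> y" for t
        using le_funD[OF g(2), of t] that by (simp add: h_def)
      show False
      proof (cases "g x < \<alpha> x")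
        case True
        then show False using J0_I[of g] g gy gt f_notin by auto
      next
        case False
        \<comment> \<open>A generator with the x-exponent of \<alpha> is traded by genericity for
          one strictly below \<alpha> in x, to which \<open>J0_I\<close> applies.\<close>
        then have "g x = \<alpha> x" using gx by simp
        moreover have "g \<noteq> \<alpha>" using gy by auto
        ultimately obtain c where c: "c \<in> G" "\<And>t. c t < max (g t) (\<alpha> t) \<or> c t = 0"
          using genericE[OF gen g(1) \<alpha>(1), of x] \<alpha> by metis
        have "c x < \<alpha> x" using c(2)[of x] \<open>g x = \<alpha> x\<close> \<alpha> by auto
        moreover have "c y \<le> \<alpha> y" using c(2)[of y] gy by auto
        moreover have "c t \<le> f t + \<alpha> t" if "t \<noteq> x" "t \<noteq> y" for t
          using c(2)[of t] gt[OF that] by auto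
        ultimately show False using J0_I[of c] c f_notin by auto
      qed
    qed
    then show "\<alpha> x \<le> \<alpha> x \<and> \<alpha> x \<le> D \<and> h (\<alpha> x) \<notin> upset G" using \<alpha>D by simp
  qed auto
  then obtain k where k: "\<alpha> x \<le> k" "k \<le> D" "h k \<notin> upset G"
    and k_max: "\<And>k'. \<alpha> x \<le> k' \<Longrightarrow> k' \<le> D \<Longrightarrow> h k' \<notin> upset G \<Longrightarrow> k' \<le> k" by blast
  \<comment> \<open>The directions in W are stopped by the generators that stop f. Such a generator
    must lie strictly below \<alpha> in y to divide here; if it had the same y-exponent, genericity
    against \<alpha> would produce a generator contradicting \<open>J0_I\<close>.\<close>
  have less: "f s + \<alpha> s < D" and blocked: "(h k)(s := Suc (h k s)) \<in> upset G"
    if s: "f s < D" "s \<noteq> x" "s \<noteq> y" for s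
  proof -
    from f_step[OF s(1)] obtain e where e: "e \<in> ?I" "e \<le> f(s := Suc (f s))" by (auto simp: upset_def)
    then obtain g where g: "g \<in> G" "g x < \<alpha> x" "e = (\<lambda>s. g s - \<alpha> s)(x := 0)" by (auto simp: link_def)
    have gy: "g y \<le> \<alpha> y" using e g s \<alpha> by auto
    have gs: "g s \<le> Suc (f s + \<alpha> s)" using le_funD[OF e(2), of s] g(3) s by auto
    have gt: "g t \<le> f t + \<alpha> t" if "t \<noteq> x" "t \<noteq> s" for t
      using le_funD[OF e(2), of t] g(3) that by auto
    have gs': "g s = Suc (f s + \<alpha> s)"
    proof (rule ccontr)
      assume "g s \<noteq> Suc (f s + \<alpha> s)"
      then have "g t \<le> f t + \<alpha> t" if "t \<noteq> x" for t using gt[of t] gs that by (cases "t = s") auto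
      then show False using J0_I[of g] g gy f_notin by auto
    qed
    moreover have "g s \<le> D" using bnd g(1) by (auto simp: bounded_by_def)
    ultimately show "f s + \<alpha> s < D" by simp
    have gy': "g y < \<alpha> y"
    proof (rule ccontr)
      assume "\<not> g y < \<alpha> y"
      then have "g y = \<alpha> y" using gy by simp
      moreover have "g \<noteq> \<alpha>" using g by auto
      ultimately obtain c where c: "c \<in> G" "\<And>t. c t < max (g t) (\<alpha> t) \<or> c t = 0"
        using genericE[OF gen g(1) \<alpha>(1), of y] \<alpha> by metis
      have "c x < \<alpha> x" using c(2)[of x] g(2) \<alpha> by auto
      moreover have "c y \<le> \<alpha> y" using c(2)[of y] gy by auto
      moreover have "c t \<le> f t + \<alpha> t" if "t \<noteq> x" for t
        using c(2)[of t] gt[of t] gs' that by (cases "t = s") auto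
      ultimately show False using J0_I[of c] c f_notin by auto
    qed
    have "g \<le> (h k)(s := Suc (h k s))"
    proof (rule le_funI)
      fix t show "g t \<le> ((h k)(s := Suc (h k s))) t"
        using gt[of t] gs gy' g(2) k(1) s by (cases "t = x"; cases "t = y"; cases "t = s") (auto simp: h_def)
    qed
    then show "(h k)(s := Suc (h k s)) \<in> upset G" using g by (auto simp: upset_def)
  qed
  have b: "corner D G (h k)"
    unfolding corner_def
  proof (intro conjI allI impI)
    show "h k \<notin> upset G" by fact
    fix s assume s: "h k s < D"
    consider "s = x" | "s = y" | "s \<noteq> x" "s \<noteq> y" by blast
    then show "(h k)(s := Suc (h k s)) \<in> upset G"
    proof cases
      case 1
      then have "(h k)(s := Suc (h k s)) = h (Suc k)" by (auto simp: h_def)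
      moreover have "h (Suc k) \<in> upset G" using k_max[of "Suc k"] k s 1 by (auto simp: h_def)
      ultimately show ?thesis by simp
    next
      case 2
      have "\<alpha> \<le> (h k)(s := Suc (h k s))"
      proof (rule le_funI)
        fix t show "\<alpha> t \<le> ((h k)(s := Suc (h k s))) t"
          using 2 k(1) \<alpha> by (cases "t = x"; cases "t = y") (auto simp: h_def)
      qed
      then show ?thesis using \<alpha>(1) by (auto simp: upset_def)
    next
      case 3
      then have "f s < D" using s by (auto simp: h_def)
      then show ?thesis using blocked 3 by blast
    qed
  qed
  have mem: "s \<in> low D (h k) \<longleftrightarrow> s \<in> W" if "s \<noteq> x" "s \<noteq> y" for s
    using less[of s] that by (auto simp: low_def W_def h_def)
  have memy: "y \<in> low D (h k)" using \<alpha>D[of y] \<alpha> by (auto simp: low_def h_def)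
  have "low D (h k) = (if x \<in> low D (h k) then insert x (insert y W) else insert y W)"
  proof (rule Set.set_eqI)
    fix s show "s \<in> low D (h k) \<longleftrightarrow>
        s \<in> (if x \<in> low D (h k) then insert x (insert y W) else insert y W)"
      using mem[of s] memy xyW by (cases "s = x"; cases "s = y") auto
  qed
  then have "low D (h k) = insert y W \<or> low D (h k) = insert x (insert y W)"
    by presburger
  then show ?thesis using that[OF a xyW low_a b] k(1) by (simp add: h_def)
qed

section \<open>Corners on the two sides of a size threshold\<close>

definition step_at :: "nat \<Rightarrow> nat \<Rightarrow> ('n \<Rightarrow> nat) set \<Rightarrow> bool" where
  "step_at D i G \<longleftrightarrow> (\<exists>a b s. corner D G a \<and> corner D G b \<and> card (low D a) = i \<and>
     s \<in> low D a \<and> low D b = low D a - {s})"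

lemma step_atI:
  fixes G :: "('n::finite \<Rightarrow> nat) set"
  assumes "corner D G a" "corner D G b" "low D a = insert s (low D b)" "s \<notin> low D b"
    "(i \<le> card (low D a)) \<noteq> (i \<le> card (low D b))"
  shows "step_at D i G"
proof -
  have "card (low D a) = Suc (card (low D b))" using assms(3,4) by simp
  then have "card (low D a) = i" using assms(5) by auto
  then show ?thesis using assms unfolding step_at_def by (intro exI[of _ a] exI[of _ b] exI[of _ s]) auto
qed

text \<open>Induction over V. By the induction hypothesis the corners of one link are on the same
  side of the threshold. \<open>adjacent_corners\<close> links them to a corner with larger
  x-coordinate, and the sizes of the two corners can fall on different sides of i only if they form
  a step. Iterating leads to corners where x is infinite or the stopping generator is a pure power
  of x, and these are compared directly.\<close>

lemma corners_connected:
  fixes G :: "('n::finite \<Rightarrow> nat) set"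
  assumes "generic G" "bounded_by D G" "supported_in V G" "\<not> step_at D i G"
    "corner D G a" "corner D G b"
  shows "i \<le> card (low D a) \<longleftrightarrow> i \<le> card (low D b)"
proof -
  have "finite V" by simp
  then show ?thesis using assms
  proof (induction V arbitrary: G i a b)
    case empty
    then show ?case using low_subset by fastforce
  next
    case (insert x V)
    note gen = insert.prems(1) and bnd = insert.prems(2) and ns = insert.prems(4)
    have supp: "supported_in V (drop_var x G)" "supported_in V (link x \<alpha> G)" for \<alpha>
      using supported_drop_var[OF insert.prems(3), of x] supported_link[OF insert.prems(3), of x] insert.hyps
      by (simp_all add: supported_in_def)
    define big where "big c \<longleftrightarrow> i \<le> card (low D c)" for c :: "'n \<Rightarrow> nat"
    have top: "big c \<longleftrightarrow> big c'"
      if c: "corner D G c" "c x \<ge> D" "corner D G c'" "c' x \<ge> D" for c c'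
    proof -
      have "\<not> step_at D i (drop_var x G)"
        using ns corner_drop_var[OF bnd] unfolding step_at_def by blast
      then show ?thesis
        using insert.IH[OF generic_drop_var[OF gen] bounded_drop_var[OF bnd] supp(1)]
          corner_drop_var[OF bnd] c unfolding big_def by blast
    qed
    \<comment> \<open>Corners of a link become corners of G after adding x to their finite set, so
      the induction hypothesis is used at i - 1. Writing \<open>Suc\<close> on the size covers i = 0
      as well.\<close>
    have star: "i \<le> Suc (card (low D c)) \<longleftrightarrow> i \<le> Suc (card (low D c'))"
      if \<alpha>: "\<alpha> \<in> G" "\<alpha> x > 0" and c: "corner D (link x \<alpha> G) c" "corner D (link x \<alpha> G) c'" for \<alpha> c c'
    proof -
      have "\<not> step_at D (i - 1) (link x \<alpha> G)" if "i > 0"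
      proof
        assume "step_at D (i - 1) (link x \<alpha> G)"
        then obtain p q s where pq: "corner D (link x \<alpha> G) p" "corner D (link x \<alpha> G) q"
          "card (low D p) = i - 1" "s \<in> low D p" "low D q = low D p - {s}"
          unfolding step_at_def by blast
        define p' where "p' = (\<lambda>s. p s + \<alpha> s)(x := \<alpha> x - 1)"
        define q' where "q' = (\<lambda>s. q s + \<alpha> s)(x := \<alpha> x - 1)"
        note p' = corner_of_link[OF bnd \<alpha> pq(1), folded p'_def]
        note q' = corner_of_link[OF bnd \<alpha> pq(2), folded q'_def]
        have "s \<noteq> x" using p'(3) pq(4) by auto
        have "step_at D i G"
          unfolding step_at_def
        proof (intro exI conjI)
          show "corner D G p'" "corner D G q'" by fact+
          show "card (low D p') = i" using p' pq(3) that by simp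
          show "s \<in> low D p'" using p' pq by simp
          show "low D q' = low D p' - {s}" using p' q' pq \<open>s \<noteq> x\<close> by auto
        qed
        then show False using ns by simp
      qed
      then have "i > 0 \<Longrightarrow> i - 1 \<le> card (low D c) \<longleftrightarrow> i - 1 \<le> card (low D c')"
        using insert.IH[OF generic_link[OF gen] bounded_link[OF bnd] supp(2)] c by blast
      then show ?thesis by (cases i) auto
    qed
    \<comment> \<open>The stopping generator has no second variable, so no exchange is possible at
      such a corner.\<close>
    define final where "final c \<longleftrightarrow> (\<exists>\<alpha>\<in>G. (\<forall>s. s \<noteq> x \<longrightarrow> \<alpha> s = 0) \<and> \<alpha> x = Suc (c x))" for c :: "'n \<Rightarrow> nat"
    have reach: "\<exists>c'. corner D G c' \<and> (c' x \<ge> D \<or> final c') \<and> (big c' \<longleftrightarrow> big c)" if "corner D G c" for c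
      using that
    proof (induction "D - c x" arbitrary: c rule: less_induct)
      case less
      show ?case
      proof (cases "c x \<ge> D")
        case True
        then show ?thesis using less.prems by blast
      next
        case False
        then have cx: "c x < D" by simp
        obtain \<alpha> where \<alpha>: "\<alpha> \<in> G" "\<alpha> x = Suc (c x)" "\<alpha> \<le> c(x := Suc (c x))"
          using corner_over[OF less.prems cx] by blast
        obtain p where p: "corner D (link x \<alpha> G) p"
          "low D c = insert x (low D p)" "x \<notin> low D p"
          using corner_to_link[OF bnd less.prems cx \<alpha>(1,3,2)] by blast
        show ?thesis
        proof (cases "\<exists>y. y \<noteq> x \<and> \<alpha> y > 0")
          case False
          then have "final c" using \<alpha> by (auto simp: final_def)
          then show ?thesis using less.prems by blast
        next
          case True
          then obtain y where y: "\<alpha> y > 0" "y \<noteq> x" by blast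
          have "(\<lambda>_. 0) \<notin> link x \<alpha> G" using p(1) by (auto simp: corner_def upset_def le_fun_def)
          then obtain q b W where q: "corner D (link x \<alpha> G) q" and W: "x \<notin> W" "y \<notin> W"
            and lq: "low D q = W \<or> low D q = insert y W"
            and b: "corner D G b" "b x \<ge> \<alpha> x"
            and lb: "low D b = insert y W \<or> low D b = insert x (insert y W)"
            using adjacent_corners[OF gen bnd \<alpha>(1) _ y] \<alpha>(2) by (metis zero_less_Suc)
          define q' where "q' = (\<lambda>s. q s + \<alpha> s)(x := \<alpha> x - 1)"
          note q' = corner_of_link[OF bnd \<alpha>(1) _ q, folded q'_def]
          have q': "corner D G q'" "low D q' = insert x (low D q)" "x \<notin> low D q"
            using q' \<alpha>(2) by auto
          have "big c \<longleftrightarrow> big q'"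
            using star[OF \<alpha>(1) _ p(1) q] \<alpha>(2) p q' by (simp add: big_def)
          also have "big q' \<longleftrightarrow> big b"
          proof (rule ccontr)
            assume ne: "\<not> (big q' \<longleftrightarrow> big b)"
            have cW: "card (insert x W) = Suc (card W)" "card (insert y W) = Suc (card W)"
              "card (insert x (insert y W)) = Suc (Suc (card W))"
              using W y by auto
            \<comment> \<open>Besides W, q' is finite in x and perhaps in y, and b is finite in y
              and perhaps in x. So the sizes agree, or one finite set is the other with one more
              element.\<close>
            consider (1) "low D q' = insert x W" "low D b = insert x (insert y W)"
              | (2) "low D q' = insert x (insert y W)" "low D b = insert y W"
              | (3) "card (low D q') = card (low D b)"
              using lq lb q'(2) cW by (metis (no_types))
            then show False
            proof cases
              case 1
              have "step_at D i G"
                by (rule step_atI[OF b(1) q'(1), of y]) (use 1 W y ne in \<open>auto simp: big_def\<close>)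
              then show False using ns by simp
            next
              case 2
              have "step_at D i G"
                by (rule step_atI[OF q'(1) b(1), of x]) (use 2 W y ne in \<open>auto simp: big_def\<close>)
              then show False using ns by simp
            next
              case 3
              then show False using ne by (simp add: big_def)
            qed
          qed
          finally have cb: "big c \<longleftrightarrow> big b" .
          have "D - b x < D - c x" using b(2) \<alpha>(2) False \<open>\<not> c x \<ge> D\<close> by auto
          from less.hyps[OF this b(1)] show ?thesis using cb by simp
        qed
      qed
    qed
    have pure_gt: "c x < \<alpha> x" if "corner D G c" "\<alpha> \<in> G" "\<forall>s. s \<noteq> x \<longrightarrow> \<alpha> s = 0" for c \<alpha>
    proof (rule ccontr)
      assume "\<not> c x < \<alpha> x"
      then have "\<alpha> \<le> c" using that(3) by (simp add: le_fun_def) (metis not_le zero_le)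
      then show False using that by (auto simp: corner_def upset_def)
    qed
    \<comment> \<open>A pure power of x in G makes x finite in every corner, so both corners are
      final; without one, both are infinite in x.\<close>
    have same: "big c \<longleftrightarrow> big c'"
      if c: "corner D G c" "corner D G c'" "c x \<ge> D \<or> final c" "c' x \<ge> D \<or> final c'" for c c'
    proof (cases "\<exists>\<alpha>\<in>G. \<forall>s. s \<noteq> x \<longrightarrow> \<alpha> s = 0")
      case False
      then have "\<not> final c" "\<not> final c'" by (auto simp: final_def)
      then show ?thesis using top c by blast
    next
      case True
      then obtain \<beta> where "\<beta> \<in> G" "\<forall>s. s \<noteq> x \<longrightarrow> \<beta> s = 0" by blast
      moreover from this have "\<beta> x \<le> D" using bnd by (auto simp: bounded_by_def)
      ultimately have "c x < D" "c' x < D"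
        using pure_gt[OF c(1), of \<beta>] pure_gt[OF c(2), of \<beta>] by auto
      then obtain \<alpha> \<alpha>' where \<alpha>: "\<alpha> \<in> G" "\<forall>s. s \<noteq> x \<longrightarrow> \<alpha> s = 0" "\<alpha> x = Suc (c x)"
        and \<alpha>': "\<alpha>' \<in> G" "\<forall>s. s \<noteq> x \<longrightarrow> \<alpha>' s = 0" "\<alpha>' x = Suc (c' x)"
        using c by (auto simp: final_def)
      \<comment> \<open>Each pure power exceeds both coordinates, and each coordinate is one below
        its own power. Hence a single \<alpha> stops both corners, and they come from the same
        link.\<close>
      have "c x = c' x" using pure_gt[OF c(1) \<alpha>'(1,2)] pure_gt[OF c(2) \<alpha>(1,2)] \<alpha>(3) \<alpha>'(3) by simp
      have "\<alpha> \<le> c(x := Suc (c x))" "\<alpha> \<le> c'(x := Suc (c' x))"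
        using \<alpha>(2,3) \<open>c x = c' x\<close> by (simp_all add: le_fun_def)
      obtain p p' where "corner D (link x \<alpha> G) p" "low D c = insert x (low D p)" "x \<notin> low D p"
        "corner D (link x \<alpha> G) p'" "low D c' = insert x (low D p')" "x \<notin> low D p'"
        using corner_to_link[OF bnd c(1) \<open>c x < D\<close> \<alpha>(1) \<open>\<alpha> \<le> c(x := Suc (c x))\<close> \<alpha>(3)]
          corner_to_link[OF bnd c(2) \<open>c' x < D\<close> \<alpha>(1) \<open>\<alpha> \<le> c'(x := Suc (c' x))\<close>] \<alpha>(3) \<open>c x = c' x\<close>
        by (metis (no_types))
      then show ?thesis using star[OF \<alpha>(1) _, of p p'] \<alpha>(3) by (simp add: big_def)
    qed
    obtain a' where "corner D G a'" "a' x \<ge> D \<or> final a'" "big a' \<longleftrightarrow> big a"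
      using reach[OF insert.prems(5)] by blast
    moreover obtain b' where "corner D G b'" "b' x \<ge> D \<or> final b'" "big b' \<longleftrightarrow> big b"
      using reach[OF insert.prems(6)] by blast
    ultimately show ?case using same[of a' b'] by (simp add: big_def)
  qed
qed

section \<open>Finite free resolutions\<close>

declare plus_fun_apply [simp del] zero_fun_apply [simp del]

text \<open>Vectors are sequences over the ring, with pointwise addition. One type thus contains
  free modules of all finite ranks, and an induction along a resolution need not change
  types.\<close>

definition scale :: "'a::comm_ring_1 \<Rightarrow> (nat \<Rightarrow> 'a) \<Rightarrow> nat \<Rightarrow> 'a" where
  "scale c u = (\<lambda>i. c * u i)"

definition submod :: "(nat \<Rightarrow> 'a::comm_ring_1) set \<Rightarrow> bool" where
  "submod L \<longleftrightarrow> 0 \<in> L \<and> (\<forall>u\<in>L. \<forall>v\<in>L. u + v \<in> L) \<and> (\<forall>c. \<forall>u\<in>L. scale c u \<in> L)"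

definition linmap :: "((nat \<Rightarrow> 'a::comm_ring_1) \<Rightarrow> nat \<Rightarrow> 'a) \<Rightarrow> bool" where
  "linmap f \<longleftrightarrow> (\<forall>u v. f (u + v) = f u + f v) \<and> (\<forall>c u. f (scale c u) = scale c (f u))"

definition free_mod :: "nat \<Rightarrow> (nat \<Rightarrow> 'a::comm_ring_1) set" where
  "free_mod r = {u. \<forall>i\<ge>r. u i = 0}"

definition comb :: "nat \<Rightarrow> (nat \<Rightarrow> nat \<Rightarrow> 'a::comm_ring_1) \<Rightarrow> (nat \<Rightarrow> 'a) \<Rightarrow> nat \<Rightarrow> 'a" where
  "comb r w u = (\<Sum>i<r. scale (u i) (w i))"

text \<open>For \<open>N \<subseteq> L\<close>, \<^term>\<open>res_len d L N\<close> says that \<open>L / N\<close> has a resolution by free modules of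
  finite rank with at most \<open>d\<close> of them nonzero, i.e. of length at most \<open>d - 1\<close>. The kernel of
  \<open>w\<close>, the first syzygy module, is again treated as a quotient by \<open>0\<close>.\<close>

primrec res_len :: "nat \<Rightarrow> (nat \<Rightarrow> 'a::comm_ring_1) set \<Rightarrow> (nat \<Rightarrow> 'a) set \<Rightarrow> bool" where
  "res_len 0 L N \<longleftrightarrow> L \<subseteq> N"
| "res_len (Suc d) L N \<longleftrightarrow> (\<exists>r w. (\<forall>i<r. w i \<in> L) \<and> (\<forall>l\<in>L. \<exists>u\<in>free_mod r. l - comb r w u \<in> N) \<and>
     res_len d {u \<in> free_mod r. comb r w u \<in> N} {0})"

lemma res_len_SucE:
  assumes "res_len (Suc d) L N"
  obtains r w where "\<And>i. i < r \<Longrightarrow> w i \<in> L" "\<And>l. l \<in> L \<Longrightarrow> \<exists>u\<in>free_mod r. l - comb r w u \<in> N"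
    "res_len d {u \<in> free_mod r. comb r w u \<in> N} {0}"
proof -
  from assms obtain r w where "\<forall>i<r. w i \<in> L" "\<forall>l\<in>L. \<exists>u\<in>free_mod r. l - comb r w u \<in> N"
    "res_len d {u \<in> free_mod r. comb r w u \<in> N} {0}"
    unfolding res_len.simps by (elim exE conjE)
  then show ?thesis using that[of r w] by blast
qed

lemma scale_simps:
  "scale c (u + v) = scale c u + scale c v" "scale (c + d) u = scale c u + scale d u"
  "scale c (scale d u) = scale (c * d) u" "scale 1 u = u" "scale (-1) u = - u"
  "scale c 0 = 0" "scale 0 u = 0" "scale c (- u) = - scale c u"
  by (auto simp: scale_def fun_eq_iff plus_fun_apply zero_fun_apply algebra_simps)

lemma scale_sum: "scale c (sum f A) = (\<Sum>i\<in>A. scale c (f i))"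
  by (induction A rule: infinite_finite_induct) (auto simp: scale_simps)

lemma submod_0: "submod L \<Longrightarrow> 0 \<in> L"
  and submod_add: "submod L \<Longrightarrow> u \<in> L \<Longrightarrow> v \<in> L \<Longrightarrow> u + v \<in> L"
  and submod_scale: "submod L \<Longrightarrow> u \<in> L \<Longrightarrow> scale c u \<in> L"
  by (auto simp: submod_def)

lemma submod_uminus: "submod L \<Longrightarrow> u \<in> L \<Longrightarrow> - u \<in> L"
  using submod_scale[of L u "-1"] by (simp add: scale_simps)

lemma submod_diff: "submod L \<Longrightarrow> u \<in> L \<Longrightarrow> v \<in> L \<Longrightarrow> u - v \<in> L"
  using submod_add[of L u "- v"] submod_uminus by auto

lemma submod_sum: "submod L \<Longrightarrow> (\<And>i. i \<in> A \<Longrightarrow> f i \<in> L) \<Longrightarrow> sum f A \<in> L"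
  by (induction A rule: infinite_finite_induct) (auto simp: submod_0 submod_add)

lemma submod_diff_cancel: "submod L \<Longrightarrow> u - v \<in> L \<Longrightarrow> u \<in> L \<longleftrightarrow> v \<in> L"
  using submod_add[of L "u - v" v] submod_diff[of L u "u - v"] by auto

lemma submod_zero: "submod {0}"
  by (auto simp: submod_def scale_simps)

lemma submod_free_mod: "submod (free_mod r)"
  by (auto simp: submod_def free_mod_def scale_def plus_fun_apply zero_fun_apply)

lemma linmapD:
  assumes "linmap f"
  shows "f (u + v) = f u + f v" "f (scale c u) = scale c (f u)" "f 0 = 0" "f (- u) = - f u"
    "f (u - v) = f u - f v" "f (sum g A) = (\<Sum>i\<in>A. f (g i))"
proof -
  have a: "f (u + v) = f u + f v" and s: "f (scale c u) = scale c (f u)" for u v c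
    using assms by (auto simp: linmap_def)
  show "f (u + v) = f u + f v" "f (scale c u) = scale c (f u)" by (fact a s)+
  show z: "f 0 = 0" using s[of 0 0] by (simp add: scale_simps)
  have m: "f (- u) = - f u" for u using s[of "-1" u] by (simp add: scale_simps)
  show "f (- u) = - f u" by fact
  show "f (u - v) = f u - f v" using a[of u "- v"] m[of v] by simp
  show "f (sum g A) = (\<Sum>i\<in>A. f (g i))"
    by (induction A rule: infinite_finite_induct) (auto simp: z a)
qed

lemma linmap_comb: "linmap (comb r w)"
  by (simp add: linmap_def comb_def scale_sum sum.distrib scale_simps plus_fun_apply)
    (simp add: scale_def)

lemma linmap_scale: "linmap (scale c)"
  by (auto simp: linmap_def scale_simps mult.commute)

lemma scale_diff: "scale c (u - v) = scale c u - scale c v"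
  using linmapD(5)[OF linmap_scale] .

lemma comb_diff: "comb r w u - comb r v u = comb r (\<lambda>i. w i - v i) u"
  by (simp add: comb_def scale_diff sum_subtractf)

lemma comb_in: "submod L \<Longrightarrow> (\<And>i. i < r \<Longrightarrow> w i \<in> L) \<Longrightarrow> comb r w u \<in> L"
  unfolding comb_def by (intro submod_sum submod_scale) auto

lemma linmap_of_comb: "linmap f \<Longrightarrow> f (comb r w u) = comb r (\<lambda>i. f (w i)) u"
  by (simp add: comb_def linmapD)

lemma submod_vimage: "submod L \<Longrightarrow> submod N \<Longrightarrow> linmap f \<Longrightarrow> submod {u \<in> L. f u \<in> N}"
  unfolding submod_def[of "{u \<in> L. f u \<in> N}"] by (auto simp: linmapD submod_0 submod_add submod_scale)

lemma comb_0: "comb 0 w u = 0"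
  by (simp add: comb_def)

lemma res_len_Suc: "res_len d L N \<Longrightarrow> res_len (Suc d) L N"
proof (induction d arbitrary: L N)
  case 0
  have "{u \<in> free_mod 0. comb 0 w u \<in> N} \<subseteq> {0}" for w :: "nat \<Rightarrow> nat \<Rightarrow> 'a"
    by (auto simp: free_mod_def fun_eq_iff zero_fun_apply)
  moreover have "\<forall>l\<in>L. \<exists>u\<in>free_mod 0. l - comb 0 w u \<in> N" for w
    using 0 by (auto simp: comb_0 free_mod_def zero_fun_apply intro!: bexI[of _ 0])
  ultimately have "res_len (Suc 0) L N"
    unfolding res_len.simps(2) by (intro exI[of _ 0] exI[of _ "\<lambda>_. 0"]) (simp add: res_len.simps(1))
  then show ?case by simp
next
  case (Suc d)
  from Suc.prems obtain r w where "\<And>i. i < r \<Longrightarrow> w i \<in> L"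
    "\<And>l. l \<in> L \<Longrightarrow> \<exists>u\<in>free_mod r. l - comb r w u \<in> N"
    "res_len d {u \<in> free_mod r. comb r w u \<in> N} {0}" by (rule res_len_SucE) blast
  then show ?case using Suc.IH unfolding res_len.simps(2)[of "Suc d"] by blast
qed

section \<open>Resolutions under isomorphisms, extensions and cokernels\<close>

definition quot_iso where
  "quot_iso f L N L' N' \<longleftrightarrow> linmap f \<and> submod L \<and> submod N' \<and> f ` L \<subseteq> L' \<and>
     (\<forall>y\<in>L'. \<exists>l\<in>L. y - f l \<in> N') \<and> (\<forall>l\<in>L. f l \<in> N' \<longleftrightarrow> l \<in> N)"

text \<open>The images of the generators generate the target quotient and have literally the same
  syzygies, so the rest of the resolution is kept.\<close>

lemma res_len_iso_fwd:
  assumes "quot_iso f L N L' N'" "res_len d L N"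
  shows "res_len d L' N'"
proof -
  have f: "linmap f" and L: "submod L" and N': "submod N'" and im: "\<And>l. l \<in> L \<Longrightarrow> f l \<in> L'"
    and sur: "\<And>y. y \<in> L' \<Longrightarrow> \<exists>l\<in>L. y - f l \<in> N'" and iff: "\<And>l. l \<in> L \<Longrightarrow> f l \<in> N' \<longleftrightarrow> l \<in> N"
    using assms(1) by (auto simp: quot_iso_def)
  show ?thesis
  proof (cases d)
    case 0
    show ?thesis unfolding 0 res_len.simps
    proof
      fix y assume "y \<in> L'"
      then obtain l where "l \<in> L" "y - f l \<in> N'" using sur by blast
      moreover have "f l \<in> N'" using iff assms(2) 0 \<open>l \<in> L\<close> by auto
      ultimately show "y \<in> N'" using submod_diff_cancel[OF N'] by blast
    qed
  next
    case (Suc e)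
    with assms(2) have "res_len (Suc e) L N" by simp
    then obtain r w where w: "\<And>i. i < r \<Longrightarrow> w i \<in> L"
      and cov: "\<And>l. l \<in> L \<Longrightarrow> \<exists>u\<in>free_mod r. l - comb r w u \<in> N"
      and K: "res_len e {u \<in> free_mod r. comb r w u \<in> N} {0}" by (rule res_len_SucE) blast
    let ?w = "\<lambda>i. f (w i)"
    have c: "comb r w u \<in> L" for u using comb_in[OF L] w by blast
    have "{u \<in> free_mod r. comb r ?w u \<in> N'} = {u \<in> free_mod r. comb r w u \<in> N}"
      using iff[OF c] linmap_of_comb[OF f] by simp
    moreover have "\<exists>u\<in>free_mod r. y - comb r ?w u \<in> N'" if "y \<in> L'" for y
    proof -
      obtain l where l: "l \<in> L" "y - f l \<in> N'" using sur \<open>y \<in> L'\<close> by blast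
      obtain u where u: "u \<in> free_mod r" "l - comb r w u \<in> N" using cov l by blast
      have "f (l - comb r w u) \<in> N'" using iff u submod_diff[OF L l(1) c] by blast
      moreover have "(y - f l) + f (l - comb r w u) = y - comb r ?w u"
        by (simp add: linmapD(5)[OF f] linmap_of_comb[OF f])
      ultimately have "y - comb r ?w u \<in> N'" using submod_add[OF N' l(2)] by metis
      then show ?thesis using u by auto
    qed
    ultimately show ?thesis using K im w unfolding Suc res_len.simps by (intro exI[of _ r] exI[of _ ?w]) auto
  qed
qed

text \<open>The generators are lifted along f modulo \<open>N'\<close>. This alters their
  combinations only by elements of \<open>N'\<close>, so again the syzygy module is the same
  set.\<close>

lemma res_len_iso_bwd:
  assumes "quot_iso f L N L' N'" "res_len d L' N'"
  shows "res_len d L N"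
proof -
  have f: "linmap f" and L: "submod L" and N': "submod N'" and im: "\<And>l. l \<in> L \<Longrightarrow> f l \<in> L'"
    and sur: "\<And>y. y \<in> L' \<Longrightarrow> \<exists>l\<in>L. y - f l \<in> N'" and iff: "\<And>l. l \<in> L \<Longrightarrow> f l \<in> N' \<longleftrightarrow> l \<in> N"
    using assms(1) by (auto simp: quot_iso_def)
  show ?thesis
  proof (cases d)
    case 0
    then show ?thesis using assms(2) im iff by auto
  next
    case (Suc e)
    with assms(2) have "res_len (Suc e) L' N'" by simp
    then obtain r w where w: "\<And>i. i < r \<Longrightarrow> w i \<in> L'"
      and cov: "\<And>l. l \<in> L' \<Longrightarrow> \<exists>u\<in>free_mod r. l - comb r w u \<in> N'"
      and K: "res_len e {u \<in> free_mod r. comb r w u \<in> N'} {0}" by (rule res_len_SucE) blast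
    have "\<forall>i. \<exists>l. i < r \<longrightarrow> l \<in> L \<and> w i - f l \<in> N'" using sur w by blast
    then obtain v where v: "\<And>i. i < r \<Longrightarrow> v i \<in> L" "\<And>i. i < r \<Longrightarrow> w i - f (v i) \<in> N'" by metis
    have c: "comb r v u \<in> L" for u using comb_in[OF L] v by blast
    have d: "comb r w u - f (comb r v u) \<in> N'" for u
    proof -
      have "comb r w u - f (comb r v u) = comb r (\<lambda>i. w i - f (v i)) u"
        by (simp only: linmap_of_comb[OF f] comb_diff)
      then show ?thesis using comb_in[OF N', of r "\<lambda>i. w i - f (v i)"] v by simp
    qed
    have "{u \<in> free_mod r. comb r v u \<in> N} = {u \<in> free_mod r. comb r w u \<in> N'}"
      using iff[OF c] submod_diff_cancel[OF N' d] by auto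
    moreover have "\<exists>u\<in>free_mod r. l - comb r v u \<in> N" if "l \<in> L" for l
    proof -
      obtain u where u: "u \<in> free_mod r" "f l - comb r w u \<in> N'" using cov im \<open>l \<in> L\<close> by blast
      have "f (l - comb r v u) = (f l - comb r w u) + (comb r w u - f (comb r v u))"
        by (simp add: linmapD(5)[OF f])
      then have "f (l - comb r v u) \<in> N'" using submod_add[OF N' u(2) d] by metis
      then show ?thesis using iff submod_diff[OF L that c] u by blast
    qed
    ultimately show ?thesis using K v(1) unfolding Suc res_len.simps by (intro exI[of _ r] exI[of _ v]) auto
  qed
qed

lemma linmap_shift: "linmap (\<lambda>u i. u (i + k))"
  by (auto simp: linmap_def scale_def plus_fun_def)

lemma comb_append:
  "comb (r + q) (\<lambda>i. if i < r then w i else v (i - r)) u = comb r w u + comb q v (\<lambda>i. u (i + r))"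
  by (induction q) (simp_all add: comb_def add.assoc add.commute)

text \<open>Horseshoe argument for 0 -> L/N -> L'/N -> L'/L -> 0: generators of the two outer
  quotients are concatenated. The syzygies of the middle are then an extension of those of the outer
  terms, to which induction on d applies.\<close>

theorem res_len_ext:
  assumes "submod N" "submod L" "submod L'" "N \<subseteq> L" "L \<subseteq> L'" "res_len d L N" "res_len d L' L"
  shows "res_len d L' N"
  using assms
proof (induction d arbitrary: N L L')
  case 0
  then show ?case by auto
next
  case (Suc d)
  note sub = Suc.prems(1-3)
  from Suc.prems(6) obtain r w where w: "\<And>i. i < r \<Longrightarrow> w i \<in> L"
    and wcov: "\<And>l. l \<in> L \<Longrightarrow> \<exists>u\<in>free_mod r. l - comb r w u \<in> N"
    and wK: "res_len d {u \<in> free_mod r. comb r w u \<in> N} {0}" by (rule res_len_SucE) blast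
  from Suc.prems(7) obtain q v where v: "\<And>i. i < q \<Longrightarrow> v i \<in> L'"
    and vcov: "\<And>l. l \<in> L' \<Longrightarrow> \<exists>u\<in>free_mod q. l - comb q v u \<in> L"
    and vK: "res_len d {u \<in> free_mod q. comb q v u \<in> L} {0}" by (rule res_len_SucE) blast
  define p where "p = r + q"
  define x where "x = (\<lambda>i. if i < r then w i else v (i - r))"
  define sh where "sh = (\<lambda>u (i::nat). (u (i + r) :: 'a))"
  define app where "app a b = (\<lambda>i. if i < r then a i else (b (i - r) :: 'a))" for a b
  have x: "comb p x u = comb r w u + comb q v (sh u)" for u
    unfolding p_def x_def sh_def by (rule comb_append)
  have cw: "comb r w u \<in> L" for u using comb_in[OF sub(2)] w by blast
  have app: "sh (app a b) = b" "comb r w (app a b) = comb r w a" for a b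
    by (auto simp: sh_def app_def comb_def)
  have app_free: "app a b \<in> free_mod p" if "b \<in> free_mod q" for a b
    using that by (auto simp: app_def free_mod_def p_def)
  have sh_free: "sh u \<in> free_mod q" if "u \<in> free_mod p" for u
    using that by (auto simp: sh_def free_mod_def p_def)
  have sh: "linmap sh" unfolding sh_def by (rule linmap_shift)
  let ?K = "{u \<in> free_mod p. comb p x u \<in> N}"
  \<comment> \<open>Syzygies whose block on the generators of L'/L vanishes are the syzygies of L/N;
    projecting to that block identifies \<open>?K / ?KA\<close> with the syzygies of L'/L.\<close>
  let ?KA = "{u \<in> ?K. sh u = 0}"
  have Ks: "submod ?K" by (intro submod_vimage submod_free_mod sub linmap_comb)
  have K1s: "submod ?KA" using submod_vimage[OF Ks submod_zero sh] by simp
  have "?KA = {u \<in> free_mod r. comb r w u \<in> N}"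
  proof -
    have "u \<in> free_mod p \<and> sh u = 0 \<longleftrightarrow> u \<in> free_mod r" for u
    proof
      assume u: "u \<in> free_mod p \<and> sh u = 0"
      have "u i = 0" if "i \<ge> r" for i
        using fun_cong[OF conjunct2[OF u], of "i - r"] that by (simp add: sh_def zero_fun_apply)
      then show "u \<in> free_mod r" by (simp add: free_mod_def)
    qed (auto simp: free_mod_def p_def sh_def fun_eq_iff zero_fun_apply)
    moreover have "comb p x u = comb r w u" if "sh u = 0" for u
      using x[of u] that linmapD(3)[OF linmap_comb] by simp
    ultimately have "(u \<in> free_mod p \<and> comb p x u \<in> N) \<and> sh u = 0 \<longleftrightarrow> u \<in> free_mod r \<and> comb r w u \<in> N" for u
      by metis
    then show ?thesis by simp
  qed
  then have r1: "res_len d ?KA {0}" using wK by simp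
  have "quot_iso sh ?K ?KA {u \<in> free_mod q. comb q v u \<in> L} {0}"
    unfolding quot_iso_def
  proof (intro conjI ballI)
    show "sh ` ?K \<subseteq> {u \<in> free_mod q. comb q v u \<in> L}"
    proof (intro image_subsetI CollectI conjI)
      fix u assume u: "u \<in> ?K"
      then show "sh u \<in> free_mod q" using sh_free by blast
      have "comb q v (sh u) = comb p x u - comb r w u" using x[of u] by simp
      then show "comb q v (sh u) \<in> L" using u Suc.prems(4) submod_diff[OF sub(2) _ cw] by auto
    qed
    fix b assume b: "b \<in> {u \<in> free_mod q. comb q v u \<in> L}"
    then obtain a where a: "a \<in> free_mod r" "comb q v b - comb r w a \<in> N" using wcov by blast
    \<comment> \<open>A syzygy b of L'/L has its value in L; subtracting an expression of that value
      in the generators of L/N completes b to a syzygy of L'/N.\<close>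
    have "app (- a) b \<in> ?K"
      using a b app_free x[of "app (- a) b"] by (simp add: app linmapD[OF linmap_comb])
    then show "\<exists>u\<in>?K. b - sh u \<in> {0}" using app(1) by (intro bexI[of _ "app (- a) b"]) auto
  qed (use sh Ks submod_zero in auto)
  from res_len_iso_bwd[OF this vK] have r2: "res_len d ?K ?KA" .
  have "res_len d ?K {0}"
    by (rule Suc.IH[OF submod_zero K1s Ks _ _ r1 r2]) (use submod_0[OF K1s] in auto)
  moreover have "\<exists>u\<in>free_mod p. l - comb p x u \<in> N" if "l \<in> L'" for l
  proof -
    obtain b where b: "b \<in> free_mod q" "l - comb q v b \<in> L" using vcov \<open>l \<in> L'\<close> by blast
    obtain a where a: "a \<in> free_mod r" "(l - comb q v b) - comb r w a \<in> N" using wcov b by blast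
    have "l - comb p x (app a b) = (l - comb q v b) - comb r w a"
      unfolding x app by simp
    then show ?thesis using a b app_free by metis
  qed
  moreover have "x i \<in> L'" if "i < p" for i
    using w[of i] v[of "i - r"] that Suc.prems(5) by (auto simp: x_def p_def)
  ultimately show ?case unfolding res_len.simps by blast
qed

text \<open>Generators of L'/N also generate L'/L. Their syzygies modulo L form an extension of L/N
  by the syzygies modulo N, so both hypotheses enter at length d and \<open>res_len_ext\<close>
  combines them.\<close>

theorem res_len_cone:
  assumes "submod N" "submod L" "submod L'" "N \<subseteq> L" "L \<subseteq> L'" "res_len d L N" "res_len (Suc d) L' N"
  shows "res_len (Suc d) L' L"
proof -
  from assms(7) obtain r w where w: "\<And>i. i < r \<Longrightarrow> w i \<in> L'"
    and cov: "\<And>l. l \<in> L' \<Longrightarrow> \<exists>u\<in>free_mod r. l - comb r w u \<in> N"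
    and K: "res_len d {u \<in> free_mod r. comb r w u \<in> N} {0}" by (rule res_len_SucE) blast
  let ?K = "{u \<in> free_mod r. comb r w u \<in> L}" and ?KN = "{u \<in> free_mod r. comb r w u \<in> N}"
  have s: "submod ?K" "submod ?KN" by (intro submod_vimage submod_free_mod assms linmap_comb)+
  have "quot_iso (comb r w) ?K ?KN L N"
    unfolding quot_iso_def
  proof (intro conjI ballI)
    fix y assume y: "y \<in> L"
    then obtain u where u: "u \<in> free_mod r" "y - comb r w u \<in> N" using cov assms(5) by blast
    then have "comb r w u \<in> L" using submod_diff_cancel[OF assms(2), of y "comb r w u"] y assms(4) by blast
    then show "\<exists>l\<in>?K. y - comb r w l \<in> N" using u by blast
  qed (use s assms linmap_comb in auto)
  then have KN: "res_len d ?K ?KN" using res_len_iso_bwd assms(6) by blast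
  have "res_len d ?K {0}"
    by (rule res_len_ext[OF submod_zero s(2,1) _ _ K KN]) (use submod_0[OF s(2)] assms(4) in auto)
  moreover have "\<exists>u\<in>free_mod r. l - comb r w u \<in> L" if "l \<in> L'" for l
    using cov[OF that] assms(4) by blast
  ultimately show ?thesis unfolding res_len.simps using w by blast
qed

section \<open>Bounding the projective dimension\<close>

abbreviation (input) Rng :: "'a::comm_ring_1 ring" where "Rng \<equiv> ring_of_type_algebra"

lemma rta_simps [simp]:
  "carrier (ring_of_type_algebra :: 'a::comm_ring_1 ring) = UNIV"
  "x \<otimes>\<^bsub>ring_of_type_algebra\<^esub> (y :: 'a) = x * y" "\<one>\<^bsub>ring_of_type_algebra\<^esub> = (1 :: 'a)"
  "\<zero>\<^bsub>ring_of_type_algebra\<^esub> = (0 :: 'a)" "x \<oplus>\<^bsub>ring_of_type_algebra\<^esub> (y :: 'a) = x + y"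
  by (simp_all add: ring_of_type_algebra_def)

lemma rta_minus [simp]:
  "\<ominus>\<^bsub>ring_of_type_algebra\<^esub> (x :: 'a::comm_ring_1) = - x"
  "x \<ominus>\<^bsub>ring_of_type_algebra\<^esub> y = x - y"
proof -
  interpret cring "ring_of_type_algebra :: 'a ring" by (rule cring_from_type_algebra)
  show m: "\<ominus>\<^bsub>ring_of_type_algebra\<^esub> x = - x" for x :: 'a by (rule minus_equality) auto
  show "x \<ominus>\<^bsub>ring_of_type_algebra\<^esub> y = x - y" by (simp add: a_minus_def m)
qed

lemma ideal_rtaD:
  fixes Q :: "'a::comm_ring_1 set"
  assumes "ideal Q ring_of_type_algebra"
  shows "0 \<in> Q" "x \<in> Q \<Longrightarrow> y \<in> Q \<Longrightarrow> x + y \<in> Q" "x \<in> Q \<Longrightarrow> c * x \<in> Q" "x \<in> Q \<Longrightarrow> - x \<in> Q"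
    "x \<in> Q \<Longrightarrow> y \<in> Q \<Longrightarrow> x - y \<in> Q"
proof -
  interpret ideal Q "ring_of_type_algebra :: 'a ring" by fact
  show "0 \<in> Q" using additive_subgroup.zero_closed[OF is_additive_subgroup] by simp
  have add: "x \<in> Q \<Longrightarrow> y \<in> Q \<Longrightarrow> x + y \<in> Q" for x y
    using additive_subgroup.a_closed[OF is_additive_subgroup, of x y] by simp
  have mult: "x \<in> Q \<Longrightarrow> c * x \<in> Q" for x c using I_l_closed[of x c] by simp
  have uminus: "x \<in> Q \<Longrightarrow> - x \<in> Q" for x using mult[of x "-1"] by simp
  show "x \<in> Q \<Longrightarrow> y \<in> Q \<Longrightarrow> x + y \<in> Q" "x \<in> Q \<Longrightarrow> c * x \<in> Q" "x \<in> Q \<Longrightarrow> - x \<in> Q" by (fact add mult uminus)+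
  show "x \<in> Q \<Longrightarrow> y \<in> Q \<Longrightarrow> x - y \<in> Q" using add[of x "- y"] uminus[of y] by simp
qed

lemma ideal_sum_rta:
  assumes "ideal Q (ring_of_type_algebra :: 'a::comm_ring_1 ring)" "\<And>i. i \<in> A \<Longrightarrow> f i \<in> Q"
  shows "sum f A \<in> Q"
  using assms(2) by (induction A rule: infinite_finite_induct) (auto intro: ideal_rtaD[OF assms(1)])

lemma rcos_eq_ideal_iff:
  fixes I :: "'a::comm_ring_1 set"
  assumes I: "ideal I ring_of_type_algebra"
  shows "I +>\<^bsub>ring_of_type_algebra\<^esub> x = I \<longleftrightarrow> x \<in> I"
proof -
  interpret I: ideal I "ring_of_type_algebra :: 'a ring" by fact
  show ?thesis using I.rcos_const_imp_mem[of x] I.a_rcos_zero[OF I, of x] by auto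
qed

text \<open>The definition of \<open>proj_dim\<close> prescribes functions on lists as elements of
  the resolving modules. A sequence is read there as a function of the length of the list;
  \<open>of_lists\<close> recovers it from constant lists.\<close>

definition to_lists :: "(nat \<Rightarrow> 'a) \<Rightarrow> 'i list \<Rightarrow> 'a" where
  "to_lists u = (\<lambda>l. u (length l))"

definition of_lists :: "('i list \<Rightarrow> 'a) \<Rightarrow> nat \<Rightarrow> 'a" where
  "of_lists v = (\<lambda>i. v (replicate i undefined))"

definition free_module :: "nat \<Rightarrow> ('a::comm_ring_1, 'i list \<Rightarrow> 'a) module" where
  "free_module r = \<lparr>carrier = to_lists ` free_mod r, monoid.mult = (\<lambda>_ _. 0), one = 0,
     ring.zero = 0, add = (+), module.smult = (\<lambda>c v l. c * v l)\<rparr>"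

lemma of_to_lists [simp]: "of_lists (to_lists u) = u"
  by (simp add: of_lists_def to_lists_def)

lemma to_lists_simps:
  "to_lists (u + v) = to_lists u + to_lists v" "to_lists 0 = 0"
  "to_lists (scale c u) = (\<lambda>l. c * to_lists u l)" "to_lists (- u) = - to_lists u"
  by (auto simp: to_lists_def fun_eq_iff plus_fun_apply zero_fun_apply scale_def)

lemma free_module_simps:
  "carrier (free_module r) = to_lists ` free_mod r" "\<zero>\<^bsub>free_module r\<^esub> = 0"
  "x \<oplus>\<^bsub>free_module r\<^esub> y = x + y" "c \<odot>\<^bsub>free_module r\<^esub> x = (\<lambda>l. c * x l)"
  by (simp_all add: free_module_def)

lemma module_free_module: "module Rng (free_module r)"
proof (rule moduleI)
  show "cring (Rng :: 'a ring)" by (rule cring_from_type_algebra)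
  show "abelian_group (free_module r :: ('a, 'i list \<Rightarrow> 'a) module)"
  proof (rule abelian_groupI, unfold free_module_simps)
    fix x y :: "'i list \<Rightarrow> 'a"
    assume "x \<in> to_lists ` free_mod r" "y \<in> to_lists ` free_mod r"
    then show "x + y \<in> to_lists ` free_mod r"
      using submod_add[OF submod_free_mod] by (auto simp: to_lists_simps(1)[symmetric] intro!: imageI)
  next
    show "(0 :: 'i list \<Rightarrow> 'a) \<in> to_lists ` free_mod r"
      using submod_0[OF submod_free_mod] by (metis imageI to_lists_simps(2))
  next
    fix x :: "'i list \<Rightarrow> 'a" assume "x \<in> to_lists ` free_mod r"
    then obtain u where u: "u \<in> free_mod r" "x = to_lists u" by blast
    have "to_lists (- u) + x = 0" by (simp add: u to_lists_simps)
    then show "\<exists>y\<in>to_lists ` free_mod r. y + x = 0"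
      using submod_uminus[OF submod_free_mod u(1)] by blast
  qed (simp_all add: algebra_simps)
qed (auto simp: free_module_simps to_lists_simps(3)[symmetric] submod_scale[OF submod_free_mod]
    plus_fun_apply fun_eq_iff algebra_simps)

lemma mod_homI:
  assumes "\<And>x. x \<in> carrier A \<Longrightarrow> f x \<in> carrier B"
    "\<And>x y. x \<in> carrier A \<Longrightarrow> y \<in> carrier A \<Longrightarrow> f (x \<oplus>\<^bsub>A\<^esub> y) = f x \<oplus>\<^bsub>B\<^esub> f y"
    "\<And>r x. r \<in> carrier R \<Longrightarrow> x \<in> carrier A \<Longrightarrow> f (r \<odot>\<^bsub>A\<^esub> x) = r \<odot>\<^bsub>B\<^esub> f x"
  shows "f \<in> mod_hom R A B"
  using assms by (auto simp: mod_hom_def hom_def)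

lemma mod_homD:
  assumes "f \<in> mod_hom R A B"
  shows "x \<in> carrier A \<Longrightarrow> f x \<in> carrier B"
    "x \<in> carrier A \<Longrightarrow> y \<in> carrier A \<Longrightarrow> f (x \<oplus>\<^bsub>A\<^esub> y) = f x \<oplus>\<^bsub>B\<^esub> f y"
    "r \<in> carrier R \<Longrightarrow> x \<in> carrier A \<Longrightarrow> f (r \<odot>\<^bsub>A\<^esub> x) = r \<odot>\<^bsub>B\<^esub> f x"
  using assms by (auto simp: mod_hom_def hom_def)

lemma mod_hom_zero:
  assumes "f \<in> mod_hom R A B" "module R A" "module R B"
  shows "f \<zero>\<^bsub>A\<^esub> = \<zero>\<^bsub>B\<^esub>"
proof -
  interpret A: module R A by fact
  interpret B: module R B by fact
  have "f (\<zero>\<^bsub>R\<^esub> \<odot>\<^bsub>A\<^esub> \<zero>\<^bsub>A\<^esub>) = \<zero>\<^bsub>R\<^esub> \<odot>\<^bsub>B\<^esub> f \<zero>\<^bsub>A\<^esub>"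
    by (rule mod_homD(3)[OF assms(1)]) auto
  then show ?thesis using mod_homD(1)[OF assms(1), of "\<zero>\<^bsub>A\<^esub>"] by simp
qed

text \<open>Preimages under g of the values of f on the basis vectors define the lift h by linear
  extension.\<close>

lemma projective_free_module:
  "projective_module Rng (free_module r :: ('a::comm_ring_1, 'i list \<Rightarrow> 'a) module)"
  unfolding projective_module_def
proof (intro conjI allI impI, rule module_free_module, elim conjE)
  fix A :: "('a, ('i list \<Rightarrow> 'a) \<Rightarrow> 'a) module" and B :: "('a, 'i list \<Rightarrow> 'a) module"
    and f :: "('i list \<Rightarrow> 'a) \<Rightarrow> 'i list \<Rightarrow> 'a" and g
  assume A: "module Rng A" and B: "module Rng B" and g: "g \<in> mod_hom Rng A B"
    and sur: "g ` carrier A = carrier B" and f: "f \<in> mod_hom Rng (free_module r) B"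
  interpret A: module Rng A by fact
  interpret B: module Rng B by fact
  define e where "e j = (to_lists (\<lambda>i. if i = j then 1 else 0) :: 'i list \<Rightarrow> 'a)" for j :: nat
  have e: "e j \<in> carrier (free_module r)" if "j < r" for j
    using that by (auto simp: e_def free_module_simps free_mod_def)
  have "\<forall>j. \<exists>a. j < r \<longrightarrow> a \<in> carrier A \<and> g a = f (e j)"
    using mod_homD(1)[OF f e] sur by (metis (no_types) imageE)
  then obtain a where a: "\<And>j. j < r \<Longrightarrow> a j \<in> carrier A" "\<And>j. j < r \<Longrightarrow> g (a j) = f (e j)" by metis
  define h where "h v = (\<Oplus>\<^bsub>A\<^esub>j\<in>{..<r}. of_lists v j \<odot>\<^bsub>A\<^esub> a j)" for v :: "'i list \<Rightarrow> 'a"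
  have cl: "(\<lambda>j. of_lists v j \<odot>\<^bsub>A\<^esub> a j) \<in> {..<r} \<rightarrow> carrier A" for v :: "'i list \<Rightarrow> 'a"
    using a(1) by auto
  have "h \<in> mod_hom Rng (free_module r) A"
  proof (rule mod_homI)
    fix x y :: "'i list \<Rightarrow> 'a" assume "x \<in> carrier (free_module r)" "y \<in> carrier (free_module r)"
    show "h x \<in> carrier A" unfolding h_def by (rule A.M.finsum_closed[OF cl])
    have "h (x \<oplus>\<^bsub>free_module r\<^esub> y) =
        (\<Oplus>\<^bsub>A\<^esub>j\<in>{..<r}. (of_lists x j \<odot>\<^bsub>A\<^esub> a j) \<oplus>\<^bsub>A\<^esub> (of_lists y j \<odot>\<^bsub>A\<^esub> a j))"
      unfolding h_def
    proof (rule A.M.finsum_cong')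
      show "(\<lambda>j. of_lists x j \<odot>\<^bsub>A\<^esub> a j \<oplus>\<^bsub>A\<^esub> of_lists y j \<odot>\<^bsub>A\<^esub> a j) \<in> {..<r} \<rightarrow> carrier A"
        using a(1) by auto
      fix j assume "j \<in> {..<r}"
      then show "of_lists (x \<oplus>\<^bsub>free_module r\<^esub> y) j \<odot>\<^bsub>A\<^esub> a j =
          of_lists x j \<odot>\<^bsub>A\<^esub> a j \<oplus>\<^bsub>A\<^esub> of_lists y j \<odot>\<^bsub>A\<^esub> a j"
        using A.smult_l_distr[of "of_lists x j" "of_lists y j" "a j"] a(1)[of j]
        by (simp add: free_module_simps of_lists_def plus_fun_apply)
    qed simp
    also have "\<dots> = h x \<oplus>\<^bsub>A\<^esub> h y"
      unfolding h_def by (rule A.M.finsum_addf[OF cl cl])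
    finally show "h (x \<oplus>\<^bsub>free_module r\<^esub> y) = h x \<oplus>\<^bsub>A\<^esub> h y" .
  next
    fix c :: 'a and x :: "'i list \<Rightarrow> 'a" assume "x \<in> carrier (free_module r)"
    have "h (c \<odot>\<^bsub>free_module r\<^esub> x) = (\<Oplus>\<^bsub>A\<^esub>j\<in>{..<r}. c \<odot>\<^bsub>A\<^esub> (of_lists x j \<odot>\<^bsub>A\<^esub> a j))"
      unfolding h_def
    proof (rule A.M.finsum_cong')
      show "(\<lambda>j. c \<odot>\<^bsub>A\<^esub> (of_lists x j \<odot>\<^bsub>A\<^esub> a j)) \<in> {..<r} \<rightarrow> carrier A"
        using a(1) by auto
      fix j assume "j \<in> {..<r}"
      then show "of_lists (c \<odot>\<^bsub>free_module r\<^esub> x) j \<odot>\<^bsub>A\<^esub> a j = c \<odot>\<^bsub>A\<^esub> (of_lists x j \<odot>\<^bsub>A\<^esub> a j)"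
        using A.smult_assoc1[of c "of_lists x j" "a j"] a(1)[of j]
        by (simp add: free_module_simps of_lists_def)
    qed simp
    also have "\<dots> = c \<odot>\<^bsub>A\<^esub> h x"
      unfolding h_def by (rule A.finsum_smult_ldistr[symmetric]) (use cl in auto)
    finally show "h (c \<odot>\<^bsub>free_module r\<^esub> x) = c \<odot>\<^bsub>A\<^esub> h x" .
  qed
  moreover have "g (h v) = f v" if v: "v \<in> carrier (free_module r)" for v
  proof -
    obtain u where u: "u \<in> free_mod r" "v = to_lists u" using v by (auto simp: free_module_simps)
    have in_free: "to_lists (\<lambda>i. if i < n then u i else 0) \<in> carrier (free_module r)" for n
      using u by (auto simp: free_module_simps free_mod_def)
    \<comment> \<open>Induction over the number of coordinates kept: the vector truncated after n
      entries grows by one basis multiple at a time.\<close>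
    have "g (\<Oplus>\<^bsub>A\<^esub>j\<in>{..<n}. u j \<odot>\<^bsub>A\<^esub> a j) = f (to_lists (\<lambda>i. if i < n then u i else 0))" if "n \<le> r" for n
      using that
    proof (induction n)
      case 0
      have "(to_lists (\<lambda>i. if i < 0 then u i else 0) :: 'i list \<Rightarrow> 'a) = \<zero>\<^bsub>free_module r\<^esub>"
        by (simp add: free_module_simps to_lists_def zero_fun_def)
      then show ?case
        using mod_hom_zero[OF g A B] mod_hom_zero[OF f module_free_module B] by simp
    next
      case (Suc n)
      let ?t = "to_lists (\<lambda>i. if i < n then u i else 0)"
      have n: "n < r" using Suc.prems by simp
      have cln: "(\<lambda>j. u j \<odot>\<^bsub>A\<^esub> a j) \<in> {..<n} \<rightarrow> carrier A" using a(1) n by auto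
      have "g (\<Oplus>\<^bsub>A\<^esub>j\<in>{..<Suc n}. u j \<odot>\<^bsub>A\<^esub> a j) =
          g ((u n \<odot>\<^bsub>A\<^esub> a n) \<oplus>\<^bsub>A\<^esub> (\<Oplus>\<^bsub>A\<^esub>j\<in>{..<n}. u j \<odot>\<^bsub>A\<^esub> a j))"
        using cln a(1)[OF n] by (simp add: lessThan_Suc)
      also have "\<dots> = g (u n \<odot>\<^bsub>A\<^esub> a n) \<oplus>\<^bsub>B\<^esub> g (\<Oplus>\<^bsub>A\<^esub>j\<in>{..<n}. u j \<odot>\<^bsub>A\<^esub> a j)"
        by (rule mod_homD(2)[OF g]) (use a(1)[OF n] cln in auto)
      also have "\<dots> = u n \<odot>\<^bsub>B\<^esub> f (e n) \<oplus>\<^bsub>B\<^esub> f ?t"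
        using mod_homD(3)[OF g _ a(1)[OF n]] a(2)[OF n] Suc by simp
      also have "\<dots> = f (u n \<odot>\<^bsub>free_module r\<^esub> e n \<oplus>\<^bsub>free_module r\<^esub> ?t)"
      proof -
        have "u n \<odot>\<^bsub>free_module r\<^esub> e n \<in> carrier (free_module r)"
          using module.smult_closed[OF module_free_module _ e[OF n]] by simp
        then show ?thesis
          using mod_homD(2)[OF f _ in_free] mod_homD(3)[OF f _ e[OF n]] by simp
      qed
      also have "u n \<odot>\<^bsub>free_module r\<^esub> e n \<oplus>\<^bsub>free_module r\<^esub> ?t = to_lists (\<lambda>i. if i < Suc n then u i else 0)"
        by (auto simp: free_module_simps e_def to_lists_def plus_fun_def fun_eq_iff less_Suc_eq)
      finally show ?case .
    qed
    from this[of r] have "g (h v) = f (to_lists (\<lambda>i. if i < r then u i else 0))"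
      by (simp add: h_def u)
    also have "(\<lambda>i. if i < r then u i else 0) = u" using u(1) by (auto simp: free_mod_def)
    finally show ?thesis by (simp add: u)
  qed
  ultimately show "\<exists>h\<in>mod_hom Rng (free_module r) A. \<forall>x\<in>carrier (free_module r). g (h x) = f x"
    by blast
qed

text \<open>Unrolls the recursion of \<open>res_len\<close> into one exact sequence indexed by all
  natural numbers, where rank 0 from d on encodes its finite length.\<close>

lemma res_len_chain:
  assumes "submod K" "res_len d K {0}"
  obtains r w where "comb (r 0) (w 0) ` free_mod (r 0) = K"
    "\<And>i. comb (r (Suc i)) (w (Suc i)) ` free_mod (r (Suc i)) = {u \<in> free_mod (r i). comb (r i) (w i) u = 0}"
    "\<And>i. i \<ge> d \<Longrightarrow> r i = 0"
  using assms
proof (induction d arbitrary: K thesis)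
  case 0
  have "K = {0}" using 0(2,3) submod_0 by auto
  moreover have "free_mod 0 = {0 :: nat \<Rightarrow> 'a}" by (auto simp: free_mod_def fun_eq_iff zero_fun_apply)
  ultimately show ?case by (intro 0(1)[of "\<lambda>_. 0" "\<lambda>_ _. 0"]) (auto simp: comb_0)
next
  case (Suc d)
  from Suc.prems(3) obtain r0 w0 where w0: "\<And>i. i < r0 \<Longrightarrow> w0 i \<in> K"
    and cov: "\<And>l. l \<in> K \<Longrightarrow> \<exists>u\<in>free_mod r0. l - comb r0 w0 u \<in> {0}"
    and K': "res_len d {u \<in> free_mod r0. comb r0 w0 u \<in> {0}} {0}" by (rule res_len_SucE) blast
  obtain r w where rw: "comb (r 0) (w 0) ` free_mod (r 0) = {u \<in> free_mod r0. comb r0 w0 u \<in> {0}}"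
    "\<And>i. comb (r (Suc i)) (w (Suc i)) ` free_mod (r (Suc i)) = {u \<in> free_mod (r i). comb (r i) (w i) u = 0}"
    "\<And>i. i \<ge> d \<Longrightarrow> r i = 0"
    by (rule Suc.IH[OF _ submod_vimage[OF submod_free_mod submod_zero linmap_comb] K']) blast
  have "comb r0 w0 ` free_mod r0 = K"
  proof
    show "comb r0 w0 ` free_mod r0 \<subseteq> K" using comb_in[OF Suc.prems(2)] w0 by blast
    show "K \<subseteq> comb r0 w0 ` free_mod r0" 
    proof
      fix l assume "l \<in> K"
      from cov[OF this] show "l \<in> comb r0 w0 ` free_mod r0" by auto
    qed
  qed
  then show ?case
    using rw by (intro Suc.prems(1)[of "case_nat r0 r" "case_nat w0 w"]) (auto split: nat.splits)
qed

text \<open>An ideal as a submodule of the free module of rank one, so that \<open>emb UNIV\<close>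
  modulo \<open>emb I\<close> is the cyclic module R/I.\<close>

definition emb :: "'a::comm_ring_1 set \<Rightarrow> (nat \<Rightarrow> 'a) set" where
  "emb I = {u \<in> free_mod 1. u 0 \<in> I}"

text \<open>\<open>res_len\<close> counts the free modules that may be nonzero, the projective
  dimension is the last index at which one occurs; hence \<open>Suc d\<close> against d.\<close>

lemma res_len_proj_dim:
  fixes I :: "'a::comm_ring_1 set"
  assumes I: "ideal I Rng" and res: "res_len (Suc d) (emb UNIV) (emb I)"
  shows "proj_dim Rng (quotient_module Rng I) \<le> enat d"
proof -
  interpret I: ideal I Rng by fact
  let ?q = "\<lambda>x. I +>\<^bsub>Rng\<^esub> x"
  let ?Q = "quotient_module Rng I"
  have hom: "?q \<in> ring_hom Rng (Rng Quot I)" by (rule I.rcos_ring_hom)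
  note q0 = rcos_eq_ideal_iff[OF I]
  from res obtain r0 w0 where w0: "\<And>i. i < r0 \<Longrightarrow> w0 i \<in> emb UNIV"
    and cov: "\<And>l. l \<in> emb UNIV \<Longrightarrow> \<exists>u\<in>free_mod r0. l - comb r0 w0 u \<in> emb I"
    and K: "res_len d {u \<in> free_mod r0. comb r0 w0 u \<in> emb I} {0}" by (rule res_len_SucE) blast
  have sI: "submod (emb I)"
    using submod_free_mod[of 1] ideal_rtaD(1-3)[OF I] by (auto simp: submod_def emb_def plus_fun_apply zero_fun_apply scale_def)
  have sU: "submod (emb (UNIV :: 'a set))" using submod_free_mod[of 1] by (simp add: emb_def)
  have K': "submod {u \<in> free_mod r0. comb r0 w0 u \<in> emb I}"
    by (rule submod_vimage[OF submod_free_mod sI linmap_comb])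
  obtain r w where rw: "comb (r 0) (w 0) ` free_mod (r 0) = {u \<in> free_mod r0. comb r0 w0 u \<in> emb I}"
    "\<And>i. comb (r (Suc i)) (w (Suc i)) ` free_mod (r (Suc i)) = {u \<in> free_mod (r i). comb (r i) (w i) u = 0}"
    "\<And>i. i \<ge> d \<Longrightarrow> r i = 0"
    by (rule res_len_chain[OF K' K]) blast
  \<comment> \<open>Shift by one: rank \<open>r0\<close> covers R/I itself, while \<open>r\<close>
    and \<open>w\<close> resolve its first syzygies.\<close>
  define P :: "nat \<Rightarrow> ('a, ('a \<times> 'a set) list \<Rightarrow> 'a) module" where
    "P i = free_module (case i of 0 \<Rightarrow> r0 | Suc i \<Rightarrow> r i)" for i
  define \<delta> :: "nat \<Rightarrow> (('a \<times> 'a set) list \<Rightarrow> 'a) \<Rightarrow> ('a \<times> 'a set) list \<Rightarrow> 'a" where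
    "\<delta> i v = to_lists (comb (r i) (w i) (of_lists v))" for i v
  define \<epsilon> :: "(('a \<times> 'a set) list \<Rightarrow> 'a) \<Rightarrow> 'a set" where
    "\<epsilon> v = ?q (comb r0 w0 (of_lists v) 0)" for v
  have of_lists: "of_lists (x + y) = of_lists x + of_lists y" "of_lists (\<lambda>l. c * x l) = scale c (of_lists x)"
    for x y :: "('a \<times> 'a set) list \<Rightarrow> 'a" and c
    by (auto simp: of_lists_def plus_fun_def scale_def)
  have \<delta>_im: "\<delta> i ` carrier (P (Suc i)) = to_lists ` comb (r i) (w i) ` free_mod (r i)" for i
    by (auto simp: \<delta>_def P_def free_module_simps image_iff)
  have \<delta>_sub: "comb (r i) (w i) ` free_mod (r i) \<subseteq> free_mod (case i of 0 \<Rightarrow> r0 | Suc i \<Rightarrow> r i)" for i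
    using rw(1,2) by (cases i) auto
  have "projective_resolution Rng ?Q P \<delta> \<epsilon>"
    unfolding projective_resolution_def
  proof (intro conjI allI)
    show "projective_module Rng (P i)" for i unfolding P_def by (rule projective_free_module)
    show "\<epsilon> \<in> mod_hom Rng (P 0) ?Q"
    proof (rule mod_homI)
      fix x y assume "x \<in> carrier (P 0)" "y \<in> carrier (P 0)"
      show "\<epsilon> x \<in> carrier ?Q"
        using ring_hom_closed[OF hom] by (simp add: \<epsilon>_def quotient_module_def)
      show "\<epsilon> (x \<oplus>\<^bsub>P 0\<^esub> y) = \<epsilon> x \<oplus>\<^bsub>?Q\<^esub> \<epsilon> y"
        using ring_hom_add[OF hom]
        by (simp add: \<epsilon>_def quotient_module_def P_def free_module_simps of_lists linmapD[OF linmap_comb] plus_fun_apply)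
    next
      fix c :: 'a and x assume "x \<in> carrier (P 0)"
      show "\<epsilon> (c \<odot>\<^bsub>P 0\<^esub> x) = c \<odot>\<^bsub>?Q\<^esub> \<epsilon> x"
        using ring_hom_mult[OF hom]
        by (simp add: \<epsilon>_def quotient_module_def P_def free_module_simps of_lists linmapD[OF linmap_comb])
          (simp add: scale_def)
    qed
    show "\<delta> i \<in> mod_hom Rng (P (Suc i)) (P i)" for i
    proof (rule mod_homI)
      fix x y assume "x \<in> carrier (P (Suc i))" "y \<in> carrier (P (Suc i))"
      show "\<delta> i x \<in> carrier (P i)"
        using \<delta>_im[of i] \<delta>_sub[of i] \<open>x \<in> _\<close> by (auto simp: P_def free_module_simps)
      show "\<delta> i (x \<oplus>\<^bsub>P (Suc i)\<^esub> y) = \<delta> i x \<oplus>\<^bsub>P i\<^esub> \<delta> i y"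
        by (simp add: \<delta>_def P_def free_module_simps of_lists linmapD[OF linmap_comb] to_lists_simps)
    next
      fix c :: 'a and x assume "x \<in> carrier (P (Suc i))"
      show "\<delta> i (c \<odot>\<^bsub>P (Suc i)\<^esub> x) = c \<odot>\<^bsub>P i\<^esub> \<delta> i x"
        by (simp add: \<delta>_def P_def free_module_simps of_lists linmapD[OF linmap_comb] to_lists_simps)
    qed
    show "\<epsilon> ` carrier (P 0) = carrier ?Q"
    proof
      show "\<epsilon> ` carrier (P 0) \<subseteq> carrier ?Q"
        using ring_hom_closed[OF hom] by (auto simp: \<epsilon>_def quotient_module_def)
      show "carrier ?Q \<subseteq> \<epsilon> ` carrier (P 0)"
      proof
        fix Y assume "Y \<in> carrier ?Q"
        then obtain x where x: "Y = ?q x"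
          by (auto simp: quotient_module_def FactRing_def A_RCOSETS_def' )
        let ?l = "\<lambda>i::nat. if i = 0 then x else 0"
        have "?l \<in> emb UNIV" by (auto simp: emb_def free_mod_def)
        then obtain u where u: "u \<in> free_mod r0" "?l - comb r0 w0 u \<in> emb I" using cov by blast
        then have "x - comb r0 w0 u 0 \<in> I" by (simp add: emb_def)
        moreover have "x = (x - comb r0 w0 u 0) + comb r0 w0 u 0" by simp
        ultimately have "x \<in> ?q (comb r0 w0 u 0)" unfolding a_r_coset_def' by fastforce
        then have "?q (comb r0 w0 u 0) = Y"
          using I.a_repr_independence' x by simp
        then have "\<epsilon> (to_lists u) = Y" by (simp add: \<epsilon>_def)
        then show "Y \<in> \<epsilon> ` carrier (P 0)" using u by (auto simp: P_def free_module_simps)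
      qed
    qed
    have embI: "x \<in> emb UNIV \<Longrightarrow> x 0 \<in> I \<longleftrightarrow> x \<in> emb I" for x by (auto simp: emb_def)
    have "a_kernel (P 0) ?Q \<epsilon> = to_lists ` {u \<in> free_mod r0. comb r0 w0 u \<in> emb I}"
    proof -
      have "\<epsilon> (to_lists u) = I \<longleftrightarrow> comb r0 w0 u \<in> emb I" for u
        using q0 embI[OF comb_in[OF sU w0]] by (simp add: \<epsilon>_def)
      then show ?thesis
        by (auto simp: a_kernel_def' P_def free_module_simps quotient_module_def FactRing_def)
    qed
    then show "\<delta> 0 ` carrier (P 1) = a_kernel (P 0) ?Q \<epsilon>"
      using \<delta>_im[of 0] rw(1) by simp
    show "\<delta> (Suc i) ` carrier (P (i + 2)) = a_kernel (P (Suc i)) (P i) (\<delta> i)" for i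
    proof -
      have inj: "(to_lists u :: ('a \<times> 'a set) list \<Rightarrow> 'a) = 0 \<longleftrightarrow> u = 0" for u
        by (metis of_to_lists to_lists_simps(2))
      have "\<delta> (Suc i) ` carrier (P (i + 2)) = to_lists ` {u \<in> free_mod (r i). comb (r i) (w i) u = 0}"
        using \<delta>_im[of "Suc i"] rw(2)[of i] by simp
      also have "\<dots> = a_kernel (P (Suc i)) (P i) (\<delta> i)"
        by (auto simp: a_kernel_def' P_def \<delta>_def free_module_simps inj)
      finally show ?thesis .
    qed
  qed
  moreover have "carrier (P i) = {\<zero>\<^bsub>P i\<^esub>}" if "i > d" for i
  proof -
    from \<open>i > d\<close> obtain j where j: "i = Suc j" "j \<ge> d" by (metis less_Suc_eq_le less_imp_Suc_add not_less_eq)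
    have "free_mod 0 = {0 :: nat \<Rightarrow> 'a}" by (auto simp: free_mod_def fun_eq_iff zero_fun_apply)
    then show ?thesis using rw(3)[OF j(2)] by (simp add: P_def j free_module_simps to_lists_simps)
  qed
  ultimately show ?thesis
    unfolding proj_dim_def by (intro Inf_lower) blast
qed

section \<open>Monomial ideals\<close>

definition up_closed :: "('n \<Rightarrow> nat) set \<Rightarrow> bool" where
  "up_closed U \<longleftrightarrow> (\<forall>a\<in>U. \<forall>b. a \<le> b \<longrightarrow> b \<in> U)"

text \<open>For up-closed U this is the monomial ideal with exponent set U; keeping U arbitrary
  reduces colons, sums and inclusions to operations on sets of exponents.\<close>

definition mideal :: "('n \<Rightarrow> nat) set \<Rightarrow> ('n::finite, 'k::field) mpoly set" where
  "mideal U = {p. \<forall>a\<in>Poly_Mapping.keys p. Poly_Mapping.lookup a \<in> U}"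

definition expo :: "('n::finite \<Rightarrow> nat) \<Rightarrow> 'n \<Rightarrow>\<^sub>0 nat" where
  "expo f = Abs_poly_mapping f"

lemma lookup_expo [simp]: "Poly_Mapping.lookup (expo f) = f"
  by (simp add: expo_def)

lemma expo_lookup [simp]: "expo (Poly_Mapping.lookup a) = a"
  by (simp add: expo_def)

lemma up_closed_upset: "up_closed (upset G)"
  by (auto simp: up_closed_def intro: upset_mono)

lemma sum_single:
  "(\<Sum>a\<in>Poly_Mapping.keys p. Poly_Mapping.single a (Poly_Mapping.lookup p a)) = (p :: 'a \<Rightarrow>\<^sub>0 'b::comm_monoid_add)"
proof (rule poly_mapping_eqI)
  fix k
  show "Poly_Mapping.lookup (\<Sum>a\<in>Poly_Mapping.keys p. Poly_Mapping.single a (Poly_Mapping.lookup p a)) k =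
      Poly_Mapping.lookup p k"
    by (simp add: lookup_sum lookup_single when_def sum.delta in_keys_iff)
qed

lemma mideal_0 [simp]: "0 \<in> mideal U"
  by (simp add: mideal_def)

lemma mideal_add: "p \<in> mideal U \<Longrightarrow> q \<in> mideal U \<Longrightarrow> p + q \<in> mideal U"
  using Poly_Mapping.keys_add[of p q] by (auto simp: mideal_def)

lemma mideal_sum: "(\<And>i. i \<in> A \<Longrightarrow> f i \<in> mideal U) \<Longrightarrow> sum f A \<in> mideal U"
  by (induction A rule: infinite_finite_induct) (auto intro: mideal_add)

lemma mideal_mult:
  assumes "up_closed U" "p \<in> mideal U"
  shows "q * p \<in> mideal U"
  unfolding mideal_def
proof (intro CollectI ballI)
  fix a assume "a \<in> Poly_Mapping.keys (q * p)"
  then obtain b c where bc: "a = b + c" "c \<in> Poly_Mapping.keys p"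
    using keys_mult[of q p] by blast
  then have "Poly_Mapping.lookup c \<in> U" using assms by (simp add: mideal_def)
  moreover have "Poly_Mapping.lookup c \<le> Poly_Mapping.lookup a"
    by (simp add: bc le_fun_def lookup_add)
  ultimately show "Poly_Mapping.lookup a \<in> U" using assms(1) by (auto simp: up_closed_def)
qed

lemma mideal_uminus: "p \<in> mideal U \<Longrightarrow> - p \<in> mideal U"
  by (simp add: mideal_def in_keys_iff)

lemma ideal_mideal:
  assumes "up_closed U"
  shows "ideal (mideal U) (mpoly_ring :: ('n::finite, 'k::field) mpoly ring)"
proof (rule idealI)
  show "ring (mpoly_ring :: ('n, 'k) mpoly ring)" by (rule ring_from_type_algebra)
  interpret R: ring "mpoly_ring :: ('n, 'k) mpoly ring" by (rule ring_from_type_algebra)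
  show "subgroup (mideal U) (add_monoid (mpoly_ring :: ('n, 'k) mpoly ring))"
  proof (rule R.add.subgroupI)
    show "mideal U \<subseteq> carrier (mpoly_ring :: ('n, 'k) mpoly ring)" by simp
    show "(mideal U :: ('n, 'k) mpoly set) \<noteq> {}" using mideal_0 by blast
  qed (simp_all add: mideal_add mideal_uminus)
qed (use mideal_mult[OF assms] in \<open>simp_all add: mult.commute\<close>)

lemma single_in_mideal: "Poly_Mapping.single a c \<in> mideal U \<longleftrightarrow> c = 0 \<or> Poly_Mapping.lookup a \<in> U"
  by (simp add: mideal_def)

lemma genideal_monomials:
  "genideal mpoly_ring (monom_of ` G) = (mideal (upset (Poly_Mapping.lookup ` G)) :: ('n::finite, 'k::field) mpoly set)"
proof
  interpret R: ring "mpoly_ring :: ('n, 'k) mpoly ring" by (rule ring_from_type_algebra)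
  let ?M = "genideal mpoly_ring (monom_of ` G) :: ('n, 'k) mpoly set"
  show "?M \<subseteq> mideal (upset (Poly_Mapping.lookup ` G))"
  proof (rule R.genideal_minimal[OF ideal_mideal[OF up_closed_upset]])
    show "monom_of ` G \<subseteq> (mideal (upset (Poly_Mapping.lookup ` G)) :: ('n, 'k) mpoly set)"
      by (auto simp: monom_of_def single_in_mideal upset_def)
  qed
  have M: "ideal ?M mpoly_ring" by (rule R.genideal_ideal) simp
  show "mideal (upset (Poly_Mapping.lookup ` G)) \<subseteq> ?M"
  proof
    fix p :: "('n, 'k) mpoly" assume p: "p \<in> mideal (upset (Poly_Mapping.lookup ` G))"
    have "Poly_Mapping.single a (Poly_Mapping.lookup p a) \<in> ?M" if "a \<in> Poly_Mapping.keys p" for a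
    proof -
      have "Poly_Mapping.lookup a \<in> upset (Poly_Mapping.lookup ` G)" using p that by (simp add: mideal_def)
      then obtain g where g: "g \<in> G" "Poly_Mapping.lookup g \<le> Poly_Mapping.lookup a"
        by (auto simp: upset_def)
      have "a = expo (\<lambda>s. Poly_Mapping.lookup a s - Poly_Mapping.lookup g s) + g"
        using g(2) by (intro poly_mapping_eqI) (simp add: lookup_add le_fun_def)
      then have "Poly_Mapping.single a (Poly_Mapping.lookup p a) =
          Poly_Mapping.single (expo (\<lambda>s. Poly_Mapping.lookup a s - Poly_Mapping.lookup g s)) (Poly_Mapping.lookup p a)
            * monom_of g"
        by (simp add: monom_of_def mult_single)
      moreover have "monom_of g \<in> ?M" using R.genideal_self[of "monom_of ` G"] g(1) by auto
      ultimately show ?thesis using ideal_rtaD(3)[OF M] by simp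
    qed
    then show "p \<in> ?M" by (subst sum_single[symmetric, of p]) (rule ideal_sum_rta[OF M])
  qed
qed

lemma lookup_times_single:
  "Poly_Mapping.lookup (q * Poly_Mapping.single m c) (a + m) =
    Poly_Mapping.lookup (q :: ('n, 'k::field) mpoly) a * c"
proof -
  have "q * Poly_Mapping.single m c =
      (\<Sum>b\<in>Poly_Mapping.keys q. Poly_Mapping.single (b + m) (Poly_Mapping.lookup q b * c))"
    by (subst (1) sum_single[symmetric, of q]) (simp add: sum_distrib_right mult_single)
  then show ?thesis
    by (auto simp: lookup_sum lookup_single when_def sum.delta in_keys_iff)
qed

lemma mideal_colon:
  "q * Poly_Mapping.single m 1 \<in> (mideal U :: ('n::finite, 'k::field) mpoly set) \<longleftrightarrow>
    q \<in> mideal {b. (\<lambda>s. b s + Poly_Mapping.lookup m s) \<in> U}"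
proof -
  have "Poly_Mapping.keys (q * Poly_Mapping.single m 1) = (\<lambda>a. a + m) ` Poly_Mapping.keys q"
  proof
    show "Poly_Mapping.keys (q * Poly_Mapping.single m 1) \<subseteq> (\<lambda>a. a + m) ` Poly_Mapping.keys q"
      using keys_mult[of q "Poly_Mapping.single m 1"] by auto
  qed (auto simp: in_keys_iff lookup_times_single)
  moreover have "Poly_Mapping.lookup (a + m) = (\<lambda>s. Poly_Mapping.lookup a s + Poly_Mapping.lookup m s)" for a
    by (auto simp: lookup_add)
  ultimately show ?thesis by (simp add: mideal_def)
qed

section \<open>Resolutions after adding a monomial to an ideal\<close>

lemma mideal_UNIV [simp]: "mideal UNIV = UNIV"
  by (simp add: mideal_def)

lemma mideal_mono: "U \<subseteq> W \<Longrightarrow> mideal U \<subseteq> mideal W"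
  by (auto simp: mideal_def)

lemma emb_mono: "I \<subseteq> J \<Longrightarrow> emb I \<subseteq> emb J"
  by (auto simp: emb_def)

lemma submod_emb_mideal: "up_closed U \<Longrightarrow> submod (emb (mideal U))"
  using submod_free_mod[of 1]
  by (auto simp: submod_def emb_def plus_fun_apply zero_fun_apply scale_def mideal_add mideal_mult)

lemma submod_emb_UNIV: "submod (emb UNIV)"
  using submod_free_mod[of 1] by (simp add: emb_def)

lemma res_len_mono: "res_len d L N \<Longrightarrow> d \<le> e \<Longrightarrow> res_len e L N"
  by (induction e) (auto simp: le_Suc_eq simp del: res_len.simps intro: res_len_Suc)

text \<open>Multiplication by x^m induces an isomorphism from S/(I : x^m) to (I + (x^m))/I, and the
  exponents of the colon ideal are those of I translated by -m.\<close>

lemma res_len_add_monomial: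
  fixes U :: "('n::finite \<Rightarrow> nat) set"
  assumes U: "up_closed U"
    and res: "res_len d (emb UNIV) (emb (mideal {b. (\<lambda>s. b s + m s) \<in> U} :: ('n, 'k::field) mpoly set))"
  shows "res_len d (emb (mideal (U \<union> {a. m \<le> a}))) (emb (mideal U :: ('n, 'k) mpoly set))"
proof (rule res_len_iso_fwd[OF _ res])
  let ?x = "Poly_Mapping.single (expo m) 1 :: ('n, 'k) mpoly"
  let ?I = "mideal U :: ('n, 'k) mpoly set"
  have colon: "?x * q \<in> ?I \<longleftrightarrow> q \<in> mideal {b. (\<lambda>s. b s + m s) \<in> U}" for q
    using mideal_colon[of q "expo m" U] by (simp add: mult.commute)
  show "quot_iso (scale ?x) (emb UNIV) (emb (mideal {b. (\<lambda>s. b s + m s) \<in> U}))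
      (emb (mideal (U \<union> {a. m \<le> a}))) (emb ?I)"
    unfolding quot_iso_def
  proof (intro conjI ballI)
    have "?x \<in> mideal {a. m \<le> a}" by (simp add: single_in_mideal)
    then have "q * ?x \<in> mideal {a. m \<le> a}" for q
      by (rule mideal_mult[rotated]) (auto simp: up_closed_def intro: order_trans)
    then have "?x * q \<in> mideal (U \<union> {a. m \<le> a})" for q
      using mideal_mono[of "{a. m \<le> a}" "U \<union> {a. m \<le> a}"] by (auto simp: mult.commute)
    then show "scale ?x ` emb UNIV \<subseteq> emb (mideal (U \<union> {a. m \<le> a}))"
      by (auto simp: emb_def scale_def free_mod_def)
  next
    fix y assume y: "y \<in> emb (mideal (U \<union> {a. m \<le> a}) :: ('n, 'k) mpoly set)"
    define p where "p = y 0"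
    have p: "p \<in> mideal (U \<union> {a. m \<le> a})" using y by (simp add: emb_def p_def)
    \<comment> \<open>Preimage of p: the terms outside I are divisible by x^m and get divided by it;
      the remaining terms vanish modulo I.\<close>
    define q where "q = (\<Sum>a\<in>{a \<in> Poly_Mapping.keys p. Poly_Mapping.lookup a \<notin> U}.
      Poly_Mapping.single (expo (\<lambda>s. Poly_Mapping.lookup a s - m s)) (Poly_Mapping.lookup p a))"
    define lo where "lo = (\<Sum>a\<in>{a \<in> Poly_Mapping.keys p. Poly_Mapping.lookup a \<notin> U}.
          Poly_Mapping.single a (Poly_Mapping.lookup p a))"
    define hi where "hi = (\<Sum>a\<in>{a \<in> Poly_Mapping.keys p. Poly_Mapping.lookup a \<in> U}.
          Poly_Mapping.single a (Poly_Mapping.lookup p a))"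
    have "?x * q = lo"
      unfolding lo_def q_def sum_distrib_left
    proof (rule sum.cong)
      fix a assume "a \<in> {a \<in> Poly_Mapping.keys p. Poly_Mapping.lookup a \<notin> U}"
      then have "m \<le> Poly_Mapping.lookup a" using p by (auto simp: mideal_def)
      then have "expo m + expo (\<lambda>s. Poly_Mapping.lookup a s - m s) = a"
        by (intro poly_mapping_eqI) (simp add: lookup_add le_fun_def)
      then show "?x * Poly_Mapping.single (expo (\<lambda>s. Poly_Mapping.lookup a s - m s)) (Poly_Mapping.lookup p a)
          = Poly_Mapping.single a (Poly_Mapping.lookup p a)"
        by (simp add: mult_single)
    qed simp
    moreover have "p = lo + hi"
    proof -
      have "Poly_Mapping.keys p = {a \<in> Poly_Mapping.keys p. Poly_Mapping.lookup a \<notin> U} \<union>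
          {a \<in> Poly_Mapping.keys p. Poly_Mapping.lookup a \<in> U}" by auto
      then have "(\<Sum>a\<in>Poly_Mapping.keys p. Poly_Mapping.single a (Poly_Mapping.lookup p a)) =
          (\<Sum>a\<in>{a \<in> Poly_Mapping.keys p. Poly_Mapping.lookup a \<notin> U} \<union>
          {a \<in> Poly_Mapping.keys p. Poly_Mapping.lookup a \<in> U}. Poly_Mapping.single a (Poly_Mapping.lookup p a))"
        by (rule sum.cong) simp
      also have "\<dots> = lo + hi" unfolding lo_def hi_def by (rule sum.union_disjoint) auto
      finally show ?thesis by (simp only: sum_single)
    qed
    ultimately have "p - ?x * q = hi" by simp
    also have "hi \<in> ?I" unfolding hi_def by (rule mideal_sum) (simp add: single_in_mideal)
    finally have "p - ?x * q \<in> ?I" .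
    then have "y - scale ?x (\<lambda>i. if i = 0 then q else 0) \<in> emb ?I"
      using y by (auto simp: emb_def free_mod_def scale_def p_def)
    moreover have "(\<lambda>i. if i = 0 then q else 0) \<in> emb UNIV" by (auto simp: emb_def free_mod_def)
    ultimately show "\<exists>l\<in>emb UNIV. y - scale ?x l \<in> emb ?I" by blast
  next
    fix l :: "nat \<Rightarrow> ('n, 'k) mpoly" assume "l \<in> emb UNIV"
    then show "scale ?x l \<in> emb ?I \<longleftrightarrow> l \<in> emb (mideal {b. (\<lambda>s. b s + m s) \<in> U})"
      using colon[of "l 0"] by (auto simp: emb_def scale_def free_mod_def)
  qed (use linmap_scale submod_emb_UNIV submod_emb_mideal[OF U] in auto)
qed

lemma up_closed_Un: "up_closed U \<Longrightarrow> up_closed (U \<union> {a. m \<le> a})"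
  by (auto simp: up_closed_def intro: order_trans)

text \<open>If x does not matter for membership in U, the colon ideal by x^j is the ideal itself, so
  x^j acts injectively on the quotient; \<open>res_len_cone\<close> pays one step for factoring it
  out.\<close>

lemma res_len_add_power:
  fixes U :: "('n::finite \<Rightarrow> nat) set"
  assumes U: "up_closed U" "\<And>b c. b(x := c) \<in> U \<longleftrightarrow> b \<in> U"
    and res: "res_len d (emb UNIV) (emb (mideal U :: ('n, 'k::field) mpoly set))"
  shows "res_len (Suc d) (emb UNIV) (emb (mideal (U \<union> {a. a x \<ge> j}) :: ('n, 'k) mpoly set))"
proof -
  define m :: "'n \<Rightarrow> nat" where "m = (\<lambda>s. 0)(x := j)"
  have "{b. (\<lambda>s. b s + m s) \<in> U} = U"
  proof -
    have "(\<lambda>s. b s + m s) = b(x := b x + j)" for b by (auto simp: m_def)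
    then show ?thesis using U(2) by simp
  qed
  moreover have "{a. m \<le> a} = {a. a x \<ge> j}" by (auto simp: m_def le_fun_def)
  ultimately have 1: "res_len d (emb (mideal (U \<union> {a. a x \<ge> j}))) (emb (mideal U :: ('n, 'k) mpoly set))"
    and uc: "up_closed (U \<union> {a. a x \<ge> j})"
    using res_len_add_monomial[OF U(1), of d m] res up_closed_Un[OF U(1), of m] by simp_all
  show ?thesis
    by (rule res_len_cone[OF submod_emb_mideal[OF U(1)] submod_emb_mideal[OF uc] submod_emb_UNIV _ _ 1])
      (auto intro!: emb_mono mideal_mono res_len_Suc res simp del: res_len.simps)
qed

lemma emb_zero: "emb {0} = {0}"
  by (auto simp: emb_def free_mod_def fun_eq_iff zero_fun_apply) (metis One_nat_def Suc_leI not_gr_zero)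

lemma res_len_UNIV_zero: "res_len 1 (emb UNIV) (emb ({0} :: 'a::comm_ring_1 set))"
proof -
  define w where "w i = (\<lambda>j::nat. if j = 0 then 1 else 0 :: 'a)" for i :: nat
  have comb: "comb 1 w u = u" if "u \<in> free_mod 1" for u
    using that by (auto simp: comb_def w_def scale_def free_mod_def fun_eq_iff)
  have "\<forall>i<1. w i \<in> emb UNIV" by (auto simp: w_def emb_def free_mod_def)
  moreover have "\<forall>l\<in>emb UNIV. \<exists>u\<in>free_mod 1. l - comb 1 w u \<in> emb {0 :: 'a}"
  proof
    fix l :: "nat \<Rightarrow> 'a" assume "l \<in> emb UNIV"
    then have "l \<in> free_mod 1" by (simp add: emb_def)
    then show "\<exists>u\<in>free_mod 1. l - comb 1 w u \<in> emb {0 :: 'a}"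
      using comb emb_zero by (intro bexI[of _ l]) auto
  qed
  moreover have "res_len 0 {u \<in> free_mod 1. comb 1 w u \<in> emb {0 :: 'a}} {0}"
    using comb emb_zero by auto
  ultimately show ?thesis unfolding One_nat_def res_len.simps(2) by blast
qed

text \<open>T holds the generators from which x has already been removed, taken in order of
  x-exponent. Modulo the monomial of \<alpha> without x, \<alpha> itself contributes the power of x
  and the generators below \<alpha> in x contribute the link. Elements of T with the x-exponent of
  \<alpha> contribute nothing new, since genericity supplies a generator below \<alpha> in x that
  accounts for them.\<close>

lemma upset_link_or_power:
  assumes gen: "generic G" and T: "T \<subseteq> G" "\<And>g h. g \<in> T \<Longrightarrow> h \<in> G \<Longrightarrow> h x < g x \<Longrightarrow> h \<in> T"
    and \<alpha>: "\<alpha> \<in> G" "\<alpha> \<notin> T" "\<alpha> x > 0" "\<And>g. g \<in> G \<Longrightarrow> g x < \<alpha> x \<Longrightarrow> g \<in> T"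
  shows "{b. (\<lambda>s. b s + (\<alpha>(x := 0)) s) \<in> upset (G \<union> drop_var x T)} = upset (link x \<alpha> G) \<union> {b. b x \<ge> \<alpha> x}"
proof (rule Set.set_eqI)
  fix b
  let ?c = "\<lambda>s. b s + (\<alpha>(x := 0)) s"
  have in_link: "b \<in> upset (link x \<alpha> G)" if "g \<in> G" "g x < \<alpha> x" "\<And>s. s \<noteq> x \<Longrightarrow> g s \<le> b s + \<alpha> s" for g
  proof -
    have "(\<lambda>s. g s - \<alpha> s)(x := 0) \<le> b" using that(3) by (auto simp: le_fun_def le_diff_conv)
    then show ?thesis using that by (auto simp: upset_def link_def)
  qed
  have "?c \<in> upset (G \<union> drop_var x T)" if b: "b \<in> upset (link x \<alpha> G) \<or> b x \<ge> \<alpha> x"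
  proof (cases "b x \<ge> \<alpha> x")
    case True
    then have "\<alpha> \<le> ?c" by (auto simp: le_fun_def)
    then show ?thesis using \<alpha>(1) by (auto simp: upset_def)
  next
    case False
    then obtain g where g: "g \<in> G" "g x < \<alpha> x" "(\<lambda>s. g s - \<alpha> s)(x := 0) \<le> b"
      using b by (auto simp: upset_def link_def)
    have "g(x := 0) \<le> ?c"
    proof (rule le_funI)
      fix s show "(g(x := 0)) s \<le> ?c s" using le_funD[OF g(3), of s] by (cases "s = x") auto
    qed
    moreover have "g(x := 0) \<in> drop_var x T" using \<alpha>(4) g by (auto simp: drop_var_def)
    ultimately show ?thesis by (auto simp: upset_def)
  qed
  moreover have "b \<in> upset (link x \<alpha> G)" if c: "?c \<in> upset (G \<union> drop_var x T)" and bx: "b x < \<alpha> x"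
  proof -
    have "\<exists>g\<in>G. g x \<le> \<alpha> x \<and> g \<noteq> \<alpha> \<and> (\<forall>s. s \<noteq> x \<longrightarrow> g s \<le> b s + \<alpha> s)"
    proof -
      from c consider g where "g \<in> G" "g \<le> ?c" | g where "g \<in> T" "g(x := 0) \<le> ?c"
        by (auto simp: upset_def drop_var_def)
      then show ?thesis
      proof cases
        case 1
        have "g s \<le> b s + \<alpha> s" if "s \<noteq> x" for s using le_funD[OF 1(2), of s] that by simp
        moreover have "g x < \<alpha> x" using le_funD[OF 1(2), of x] bx by simp
        ultimately show ?thesis using 1 by (intro bexI[of _ g]) auto
      next
        case 2
        have "g s \<le> b s + \<alpha> s" if "s \<noteq> x" for s using le_funD[OF 2(2), of s] that by simp
        moreover have "g x \<le> \<alpha> x" using T(2)[OF 2(1) \<alpha>(1)] \<alpha>(2) by (meson not_le)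
        ultimately show ?thesis using 2 T(1) \<alpha>(2) by (intro bexI[of _ g]) auto
      qed
    qed
    then obtain g where g: "g \<in> G" "g x \<le> \<alpha> x" "g \<noteq> \<alpha>" "\<And>s. s \<noteq> x \<Longrightarrow> g s \<le> b s + \<alpha> s" by blast
    show ?thesis
    proof (cases "g x < \<alpha> x")
      case True
      then show ?thesis using in_link g by blast
    next
      case False
      then have "g x = \<alpha> x" using g by simp
      then obtain c where c: "c \<in> G" "\<And>t. c t < max (g t) (\<alpha> t) \<or> c t = 0"
        using genericE[OF gen g(1) \<alpha>(1) g(3)] \<alpha>(3) by metis
      have "c x < \<alpha> x" using c(2)[of x] \<open>g x = \<alpha> x\<close> \<alpha>(3) by auto
      moreover have "c s \<le> b s + \<alpha> s" if "s \<noteq> x" for s using c(2)[of s] g(4)[OF that] by auto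
      ultimately show ?thesis using in_link c by blast
    qed
  qed
  ultimately show "b \<in> {b. (\<lambda>s. b s + (\<alpha>(x := 0)) s) \<in> upset (G \<union> drop_var x T)} \<longleftrightarrow>
      b \<in> upset (link x \<alpha> G) \<union> {b. b x \<ge> \<alpha> x}" by fastforce
qed

text \<open>The ideals generated by \<open>G\<close> and part of \<^term>\<open>drop_var x G\<close> interpolate between the ideal of
  \<open>G\<close> and its saturation by \<open>x\<close>; by genericity, successive quotients are cyclic modules
  \<open>S / (J + x\<^sup>j)\<close> with \<open>J\<close> the ideal of a link.\<close>

lemma res_len_generic:
  fixes G :: "('n::finite \<Rightarrow> nat) set"
  assumes "finite G" "generic G" "bounded_by D G" "supported_in V G"
    and "\<And>a. corner D G a \<Longrightarrow> card (low D a) < d"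
  shows "res_len d (emb UNIV) (emb (mideal (upset G) :: ('n, 'k::field) mpoly set))"
proof -
  have "finite V" by simp
  then show ?thesis using assms
  proof (induction V arbitrary: G d)
    case empty
    show ?case
    proof (cases "G = {}")
      case True
      then have "corner D G (\<lambda>_. D)" by (auto simp: corner_def upset_def)
      from empty.prems(5)[OF this] have "1 \<le> d" by simp
      moreover have "mideal (upset G) = ({0} :: ('n, 'k) mpoly set)"
        using True by (auto simp: mideal_def upset_def)
      ultimately show ?thesis using res_len_mono[OF res_len_UNIV_zero] by simp
    next
      case False
      then obtain g where "g \<in> G" by blast
      moreover have "g = (\<lambda>_. 0)" using \<open>g \<in> G\<close> empty.prems(4) by (auto simp: supported_in_def)
      ultimately have "upset G = UNIV" by (auto simp: upset_def le_fun_def)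
      then show ?thesis by (simp add: res_len_mono[of 0])
    qed
  next
    case (insert x V)
    note fin = insert.prems(1) and gen = insert.prems(2) and bnd = insert.prems(3)
      and small = insert.prems(5)
    have supp: "supported_in V (drop_var x G)" "supported_in V (link x \<alpha> G)" for \<alpha>
      using supported_drop_var[OF insert.prems(4), of x] supported_link[OF insert.prems(4), of x] insert.hyps
      by (simp_all add: supported_in_def)
    have top: "res_len d (emb UNIV) (emb (mideal (upset (drop_var x G)) :: ('n, 'k) mpoly set))"
      by (rule insert.IH[OF _ generic_drop_var[OF gen] bounded_drop_var[OF bnd] supp(1)])
        (use fin small corner_drop_var[OF bnd] in \<open>auto simp: drop_var_def\<close>)
    \<comment> \<open>Corners of the link are smaller by one, which gains exactly the step spent on
      the power of x.\<close>
    have star: "res_len d (emb UNIV) (emb (mideal (upset (link x \<alpha> G) \<union> {b. b x \<ge> \<alpha> x}) :: ('n, 'k) mpoly set))"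
      if \<alpha>: "\<alpha> \<in> G" "\<alpha> x > 0" for \<alpha>
    proof -
      have sm: "Suc (card (low D b)) < d" if "corner D (link x \<alpha> G) b" for b
        using small[OF corner_of_link(1)[OF bnd \<alpha> that], unfolded corner_of_link(2)[OF bnd \<alpha> that]]
          corner_of_link(3)[OF bnd \<alpha> that] by simp
      have "res_len (d - 1) (emb UNIV) (emb (mideal (upset (link x \<alpha> G)) :: ('n, 'k) mpoly set))"
        by (rule insert.IH[OF _ generic_link[OF gen] bounded_link[OF bnd] supp(2)])
          (use fin sm in \<open>fastforce simp: link_def\<close>)+
      moreover have "b(x := c) \<in> upset (link x \<alpha> G) \<longleftrightarrow> b \<in> upset (link x \<alpha> G)" for b c
        by (simp add: upset_link[of \<alpha> x] \<alpha>(2) fun_upd_def cong: if_cong)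
      ultimately have *: "res_len (Suc (d - 1)) (emb UNIV)
          (emb (mideal (upset (link x \<alpha> G) \<union> {b. b x \<ge> \<alpha> x}) :: ('n, 'k) mpoly set))"
        by (intro res_len_add_power up_closed_upset)
      show ?thesis
      \<comment> \<open>For d = 0 the predecessor is not smaller, but then the link has no corners
        at all and generates the unit ideal.\<close>
      proof (cases d)
        case 0
        then have "(\<lambda>_. 0) \<in> link x \<alpha> G" using corner_exists[of "link x \<alpha> G" D] sm by (metis not_less_zero)
        then have "upset (link x \<alpha> G) = UNIV" by (auto simp: upset_def le_fun_def)
        then show ?thesis using 0 by simp
      next
        case (Suc e)
        then show ?thesis using * by simp
      qed
    qed
    \<comment> \<open>Downward along the filtration: T = G gives the saturation by x, T empty the
      ideal itself, and T is always closed under passing to smaller x-exponents.\<close>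
    have filt: "res_len d (emb UNIV) (emb (mideal (upset (G \<union> drop_var x T)) :: ('n, 'k) mpoly set))"
      if "T \<subseteq> G" "\<And>g h. g \<in> T \<Longrightarrow> h \<in> G \<Longrightarrow> h x < g x \<Longrightarrow> h \<in> T" for T
      using that
    proof (induction "card (G - T)" arbitrary: T rule: less_induct)
      case less
      show ?case
      proof (cases "T = G")
        case True
        have "upset (G \<union> drop_var x G) = upset (drop_var x G)"
        proof -
          have "g(x := 0) \<le> a" if "g \<le> a" for g a :: "'n \<Rightarrow> nat"
            using that by (auto simp: le_fun_def)
          then show ?thesis by (auto simp: upset_def drop_var_def)
        qed
        then show ?thesis using top True by simp
      next
        case False
        then obtain g where "g \<in> G - T" using less.prems(1) by blast
        \<comment> \<open>The next generator must have least x-exponent outside T, so that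
          everything below it in x is already in T.\<close>
        then have "\<exists>\<alpha>. \<alpha> \<in> G - T \<and> (\<forall>g. g \<in> G - T \<longrightarrow> \<alpha> x \<le> g x)"
          by (rule ex_has_least_nat[of "\<lambda>g. g \<in> G - T" _ "\<lambda>g. g x"])
        then obtain \<alpha> where \<alpha>: "\<alpha> \<in> G" "\<alpha> \<notin> T" "\<And>g. g \<in> G \<Longrightarrow> g \<notin> T \<Longrightarrow> \<alpha> x \<le> g x" by blast
        let ?T = "insert \<alpha> T"
        let ?N = "\<lambda>T. upset (G \<union> drop_var x T)"
        have "G - ?T \<subset> G - T" using \<alpha> by blast
        then have "card (G - ?T) < card (G - T)" using fin by (intro psubset_card_mono) auto
        then have IH: "res_len d (emb UNIV) (emb (mideal (?N ?T) :: ('n, 'k) mpoly set))"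
          by (rule less.hyps) (use less.prems \<alpha> in \<open>fastforce simp: not_le\<close>)+
        show ?thesis
        proof (cases "\<alpha> x = 0")
          case True
          then have "\<alpha>(x := 0) = \<alpha>" by auto
          then have "G \<union> drop_var x ?T = G \<union> drop_var x T" using \<alpha>(1) by (auto simp: drop_var_def)
          then show ?thesis using IH by simp
        next
          case False
          then have pos: "\<alpha> x > 0" by simp
          have lt: "g \<in> T" if "g \<in> G" "g x < \<alpha> x" for g
            using \<alpha>(3)[OF that(1)] that(2) by linarith
          have N: "?N ?T = ?N T \<union> {a. \<alpha>(x := 0) \<le> a}" by (auto simp: upset_def drop_var_def)
          have "{b. (\<lambda>s. b s + (\<alpha>(x := 0)) s) \<in> ?N T} = upset (link x \<alpha> G) \<union> {b. b x \<ge> \<alpha> x}"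
            by (rule upset_link_or_power[OF gen less.prems \<alpha>(1,2) pos lt])
          then have res_step: "res_len d (emb (mideal (?N ?T))) (emb (mideal (?N T) :: ('n, 'k) mpoly set))"
            unfolding N using star[OF \<alpha>(1) pos] by (intro res_len_add_monomial up_closed_upset) simp
          have le: "?N T \<subseteq> ?N ?T" by (simp add: N)
          show ?thesis
            by (rule res_len_ext[OF submod_emb_mideal submod_emb_mideal submod_emb_UNIV _ _ res_step IH])
              (intro up_closed_upset emb_mono mideal_mono le subset_UNIV)+
        qed
      qed
    qed
    from filt[of "{}"] show ?case by (simp add: drop_var_def)
  qed
qed

theorem proj_dim_generic_le:
  fixes G :: "('n::finite \<Rightarrow> nat) set"
  assumes "finite G" "generic G" "bounded_by D G"
    and "\<And>a. corner D G a \<Longrightarrow> card (low D a) \<le> d"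
  shows "proj_dim mpoly_ring (quotient_module mpoly_ring (mideal (upset G) :: ('n, 'k::field) mpoly set)) \<le> enat d"
proof (rule res_len_proj_dim[OF ideal_mideal[OF up_closed_upset]])
  show "res_len (Suc d) (emb UNIV) (emb (mideal (upset G) :: ('n, 'k) mpoly set))"
    by (rule res_len_generic[OF assms(1-3), of UNIV]) (use assms(4) in \<open>auto simp: supported_in_def less_Suc_eq_le\<close>)
qed

section \<open>Monomial primes and their heights\<close>

lemma primeideal_rtaD:
  fixes Q :: "'a::comm_ring_1 set"
  assumes "primeideal Q ring_of_type_algebra"
  shows "ideal Q ring_of_type_algebra" "1 \<notin> Q" "x * y \<in> Q \<Longrightarrow> x \<in> Q \<or> y \<in> Q"
proof -
  interpret primeideal Q "ring_of_type_algebra :: 'a ring" by fact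
  show id: "ideal Q ring_of_type_algebra" by (rule is_ideal)
  show one: "1 \<notin> Q"
  proof
    assume "1 \<in> Q"
    then have "x \<in> Q" for x using ideal_rtaD(3)[OF id, of 1 x] by simp
    then show False using I_notcarr by auto
  qed
  show "x * y \<in> Q \<Longrightarrow> x \<in> Q \<or> y \<in> Q" using I_prime[of x y] by simp
qed

definition var_prime :: "'n set \<Rightarrow> ('n::finite, 'k::field) mpoly set" where
  "var_prime F = mideal {a. \<exists>s\<in>F. a s > 0}"

definition var_mon :: "'n \<Rightarrow> ('n::finite, 'k::field) mpoly" where
  "var_mon s = Poly_Mapping.single (Poly_Mapping.single s 1) 1"

text \<open>Take the largest elements of A and B in a linear order compatible with addition: any
  other pair has a smaller sum.\<close>

lemma unique_sum:
  fixes A B :: "('n::finite \<Rightarrow>\<^sub>0 nat) set"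
  assumes "finite A" "A \<noteq> {}" "finite B" "B \<noteq> {}"
  obtains a b where "a \<in> A" "b \<in> B" "\<And>a' b'. a' \<in> A \<Longrightarrow> b' \<in> B \<Longrightarrow> a' + b' = a + b \<Longrightarrow> a' = a \<and> b' = b"
proof -
  obtain idx :: "'n \<Rightarrow> nat" where idx: "inj idx"
    using finite_imp_inj_to_nat_seg[of "UNIV :: 'n set"] by auto
  \<comment> \<open>Numbering the variables carries exponents into
    \<open>nat \<Rightarrow>\<^sub>0 nat\<close>, where such an order is available.\<close>
  define T where "T a = (\<Sum>s\<in>UNIV. Poly_Mapping.single (idx s) (Poly_Mapping.lookup a s))" for a :: "'n \<Rightarrow>\<^sub>0 nat"
  have T_add: "T (a + b) = T a + T b" for a b
    by (simp add: T_def lookup_add single_add sum.distrib)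
  have lookup_T: "Poly_Mapping.lookup (T a) (idx s) = Poly_Mapping.lookup a s" for a s
    using idx by (simp add: T_def lookup_sum lookup_single when_def inj_eq sum.delta)
  have T_inj: "T a = T b \<Longrightarrow> a = b" for a b
    by (rule poly_mapping_eqI) (metis lookup_T)
  obtain a where a: "a \<in> A" "\<And>a'. a' \<in> A \<Longrightarrow> T a' \<le> T a"
  proof -
    have "Max (T ` A) \<in> T ` A" using assms by (intro Max_in) auto
    then obtain a where "a \<in> A" "T a = Max (T ` A)" by auto
    then show ?thesis using that[of a] assms by auto
  qed
  obtain b where b: "b \<in> B" "\<And>b'. b' \<in> B \<Longrightarrow> T b' \<le> T b"
  proof -
    have "Max (T ` B) \<in> T ` B" using assms by (intro Max_in) auto
    then obtain b where "b \<in> B" "T b = Max (T ` B)" by auto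
    then show ?thesis using that[of b] assms by auto
  qed
  have "a' = a \<and> b' = b" if "a' \<in> A" "b' \<in> B" "a' + b' = a + b" for a' b'
  proof -
    have eq: "T a' + T b' = T a + T b" using that(3) by (metis T_add)
    have le: "T a' \<le> T a" "T b' \<le> T b" using a b that by auto
    have "\<not> T a' < T a"
    proof
      assume "T a' < T a"
      from add_less_le_mono[OF this le(2)] show False using eq by simp
    qed
    moreover have "\<not> T b' < T b"
    proof
      assume "T b' < T b"
      from add_le_less_mono[OF le(1) this] show False using eq by simp
    qed
    ultimately have "T a' = T a" "T b' = T b" using le by (simp_all add: order.order_iff_strict)
    then show ?thesis using T_inj by blast
  qed
  then show ?thesis using that a b by blast
qed

lemma lookup_mult_sum:
  fixes p q :: "('n::finite, 'k::field) mpoly"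
  shows "Poly_Mapping.lookup (p * q) k = (\<Sum>(a, b)\<in>Poly_Mapping.keys p \<times> Poly_Mapping.keys q.
    if a + b = k then Poly_Mapping.lookup p a * Poly_Mapping.lookup q b else 0)"
proof -
  have "p * q = (\<Sum>a\<in>Poly_Mapping.keys p. Poly_Mapping.single a (Poly_Mapping.lookup p a)) *
      (\<Sum>b\<in>Poly_Mapping.keys q. Poly_Mapping.single b (Poly_Mapping.lookup q b))"
    by (simp only: sum_single)
  also have "\<dots> = (\<Sum>(a, b)\<in>Poly_Mapping.keys p \<times> Poly_Mapping.keys q.
      Poly_Mapping.single (a + b) (Poly_Mapping.lookup p a * Poly_Mapping.lookup q b))"
    by (simp add: sum_product sum.cartesian_product mult_single)
  finally show ?thesis
    by (auto simp: lookup_sum lookup_single when_def intro!: sum.cong)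
qed

text \<open>A sum attained by a single pair of exponents has as coefficient one product of nonzero
  field elements, so nothing can cancel it.\<close>

lemma keys_mult_unique:
  fixes p q :: "('n::finite, 'k::field) mpoly"
  assumes "a \<in> Poly_Mapping.keys p" "b \<in> Poly_Mapping.keys q"
    and uniq: "\<And>a' b'. a' \<in> Poly_Mapping.keys p \<Longrightarrow> b' \<in> Poly_Mapping.keys q \<Longrightarrow> a' + b' = a + b \<Longrightarrow>
      a' = a \<and> b' = b"
  shows "a + b \<in> Poly_Mapping.keys (p * q)"
proof -
  have "(if a' + b' = a + b then Poly_Mapping.lookup p a' * Poly_Mapping.lookup q b' else 0) =
      (if (a', b') = (a, b) then Poly_Mapping.lookup p a * Poly_Mapping.lookup q b else 0)"
    if "a' \<in> Poly_Mapping.keys p" "b' \<in> Poly_Mapping.keys q" for a' b'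
    using uniq[OF that] by auto
  then have "Poly_Mapping.lookup (p * q) (a + b) =
      (\<Sum>x\<in>Poly_Mapping.keys p \<times> Poly_Mapping.keys q.
        if x = (a, b) then Poly_Mapping.lookup p a * Poly_Mapping.lookup q b else 0)"
    unfolding lookup_mult_sum by (intro sum.cong) (auto split: if_split_asm)
  also have "\<dots> = Poly_Mapping.lookup p a * Poly_Mapping.lookup q b"
    using assms(1,2) by (simp add: sum.delta)
  finally show ?thesis using assms(1,2) by (simp add: in_keys_iff)
qed

lemma var_prime_notin:
  fixes p :: "('n::finite, 'k::field) mpoly"
  shows "p \<notin> var_prime F \<longleftrightarrow> (\<exists>a\<in>Poly_Mapping.keys p. \<forall>s\<in>F. Poly_Mapping.lookup a s = 0)"
  by (auto simp: var_prime_def mideal_def)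

text \<open>\<open>unique_sum\<close> is applied to the exponents avoiding F. Other pairs cannot
  interfere, because a sum that vanishes on F has both summands vanishing there.\<close>

lemma var_prime_mult_notin:
  fixes p q :: "('n::finite, 'k::field) mpoly"
  assumes "p \<notin> var_prime F" "q \<notin> var_prime F"
  obtains a b where "a + b \<in> Poly_Mapping.keys (p * q)"
    "\<forall>s\<in>F. Poly_Mapping.lookup a s = 0" "\<forall>s\<in>F. Poly_Mapping.lookup b s = 0"
proof -
  let ?z = "\<lambda>a. \<forall>s\<in>F. Poly_Mapping.lookup a s = 0"
  let ?A = "{a \<in> Poly_Mapping.keys p. ?z a}" and ?B = "{b \<in> Poly_Mapping.keys q. ?z b}"
  have ne: "finite ?A" "?A \<noteq> {}" "finite ?B" "?B \<noteq> {}" using assms by (auto simp: var_prime_notin)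
  obtain a b where ab: "a \<in> ?A" "b \<in> ?B"
    and uniq: "\<And>a' b'. a' \<in> ?A \<Longrightarrow> b' \<in> ?B \<Longrightarrow> a' + b' = a + b \<Longrightarrow> a' = a \<and> b' = b"
    by (rule unique_sum[OF ne]) blast
  have "a + b \<in> Poly_Mapping.keys (p * q)"
  proof (rule keys_mult_unique)
    fix a' b' assume *: "a' \<in> Poly_Mapping.keys p" "b' \<in> Poly_Mapping.keys q" "a' + b' = a + b"
    have "Poly_Mapping.lookup a' s = 0 \<and> Poly_Mapping.lookup b' s = 0" if "s \<in> F" for s
      using arg_cong[OF *(3), of "\<lambda>c. Poly_Mapping.lookup c s"] ab that by (simp add: lookup_add)
    then show "a' = a \<and> b' = b" using uniq[of a' b'] * by auto
  qed (use ab in auto)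
  then show ?thesis using that ab by simp
qed

lemma var_prime_prime:
  "primeideal (var_prime F) (mpoly_ring :: ('n::finite, 'k::field) mpoly ring)"
proof (rule primeidealI)
  show "ideal (var_prime F) (mpoly_ring :: ('n, 'k) mpoly ring)"
    unfolding var_prime_def
    by (rule ideal_mideal) (auto simp: up_closed_def le_fun_def intro: less_le_trans)
  show "cring (mpoly_ring :: ('n, 'k) mpoly ring)" by (rule cring_from_type_algebra)
  have "(1 :: ('n, 'k) mpoly) \<notin> var_prime F" by (simp add: var_prime_notin)
  then show "carrier (mpoly_ring :: ('n, 'k) mpoly ring) \<noteq> var_prime F" by auto
  fix p q :: "('n, 'k) mpoly"
  assume pq: "p \<otimes>\<^bsub>mpoly_ring\<^esub> q \<in> var_prime F"
  show "p \<in> var_prime F \<or> q \<in> var_prime F"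
  proof (rule ccontr)
    assume "\<not> (p \<in> var_prime F \<or> q \<in> var_prime F)"
    then have "p \<notin> var_prime F" "q \<notin> var_prime F" by auto
    then obtain a b where "a + b \<in> Poly_Mapping.keys (p * q)"
      "\<forall>s\<in>F. Poly_Mapping.lookup a s = 0" "\<forall>s\<in>F. Poly_Mapping.lookup b s = 0"
      by (rule var_prime_mult_notin)
    then have "p * q \<notin> var_prime F"
      unfolding var_prime_notin by (intro bexI[of _ "a + b"]) (auto simp: lookup_add)
    then show False using pq by simp
  qed
qed

lemma var_mon_in: "var_mon s \<in> var_prime F \<longleftrightarrow> s \<in> F"
  by (auto simp: var_mon_def var_prime_def single_in_mideal lookup_single when_def)

lemma var_prime_mono: "F \<subseteq> F' \<Longrightarrow> var_prime F \<subseteq> var_prime F'"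
  unfolding var_prime_def by (rule mideal_mono) auto

lemma var_prime_subset_iff: "var_prime F \<subseteq> (var_prime F' :: ('n::finite, 'k::field) mpoly set) \<longleftrightarrow> F \<subseteq> F'"
  using var_prime_mono var_mon_in by (metis subset_iff)

lemma var_prime_psubset_iff: "var_prime F \<subset> (var_prime F' :: ('n::finite, 'k::field) mpoly set) \<longleftrightarrow> F \<subset> F'"
  by (auto simp: psubset_eq var_prime_subset_iff) (metis subset_refl var_prime_subset_iff subset_antisym)+

section \<open>Algebraic independence modulo a prime and its bound\<close>

definition exps :: "nat \<Rightarrow> nat \<Rightarrow> nat list set" where
  "exps m N = {l. set l \<subseteq> {..N} \<and> length l = m}"

primrec mono_prod :: "'a::comm_ring_1 list \<Rightarrow> nat list \<Rightarrow> 'a" where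
  "mono_prod [] l = 1"
| "mono_prod (z # zs) l = z ^ hd l * mono_prod zs (tl l)"

definition const :: "'k::field \<Rightarrow> ('n::finite, 'k) mpoly" where
  "const c = Poly_Mapping.single 0 c"

text \<open>Algebraic independence over the field of the residues modulo Q. Polynomials in
  \<open>zs\<close> are given by coefficients on a box of exponents, which makes them easy to
  count.\<close>

definition indep_mod :: "('n::finite, 'k::field) mpoly set \<Rightarrow> ('n, 'k) mpoly list \<Rightarrow> bool" where
  "indep_mod Q zs \<longleftrightarrow> (\<forall>N c. (\<Sum>l\<in>exps (length zs) N. const (c l) * mono_prod zs l) \<in> Q \<longrightarrow>
     (\<forall>l\<in>exps (length zs) N. c l = 0))"

lemma finite_exps [simp]: "finite (exps m N)"
  by (simp add: exps_def finite_lists_length_eq)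

lemma card_exps: "card (exps m N) = Suc N ^ m"
  by (simp add: exps_def card_lists_length_eq)

lemma exps_0: "exps 0 N = {[]}"
  by (auto simp: exps_def)

lemma sum_exps_Suc: "sum f (exps (Suc m) N) = (\<Sum>i\<le>N. \<Sum>l\<in>exps m N. f (i # l))"
proof -
  have "exps (Suc m) N = (\<lambda>(i, l). i # l) ` ({..N} \<times> exps m N)"
    by (auto simp: exps_def length_Suc_conv image_iff)
  moreover have "inj_on (\<lambda>(i, l). i # l) ({..N} \<times> exps m N)" by (auto simp: inj_on_def)
  ultimately show ?thesis
    by (simp add: sum.reindex sum.cartesian_product case_prod_unfold)
qed

text \<open>Modulo Q' only the term \<open>g 0\<close> remains, so it is zero; f can then be
  cancelled because it is outside the prime Q, and the argument repeats.\<close>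

lemma power_expansion_zero:
  fixes f :: "'a::comm_ring_1"
  assumes Q: "primeideal Q ring_of_type_algebra" and Q': "ideal Q' ring_of_type_algebra" and sub: "Q \<subseteq> Q'"
    and f: "f \<in> Q'" "f \<notin> Q"
    and "(\<Sum>i\<le>N. f ^ i * g i) \<in> Q" "\<And>i. i \<le> N \<Longrightarrow> g i \<in> Q' \<Longrightarrow> g i = 0" "i \<le> N"
  shows "g i = 0"
  using assms(6-)
proof (induction N arbitrary: g i)
  case 0
  then show ?case using sub by auto
next
  case (Suc N)
  note pQ = primeideal_rtaD[OF Q]
  have "(\<Sum>i\<le>Suc N. f ^ i * g i) = g 0 + f * (\<Sum>i\<le>N. f ^ i * g (Suc i))"
    by (simp add: sum.atMost_Suc_shift sum_distrib_left mult.assoc del: sum.atMost_Suc)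
  then have *: "g 0 + f * (\<Sum>i\<le>N. f ^ i * g (Suc i)) \<in> Q" using Suc.prems(1) by simp
  have "f * (\<Sum>i\<le>N. f ^ i * g (Suc i)) \<in> Q'"
    using ideal_rtaD(3)[OF Q' f(1), of "\<Sum>i\<le>N. f ^ i * g (Suc i)"] by (simp add: mult.commute)
  moreover have "g 0 + f * (\<Sum>i\<le>N. f ^ i * g (Suc i)) \<in> Q'" using * sub by blast
  ultimately have "g 0 \<in> Q'" using ideal_rtaD(5)[OF Q'] by fastforce
  then have g0: "g 0 = 0" using Suc.prems(2) by simp
  then have "(\<Sum>i\<le>N. f ^ i * g (Suc i)) \<in> Q" using * pQ(3) f(2) by auto
  then have "g (Suc j) = 0" if "j \<le> N" for j
    using Suc.IH[of "\<lambda>i. g (Suc i)" j] Suc.prems(2) that by auto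
  then show ?case using g0 Suc.prems(3) by (cases i) auto
qed

text \<open>A relation is sorted by powers of f. Its coefficients are polynomials in
  \<open>zs\<close>, and by independence modulo Q' such a polynomial lies in Q' only if it is zero,
  which is what \<open>power_expansion_zero\<close> requires.\<close>

lemma indep_mod_Cons:
  assumes ind: "indep_mod Q' zs" and Q: "primeideal Q mpoly_ring" and Q': "primeideal Q' mpoly_ring"
    and sub: "Q \<subseteq> Q'" and f: "f \<in> Q'" "f \<notin> Q"
  shows "indep_mod Q (f # zs)"
  unfolding indep_mod_def
proof (intro allI impI)
  fix N c
  assume "(\<Sum>l\<in>exps (length (f # zs)) N. const (c l) * mono_prod (f # zs) l) \<in> Q"
  also have "(\<Sum>l\<in>exps (length (f # zs)) N. const (c l) * mono_prod (f # zs) l) =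
      (\<Sum>i\<le>N. f ^ i * (\<Sum>l\<in>exps (length zs) N. const (c (i # l)) * mono_prod zs l))"
    by (simp add: sum_exps_Suc sum_distrib_left mult.left_commute)
  finally have s: "(\<Sum>i\<le>N. f ^ i * (\<Sum>l\<in>exps (length zs) N. const (c (i # l)) * mono_prod zs l)) \<in> Q" .
  have c0: "c (i # l) = 0"
    if "(\<Sum>l\<in>exps (length zs) N. const (c (i # l)) * mono_prod zs l) \<in> Q'" "l \<in> exps (length zs) N" for i l
    using ind[unfolded indep_mod_def, rule_format, of "\<lambda>l. c (i # l)" N] that by blast
  have z: "(\<Sum>l\<in>exps (length zs) N. const (c (i # l)) * mono_prod zs l) = 0" if "i \<le> N" for i
  proof (rule power_expansion_zero[OF Q primeideal_rtaD(1)[OF Q'] sub f s _ that])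
    fix i assume "(\<Sum>l\<in>exps (length zs) N. const (c (i # l)) * mono_prod zs l) \<in> Q'"
    then show "(\<Sum>l\<in>exps (length zs) N. const (c (i # l)) * mono_prod zs l) = 0"
      using c0 by (intro sum.neutral) (simp add: const_def)
  qed
  show "\<forall>l\<in>exps (length (f # zs)) N. c l = 0"
  proof
    fix l assume "l \<in> exps (length (f # zs)) N"
    then obtain i l' where l: "l = i # l'" "i \<le> N" "l' \<in> exps (length zs) N"
      by (auto simp: exps_def length_Suc_conv)
    then show "c l = 0" using c0[of i l'] z[of i] ideal_rtaD(1)[OF primeideal_rtaD(1)[OF Q']] by simp
  qed
qed

lemma indep_mod_Nil:
  fixes Q :: "('n::finite, 'k::field) mpoly set"
  assumes "primeideal Q mpoly_ring"
  shows "indep_mod Q []"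
  unfolding indep_mod_def
proof (intro allI impI)
  fix N :: nat and c :: "nat list \<Rightarrow> 'k"
  assume "(\<Sum>l\<in>exps (length []) N. const (c l) * mono_prod [] l) \<in> Q"
  then have *: "const (c []) \<in> Q" by (simp add: exps_0)
  have "c [] = 0"
  proof (rule ccontr)
    assume "c [] \<noteq> 0"
    then have "const (inverse (c [])) * const (c []) = (1 :: ('n, 'k) mpoly)" by (simp add: const_def mult_single)
    then show False
      using ideal_rtaD(3)[OF primeideal_rtaD(1)[OF assms] *, of "const (inverse (c []))"] primeideal_rtaD(2)[OF assms]
      by simp
  qed
  then show "\<forall>l\<in>exps (length []) N. c l = 0" by (simp add: exps_0)
qed

lemma indep_mod_chain:
  assumes "\<forall>i\<le>t. primeideal (Q i) mpoly_ring" "\<forall>i<t. Q i \<subset> Q (Suc i)" "indep_mod (Q t) zs"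
  obtains zs' where "indep_mod (Q 0) zs'" "length zs' = length zs + t"
  using assms
proof (induction t arbitrary: zs thesis)
  case 0
  then show ?case by simp
next
  case (Suc t)
  obtain f where f: "f \<in> Q (Suc t)" "f \<notin> Q t" using Suc.prems(3) by blast
  have "indep_mod (Q t) (f # zs)"
    by (rule indep_mod_Cons[OF Suc.prems(4) _ _ _ f]) (use Suc.prems in auto)
  then show ?case
    using Suc.IH[of "f # zs"] Suc.prems by (metis add_Suc_shift le_SucI length_Cons less_SucI)
qed

text \<open>Each exponent is bounded separately, not the total degree, so that the admissible
  monomials form a box.\<close>

definition deg_le :: "nat \<Rightarrow> ('n::finite, 'k::field) mpoly \<Rightarrow> bool" where
  "deg_le b p \<longleftrightarrow> (\<forall>a\<in>Poly_Mapping.keys p. \<forall>s. Poly_Mapping.lookup a s \<le> b)"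

lemma deg_le_mult: "deg_le b p \<Longrightarrow> deg_le c q \<Longrightarrow> deg_le (b + c) (p * q)"
  using keys_mult[of p q] by (fastforce simp: deg_le_def lookup_add intro: add_mono)

lemma deg_le_power: "deg_le b p \<Longrightarrow> deg_le (i * b) (p ^ i)"
proof (induction i)
  case 0
  then show ?case by (simp add: deg_le_def)
next
  case (Suc i)
  then show ?case using deg_le_mult[of b p "i * b" "p ^ i"] by simp
qed

lemma deg_le_mono: "deg_le b p \<Longrightarrow> b \<le> c \<Longrightarrow> deg_le c p"
  by (fastforce simp: deg_le_def intro: le_trans)

lemma deg_le_mono_prod:
  assumes "\<And>z. z \<in> set zs \<Longrightarrow> deg_le b z" "l \<in> exps (length zs) N"
  shows "deg_le (length zs * (N * b)) (mono_prod zs l)"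
  using assms
proof (induction zs arbitrary: l)
  case Nil
  then show ?case by (simp add: deg_le_def)
next
  case (Cons z zs)
  then obtain i l' where l: "l = i # l'" "i \<le> N" "l' \<in> exps (length zs) N"
    by (auto simp: exps_def length_Suc_conv)
  have "deg_le (N * b) (z ^ i)" using deg_le_mono[OF deg_le_power[of b z i]] Cons.prems(1) l(2) by simp
  moreover have "deg_le (length zs * (N * b)) (mono_prod zs l')" using Cons l by simp
  ultimately show ?case using deg_le_mult by (fastforce simp: l)
qed

lemma deg_le_exists:
  fixes p :: "('n::finite, 'k::field) mpoly"
  obtains b where "deg_le b p"
proof
  show "deg_le (\<Sum>a\<in>Poly_Mapping.keys p. \<Sum>s\<in>UNIV. Poly_Mapping.lookup a s) p"
    unfolding deg_le_def
  proof (intro ballI allI)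
    fix a s assume a: "a \<in> Poly_Mapping.keys p"
    have "Poly_Mapping.lookup a s \<le> (\<Sum>s\<in>UNIV. Poly_Mapping.lookup a s)"
      by (rule member_le_sum) auto
    also have "\<dots> \<le> (\<Sum>a\<in>Poly_Mapping.keys p. \<Sum>s\<in>UNIV. Poly_Mapping.lookup a s)"
      using member_le_sum[OF a, of "\<lambda>a. \<Sum>s\<in>UNIV. Poly_Mapping.lookup a s"] by auto
    finally show "Poly_Mapping.lookup a s \<le> (\<Sum>a\<in>Poly_Mapping.keys p. \<Sum>s\<in>UNIV. Poly_Mapping.lookup a s)" .
  qed
qed

lemma deg_le_list_exists:
  fixes zs :: "('n::finite, 'k::field) mpoly list"
  shows "\<exists>b. \<forall>z\<in>set zs. deg_le b z"
proof (induction zs)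
  case (Cons z zs)
  then obtain b where b: "\<forall>z\<in>set zs. deg_le b z" by blast
  obtain c where c: "deg_le c z" using deg_le_exists by blast
  have "deg_le (max b c) y" if "y \<in> set (z # zs)" for y
    using that b deg_le_mono[OF c, of "max b c"] deg_le_mono[of b y "max b c"] by auto
  then show ?case by blast
qed simp

interpretation mpoly_vs: vector_space "\<lambda>c (p :: ('n::finite, 'k::field) mpoly). const c * p"
  by unfold_locales (auto simp: const_def algebra_simps single_add mult_single mult.assoc[symmetric])

lemma card_bounded_functions: "card {f :: 'n::finite \<Rightarrow> nat. \<forall>s. f s \<le> b} = Suc b ^ card (UNIV :: 'n set)"
proof -
  have "{f :: 'n \<Rightarrow> nat. \<forall>s. f s \<le> b} = Pi\<^sub>E UNIV (\<lambda>_. {..b})"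
    by (auto simp: PiE_def Pi_def extensional_def)
  then show ?thesis by (simp add: card_PiE)
qed

lemma finite_bounded_functions: "finite {f :: 'n::finite \<Rightarrow> nat. \<forall>s. f s \<le> b}"
  using card_bounded_functions[of b, where 'n = 'n] card.infinite by fastforce

text \<open>Growth comparison: the products of \<open>zs\<close> with exponents up to N are linearly
  independent and number (N+1)^T, while their monomials lie in a box whose size grows only like
  N^n.\<close>

lemma indep_mod_length:
  fixes zs :: "('n::finite, 'k::field) mpoly list"
  assumes Q: "primeideal Q mpoly_ring" and ind: "indep_mod Q zs"
  shows "length zs \<le> card (UNIV :: 'n set)"
proof (rule ccontr)
  let ?n = "card (UNIV :: 'n set)" and ?T = "length zs"
  assume "\<not> ?T \<le> ?n"
  then have T: "Suc ?n \<le> ?T" by simp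
  obtain b where b: "\<And>z. z \<in> set zs \<Longrightarrow> deg_le b z" using deg_le_list_exists by blast
  have Q0: "0 \<in> Q" using ideal_rtaD(1)[OF primeideal_rtaD(1)[OF Q]] .
  have count: "Suc N ^ ?T \<le> Suc (?T * (N * b)) ^ ?n" for N
  proof -
    let ?L = "exps ?T N" and ?d = "?T * (N * b)"
    let ?B = "(\<lambda>f. Poly_Mapping.single (expo f) 1 :: ('n, 'k) mpoly) ` {f. \<forall>s. f s \<le> ?d}"
    have lin: "c l = 0" if "(\<Sum>l\<in>?L. const (c l) * mono_prod zs l) = 0" "l \<in> ?L" for c l
      using ind[unfolded indep_mod_def, rule_format, of c N l] that Q0 by simp
    \<comment> \<open>Linear independence concerns the set of products; two equal ones would satisfy
      the relation with coefficients 1 and -1.\<close>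
    have inj: "inj_on (mono_prod zs) ?L"
    proof (rule inj_onI, rule ccontr)
      fix l l' assume l: "l \<in> ?L" "l' \<in> ?L" "mono_prod zs l = mono_prod zs l'" "l \<noteq> l'"
      define c where "c x = (if x = l then 1 else if x = l' then - 1 else 0 :: 'k)" for x
      have "(\<Sum>x\<in>?L. const (c x) * mono_prod zs x) = (\<Sum>x\<in>{l, l'}. const (c x) * mono_prod zs x)"
        using l by (intro sum.mono_neutral_right) (auto simp: c_def const_def)
      also have "\<dots> = 0" using l by (simp add: c_def const_def single_uminus)
      finally show False using lin[of c l] l by (simp add: c_def)
    qed
    have "mpoly_vs.independent (mono_prod zs ` ?L)"
    proof (rule mpoly_vs.independent_if_scalars_zero)
      fix f x assume "(\<Sum>x\<in>mono_prod zs ` ?L. const (f x) * x) = 0" "x \<in> mono_prod zs ` ?L"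
      then show "f x = 0" using lin[of "\<lambda>l. f (mono_prod zs l)"] by (auto simp: sum.reindex[OF inj])
    qed simp
    moreover have "mono_prod zs ` ?L \<subseteq> mpoly_vs.span ?B"
    proof
      fix p assume "p \<in> mono_prod zs ` ?L"
      then have p: "deg_le ?d p" using deg_le_mono_prod[OF b] by auto
      have "(\<Sum>a\<in>Poly_Mapping.keys p. Poly_Mapping.single a (Poly_Mapping.lookup p a)) \<in> mpoly_vs.span ?B"
      proof (rule mpoly_vs.span_sum)
        fix a assume a: "a \<in> Poly_Mapping.keys p"
        have "Poly_Mapping.single a 1 \<in> ?B"
          using a p by (intro image_eqI[of _ _ "Poly_Mapping.lookup a"]) (auto simp: deg_le_def)
        then have "const (Poly_Mapping.lookup p a) * Poly_Mapping.single a 1 \<in> mpoly_vs.span ?B"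
          by (intro mpoly_vs.span_scale mpoly_vs.span_base)
        then show "Poly_Mapping.single a (Poly_Mapping.lookup p a) \<in> mpoly_vs.span ?B"
          by (simp add: const_def mult_single)
      qed
      then show "p \<in> mpoly_vs.span ?B" by (simp only: sum_single)
    qed
    ultimately have "card (mono_prod zs ` ?L) \<le> card ?B"
      using mpoly_vs.independent_span_bound[of ?B "mono_prod zs ` ?L"] finite_bounded_functions by blast
    also have "\<dots> \<le> Suc ?d ^ ?n"
      using card_image_le[OF finite_bounded_functions] card_bounded_functions by metis
    finally show ?thesis by (simp add: card_image[OF inj] card_exps)
  qed
  \<comment> \<open>E absorbs the degree bound, as \<open>Suc (?T * (N * b))\<close> is at most
    \<open>E * Suc N\<close>. With N = E^n the factor E^n is just below N + 1, which makes the
    comparison strict.\<close>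
  define E where "E = Suc (?T * b)"
  define N where "N = E ^ ?n"
  have "Suc N ^ Suc ?n \<le> Suc N ^ ?T" using T by (intro power_increasing) auto
  also have "\<dots> \<le> Suc (?T * (N * b)) ^ ?n" by (rule count)
  also have "\<dots> \<le> (E * Suc N) ^ ?n" by (intro power_mono) (auto simp: E_def algebra_simps)
  also have "\<dots> = N * Suc N ^ ?n" by (simp only: power_mult_distrib N_def)
  also have "\<dots> < Suc N ^ Suc ?n" by simp
  finally show False by simp
qed

section \<open>Heights of the monomial primes\<close>

lemma prime_height_mono:
  assumes "primeideal P' R" "P \<subseteq> P'"
  shows "prime_height R P \<le> prime_height R P'"
proof (cases "P = P'")
  case False
  show ?thesis
    unfolding prime_height_def
  proof (rule Sup_least)
    fix e assume "e \<in> {enat t | t. \<exists>Q. (\<forall>i\<le>t. primeideal (Q i) R) \<and> (\<forall>i<t. Q i \<subset> Q (Suc i)) \<and> Q t = P}"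
    then obtain t Q where e: "e = enat t" and Q: "\<forall>i\<le>t. primeideal (Q i) R" "\<forall>i<t. Q i \<subset> Q (Suc i)" "Q t = P"
      by blast
    define Q' where "Q' i = (if i \<le> t then Q i else P')" for i
    have "(\<forall>i\<le>Suc t. primeideal (Q' i) R) \<and> (\<forall>i<Suc t. Q' i \<subset> Q' (Suc i)) \<and> Q' (Suc t) = P'"
      using Q assms False by (auto simp: Q'_def less_Suc_eq)
    then have "enat (Suc t) \<le> Sup {enat t | t. \<exists>Q. (\<forall>i\<le>t. primeideal (Q i) R) \<and> (\<forall>i<t. Q i \<subset> Q (Suc i)) \<and> Q t = P'}"
      by (intro Sup_upper) blast
    then show "e \<le> Sup {enat t | t. \<exists>Q. (\<forall>i\<le>t. primeideal (Q i) R) \<and> (\<forall>i<t. Q i \<subset> Q (Suc i)) \<and> Q t = P'}"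
      unfolding e by (rule order_trans[rotated]) simp
  qed
qed simp

lemma codim_prime: "primeideal P R \<Longrightarrow> codim R P = prime_height R P"
  unfolding codim_def by (rule antisym) (auto intro: INF_lower INF_greatest prime_height_mono)

lemma var_prime_chain:
  assumes "F \<subseteq> F'"
  obtains t and Q :: "nat \<Rightarrow> ('n::finite, 'k::field) mpoly set" where
    "t = card F' - card F" "\<forall>i\<le>t. primeideal (Q i) mpoly_ring" "\<forall>i<t. Q i \<subset> Q (Suc i)"
    "Q 0 = var_prime F" "Q t = var_prime F'"
proof -
  obtain xs where xs: "set xs = F' - F" "distinct xs" using finite_distinct_list[of "F' - F"] by auto
  have len: "length xs = card F' - card F"
    using distinct_card[OF xs(2)] xs(1) assms by (simp add: card_Diff_subset)
  define Q :: "nat \<Rightarrow> ('n, 'k) mpoly set" where "Q i = var_prime (F \<union> set (take i xs))" for i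
  have "Q i \<subset> Q (Suc i)" if "i < length xs" for i
  proof -
    have "set (take (Suc i) xs) = insert (xs ! i) (set (take i xs))"
      using that by (simp add: take_Suc_conv_app_nth)
    moreover have "xs ! i \<notin> set (take i xs)"
      using that xs(2) by (auto simp: in_set_conv_nth nth_eq_iff_index_eq)
    moreover have "xs ! i \<notin> F" using that xs(1) nth_mem by blast
    ultimately show ?thesis unfolding Q_def var_prime_psubset_iff by auto
  qed
  moreover have "Q 0 = var_prime F" "Q (length xs) = var_prime F'"
    using xs assms by (auto simp: Q_def Un_absorb1)
  moreover have "primeideal (Q i) mpoly_ring" for i unfolding Q_def by (rule var_prime_prime)
  ultimately show ?thesis using that[of "length xs" Q] len by blast
qed

text \<open>For the upper bound, a chain of length t ending in P_F is prolonged by adding the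
  missing variables one by one. The resulting chain has length t + n - |F|, and independence bounds
  it by n.\<close>

theorem prime_height_var_prime:
  "prime_height mpoly_ring (var_prime F :: ('n::finite, 'k::field) mpoly set) = enat (card F)"
proof (rule antisym)
  show "enat (card F) \<le> prime_height mpoly_ring (var_prime F :: ('n, 'k) mpoly set)"
  proof -
    obtain t and Q :: "nat \<Rightarrow> ('n, 'k) mpoly set" where Q: "t = card F - card ({} :: 'n set)"
      "\<forall>i\<le>t. primeideal (Q i) mpoly_ring" "\<forall>i<t. Q i \<subset> Q (Suc i)"
      "Q 0 = var_prime {}" "Q t = var_prime F"
      by (rule var_prime_chain[OF empty_subsetI])
    have "t = card F" using Q(1) by simp
    then show ?thesis unfolding prime_height_def by (intro Sup_upper) (use Q in blast)
  qed
  show "prime_height mpoly_ring (var_prime F :: ('n, 'k) mpoly set) \<le> enat (card F)"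
    unfolding prime_height_def
  proof (rule Sup_least)
    fix e assume "e \<in> {enat t | t. \<exists>Q. (\<forall>i\<le>t. primeideal (Q i) mpoly_ring) \<and> (\<forall>i<t. Q i \<subset> Q (Suc i)) \<and>
      Q t = (var_prime F :: ('n, 'k) mpoly set)}"
    then obtain t and Q :: "nat \<Rightarrow> ('n, 'k) mpoly set" where e: "e = enat t"
      and Q: "\<forall>i\<le>t. primeideal (Q i) mpoly_ring" "\<forall>i<t. Q i \<subset> Q (Suc i)" "Q t = var_prime F"
      by blast
    obtain u and U :: "nat \<Rightarrow> ('n, 'k) mpoly set" where U: "u = card (UNIV :: 'n set) - card F"
      "\<forall>i\<le>u. primeideal (U i) mpoly_ring" "\<forall>i<u. U i \<subset> U (Suc i)" "U 0 = var_prime F"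
      "U u = var_prime UNIV"
      by (rule var_prime_chain[OF subset_UNIV])
    obtain zs where zs: "indep_mod (U 0) zs" "length zs = u"
      using indep_mod_chain[OF U(2,3) indep_mod_Nil] U(2) by auto
    then obtain zs' where "indep_mod (Q 0) zs'" "length zs' = u + t"
      using indep_mod_chain[OF Q(1,2)] Q(3) U(4) by metis
    then have "u + t \<le> card (UNIV :: 'n set)" using indep_mod_length[of "Q 0" zs'] Q(1) by auto
    moreover have "card F \<le> card (UNIV :: 'n set)" by (rule card_mono) auto
    ultimately show "e \<le> enat (card F)" using e U(1) by simp
  qed
qed

corollary codim_var_prime:
  "codim mpoly_ring (var_prime F :: ('n::finite, 'k::field) mpoly set) = enat (card F)"
  by (simp add: codim_prime[OF var_prime_prime] prime_height_var_prime)

section \<open>Associated primes\<close>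

lemma Ass_quotient_iff:
  fixes I :: "'a::comm_ring_1 set"
  assumes I: "ideal I ring_of_type_algebra"
  shows "P \<in> Ass ring_of_type_algebra (quotient_module ring_of_type_algebra I) \<longleftrightarrow>
    primeideal P ring_of_type_algebra \<and> (\<exists>x. P = {r. r * x \<in> I})"
proof -
  let ?R = "ring_of_type_algebra :: 'a ring"
  interpret I: ideal I ?R by fact
  have hom: "(+>\<^bsub>?R\<^esub>) I \<in> ring_hom ?R (?R Quot I)" by (rule I.rcos_ring_hom)
  note zero = rcos_eq_ideal_iff[OF I]
  have ann: "annihilator ?R (quotient_module ?R I) (I +>\<^bsub>?R\<^esub> x) = {r. r * x \<in> I}" for x
    using ring_hom_mult[OF hom, of _ x, symmetric] zero
    by (simp add: annihilator_def quotient_module_def) (simp add: FactRing_def)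
  have car: "carrier (quotient_module ?R I) = range (\<lambda>x. I +>\<^bsub>?R\<^esub> x)"
    by (auto simp: quotient_module_def FactRing_def A_RCOSETS_def')
  show ?thesis unfolding Ass_def car by (auto simp: ann)
qed

text \<open>A product of the monomial of \<open>a\<close> with x^b enters M exactly when b moves
  some finite coordinate: a generator dividing it must exceed \<open>a\<close> somewhere, and being
  bounded by D it can do so only in a finite direction.\<close>

lemma colon_corner:
  assumes "bounded_by D G" "corner D G a"
  shows "{r. r * Poly_Mapping.single (expo a) 1 \<in> mideal (upset G)} =
    (var_prime (low D a) :: ('n::finite, 'k::field) mpoly set)"
proof -
  have "(\<lambda>s. b s + a s) \<in> upset G \<longleftrightarrow> (\<exists>s\<in>low D a. b s > 0)" for b
  proof
    assume "(\<lambda>s. b s + a s) \<in> upset G"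
    then obtain g where g: "g \<in> G" "g \<le> (\<lambda>s. b s + a s)" by (auto simp: upset_def)
    have "\<not> g \<le> a" using assms(2) g(1) by (auto simp: corner_def upset_def)
    then obtain s where s: "g s > a s" by (auto simp: le_fun_def not_le)
    then have "a s < D" using assms(1) g(1) unfolding bounded_by_def by (meson less_le_trans)
    moreover have "b s > 0" using le_funD[OF g(2), of s] s by simp
    ultimately show "\<exists>s\<in>low D a. b s > 0" by (auto simp: low_def)
  next
    assume "\<exists>s\<in>low D a. b s > 0"
    then obtain s where "a s < D" "b s > 0" by (auto simp: low_def)
    then have "a(s := Suc (a s)) \<in> upset G" using assms(2) by (simp add: corner_def)
    moreover have "a(s := Suc (a s)) \<le> (\<lambda>s. b s + a s)" using \<open>b s > 0\<close> by (auto simp: le_fun_def)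
    ultimately show "(\<lambda>s. b s + a s) \<in> upset G" by (rule upset_mono)
  qed
  then show ?thesis by (simp add: mideal_colon var_prime_def)
qed

lemma var_in_prime:
  fixes P :: "('n::finite, 'k::field) mpoly set"
  assumes P: "primeideal P mpoly_ring" and "Poly_Mapping.single (expo u) 1 \<in> P"
  obtains s where "u s > 0" "var_mon s \<in> P"
proof -
  have "\<exists>s. u s > 0 \<and> var_mon s \<in> P"
    using assms(2)
  proof (induction "sum u UNIV" arbitrary: u rule: less_induct)
    case less
    show ?case
    proof (cases "\<exists>s. u s > 0")
      case False
      then have "expo u = 0" by (intro poly_mapping_eqI) simp
      then show ?thesis using less.prems primeideal_rtaD(2)[OF P] by simp
    next
      case True
      then obtain s where s: "u s > 0" by blast
      let ?v = "u(s := u s - 1)"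
      have "expo u = Poly_Mapping.single s 1 + expo ?v"
        using s by (intro poly_mapping_eqI) (auto simp: lookup_add lookup_single when_def)
      then have "var_mon s * Poly_Mapping.single (expo ?v) 1 \<in> P"
        using less.prems by (simp add: var_mon_def mult_single)
      then consider "var_mon s \<in> P" | "Poly_Mapping.single (expo ?v) 1 \<in> P"
        using primeideal_rtaD(3)[OF P] by blast
      then show ?thesis
      proof cases
        case 2
        have "sum ?v UNIV < sum u UNIV"
          using s by (simp add: sum.remove[of UNIV s])
        from less.hyps[OF this 2] obtain t where "?v t > 0" "var_mon t \<in> P" by blast
        then show ?thesis by (metis fun_upd_apply less_imp_diff_less s)
      qed (use s in blast)
    qed
  qed
  then show ?thesis using that by blast
qed

lemma var_prime_subset_prime:
  fixes P :: "('n::finite, 'k::field) mpoly set"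
  assumes P: "ideal P mpoly_ring" and F: "\<And>s. s \<in> F \<Longrightarrow> var_mon s \<in> P"
  shows "var_prime F \<subseteq> P"
proof
  fix q :: "('n, 'k) mpoly" assume q: "q \<in> var_prime F"
  have "Poly_Mapping.single a (Poly_Mapping.lookup q a) \<in> P" if "a \<in> Poly_Mapping.keys q" for a
  proof -
    have "\<exists>s\<in>F. Poly_Mapping.lookup a s > 0" using q that by (simp add: var_prime_def mideal_def)
    then obtain s where s: "s \<in> F" "Poly_Mapping.lookup a s > 0" by blast
    let ?v = "(Poly_Mapping.lookup a)(s := Poly_Mapping.lookup a s - 1)"
    have "a = expo ?v + Poly_Mapping.single s 1"
      using s by (intro poly_mapping_eqI) (auto simp: lookup_add lookup_single when_def)
    then have "Poly_Mapping.single a (Poly_Mapping.lookup q a) =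
        Poly_Mapping.single (expo ?v) (Poly_Mapping.lookup q a) * var_mon s"
      by (simp add: var_mon_def mult_single)
    then show ?thesis using ideal_rtaD(3)[OF P F[OF s(1)]] by simp
  qed
  then show "q \<in> P" by (subst sum_single[symmetric, of q]) (rule ideal_sum_rta[OF P])
qed

text \<open>No grading argument is needed: if \<open>r * p \<in> M\<close> but \<open>r\<close> has a term avoiding \<open>F\<close>, a uniquely
  attained sum of an \<open>F\<close>-avoiding exponent of \<open>r\<close> and an exponent of \<open>p\<close> with smallest colon ideal
  survives in \<open>r * p\<close>, outside \<open>M\<close>.\<close>

lemma associated_prime_corner:
  fixes P :: "('n::finite, 'k::field) mpoly set"
  assumes bnd: "bounded_by D G" and P: "primeideal P mpoly_ring"
    and Pp: "P = {r. r * p \<in> mideal (upset G)}"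
  obtains a where "corner D G a" "P = var_prime (low D a)"
proof -
  let ?U = "upset G"
  define F where "F = {s. var_mon s \<in> P}"
  have inc: "(\<lambda>t. Poly_Mapping.lookup b t + Poly_Mapping.lookup (Poly_Mapping.single s 1) t) \<in> ?U"
    if "s \<in> F" "b \<in> Poly_Mapping.keys p" for s b
  proof -
    have "p * Poly_Mapping.single (Poly_Mapping.single s 1) 1 \<in> mideal ?U"
      using that(1) by (simp add: F_def Pp var_mon_def mult.commute)
    then show ?thesis using that(2) unfolding mideal_colon by (simp add: mideal_def)
  qed
  have inc': "c \<in> ?U"
    if "s \<in> F" "b \<in> Poly_Mapping.keys p" "Poly_Mapping.lookup b \<le> c" "Poly_Mapping.lookup b s < c s" for s b c
  proof (rule upset_mono[OF inc[OF that(1,2)]])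
    show "(\<lambda>t. Poly_Mapping.lookup b t + Poly_Mapping.lookup (Poly_Mapping.single s 1) t) \<le> c"
      using that(3,4) by (auto simp: le_fun_def lookup_single when_def)
  qed
  \<comment> \<open>For a good exponent b, every monomial carrying x^b into M involves a variable of
    F.\<close>
  define good where "good b \<longleftrightarrow> (\<forall>u. (\<lambda>t. Poly_Mapping.lookup b t + u t) \<in> ?U \<longrightarrow> (\<exists>s\<in>F. u s > 0))" for b
  let ?B = "{b \<in> Poly_Mapping.keys p. good b}"
  have "\<forall>b. \<exists>u. \<not> good b \<longrightarrow> (\<lambda>t. Poly_Mapping.lookup b t + u t) \<in> ?U \<and> (\<forall>s\<in>F. u s = 0)"
    unfolding good_def by auto
  then obtain w where w: "\<And>b. \<not> good b \<Longrightarrow> (\<lambda>t. Poly_Mapping.lookup b t + w b t) \<in> ?U"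
    "\<And>b s. \<not> good b \<Longrightarrow> s \<in> F \<Longrightarrow> w b s = 0" by metis
  \<comment> \<open>One exponent avoiding F that carries all bad terms of p into M simultaneously,
    namely the sum of their individual witnesses.\<close>
  define u where "u = (\<lambda>t. \<Sum>b\<in>{b \<in> Poly_Mapping.keys p. \<not> good b}. w b t)"
  have u0: "u s = 0" if "s \<in> F" for s using w(2) that by (simp add: u_def)
  have ubad: "(\<lambda>t. Poly_Mapping.lookup b t + u t) \<in> ?U" if "b \<in> Poly_Mapping.keys p" "\<not> good b" for b
  proof (rule upset_mono[OF w(1)[OF that(2)]])
    have "w b t \<le> u t" for t
      unfolding u_def by (rule member_le_sum) (use that in auto)
    then show "(\<lambda>t. Poly_Mapping.lookup b t + w b t) \<le> (\<lambda>t. Poly_Mapping.lookup b t + u t)"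
      by (simp add: le_fun_def)
  qed
  \<comment> \<open>If all terms were bad, x^u would lie in P, and primality would give a variable
    of F dividing x^u.\<close>
  have B_ne: "?B \<noteq> {}"
  proof
    assume "?B = {}"
    then have "p \<in> mideal {b. (\<lambda>s. b s + u s) \<in> ?U}" using ubad by (auto simp: mideal_def)
    then have "p * Poly_Mapping.single (expo u) 1 \<in> mideal ?U" using mideal_colon[of p "expo u" ?U] by simp
    then have "Poly_Mapping.single (expo u) 1 \<in> P" by (simp add: Pp mult.commute)
    then obtain s where "u s > 0" "var_mon s \<in> P" by (rule var_in_prime[OF P])
    then show False using u0[of s] by (simp add: F_def)
  qed
  have "P \<subseteq> var_prime F"
  proof
    fix r assume r: "r \<in> P"
    show "r \<in> var_prime F"
    proof (rule ccontr)
      assume "r \<notin> var_prime F"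
      let ?A = "{a \<in> Poly_Mapping.keys r. \<forall>s\<in>F. Poly_Mapping.lookup a s = 0}"
      have ne: "finite ?A" "?A \<noteq> {}" "finite ?B" "?B \<noteq> {}"
        using \<open>r \<notin> var_prime F\<close> B_ne by (auto simp: var_prime_notin)
      obtain a b where ab: "a \<in> ?A" "b \<in> ?B"
        and uniq: "\<And>a' b'. a' \<in> ?A \<Longrightarrow> b' \<in> ?B \<Longrightarrow> a' + b' = a + b \<Longrightarrow> a' = a \<and> b' = b"
        by (rule unique_sum[OF ne]) blast
      have goodb: "good b" using ab by simp
      have la: "Poly_Mapping.lookup (x + y) = (\<lambda>t. Poly_Mapping.lookup y t + Poly_Mapping.lookup x t)"
        for x y :: "'n \<Rightarrow>\<^sub>0 nat" by (auto simp: lookup_add)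
      have out: "(\<lambda>t. Poly_Mapping.lookup (a + b) t + u t) \<notin> ?U"
      proof
        assume "(\<lambda>t. Poly_Mapping.lookup (a + b) t + u t) \<in> ?U"
        then have "(\<lambda>t. Poly_Mapping.lookup b t + (Poly_Mapping.lookup a t + u t)) \<in> ?U"
          by (simp add: la add.assoc)
        from goodb[unfolded good_def, THEN spec, THEN mp, OF this]
        have "\<exists>s\<in>F. Poly_Mapping.lookup a s + u s > 0" .
        then show False using ab u0 by auto
      qed
      have out': "Poly_Mapping.lookup (a + b) \<notin> ?U"
        using out upset_mono[of "Poly_Mapping.lookup (a + b)" G "\<lambda>t. Poly_Mapping.lookup (a + b) t + u t"]
        by (auto simp: le_fun_def)
      \<comment> \<open>A competing a' meeting F would put the product into M, and a bad b' would do
        so after multiplication by x^u. Both are excluded, so uniqueness inside \<open>?A\<close>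
        and \<open>?B\<close> extends to all terms.\<close>
      have "a + b \<in> Poly_Mapping.keys (r * p)"
      proof (rule keys_mult_unique)
        fix a' b' assume a'b': "a' \<in> Poly_Mapping.keys r" "b' \<in> Poly_Mapping.keys p" "a' + b' = a + b"
        have "Poly_Mapping.lookup a' s = 0" if "s \<in> F" for s
        proof (rule ccontr)
          assume "Poly_Mapping.lookup a' s \<noteq> 0"
          then have "Poly_Mapping.lookup (a' + b') \<in> ?U"
            by (intro inc'[OF that a'b'(2)]) (auto simp: le_fun_def lookup_add)
          then show False using out' a'b'(3) by simp
        qed
        moreover have "good b'"
        proof (rule ccontr)
          assume "\<not> good b'"
          then have "(\<lambda>t. Poly_Mapping.lookup (a' + b') t + u t) \<in> ?U"
            by (intro upset_mono[OF ubad[OF a'b'(2)]]) (auto simp: le_fun_def lookup_add)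
          then show False using out a'b'(3) by simp
        qed
        ultimately show "a' = a \<and> b' = b" using uniq[of a' b'] a'b' by auto
      qed (use ab in auto)
      moreover have "r * p \<in> mideal ?U" using r by (simp add: Pp)
      ultimately show False using out' by (simp add: mideal_def)
    qed
  qed
  moreover have "var_prime F \<subseteq> P"
    by (rule var_prime_subset_prime[OF primeideal_rtaD(1)[OF P]]) (simp add: F_def)
  ultimately have PF: "P = var_prime F" by blast
  obtain b where b: "b \<in> Poly_Mapping.keys p" "good b" using B_ne by blast
  \<comment> \<open>Adding D makes the directions outside F infinite; since this change avoids F,
    goodness of b keeps the result outside M.\<close>
  define a where "a = (\<lambda>s. Poly_Mapping.lookup b s + (if s \<in> F then 0 else D))"
  have a_out: "a \<notin> ?U"
  proof
    assume "a \<in> ?U"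
    then have "\<exists>s\<in>F. (if s \<in> F then 0 else D) > 0"
      using b(2)[unfolded good_def, rule_format, of "\<lambda>s. if s \<in> F then 0 else D"] by (simp add: a_def)
    then show False by auto
  qed
  have a_in: "a(s := Suc (a s)) \<in> ?U" if "s \<in> F" for s
    by (rule inc'[OF that b(1)]) (auto simp: a_def le_fun_def that)
  have lowF: "low D a = F"
  proof
    show "low D a \<subseteq> F" by (auto simp: low_def a_def split: if_splits)
    show "F \<subseteq> low D a"
    proof
      fix s assume "s \<in> F"
      from a_in[OF this] obtain g where g: "g \<in> G" "g \<le> a(s := Suc (a s))" by (auto simp: upset_def)
      have "\<not> g \<le> a" using a_out g(1) by (auto simp: upset_def)
      then obtain t where "g t > a t" by (auto simp: le_fun_def not_le)
      then have "g s > a s" using le_funD[OF g(2), of t] by (cases "t = s") auto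
      then show "s \<in> low D a" using bnd g(1) by (auto simp: low_def bounded_by_def intro: less_le_trans)
    qed
  qed
  have "corner D G a" unfolding corner_def using a_out a_in lowF by (auto simp: low_def)
  then show ?thesis using that PF lowF by simp
qed

text \<open>Each generator lies in P and hence involves a variable of P. So the vector that is 0 on
  those variables and D elsewhere avoids the upset, and a corner above it can be finite only in
  variables of P.\<close>

lemma prime_contains_corner:
  fixes P :: "('n::finite, 'k::field) mpoly set"
  assumes P: "primeideal P mpoly_ring" and sub: "mideal (upset G) \<subseteq> P"
  obtains a where "corner D G a" "var_prime (low D a) \<subseteq> P"
proof -
  define F where "F = {s. var_mon s \<in> P}"
  let ?a = "\<lambda>s. if s \<in> F then 0 else D"
  have "?a \<notin> upset G"
  proof
    assume "?a \<in> upset G"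
    then obtain g where g: "g \<in> G" "g \<le> ?a" by (auto simp: upset_def)
    have "Poly_Mapping.single (expo g) 1 \<in> (mideal (upset G) :: ('n, 'k) mpoly set)"
      using g(1) by (auto simp: single_in_mideal upset_def)
    then have "Poly_Mapping.single (expo g) 1 \<in> P" using sub by blast
    then obtain s where "g s > 0" "var_mon s \<in> P" by (rule var_in_prime[OF P])
    then show False using le_funD[OF g(2), of s] by (simp add: F_def)
  qed
  moreover have "?a s \<le> D" for s by simp
  ultimately obtain a where a: "corner D G a" "?a \<le> a" by (rule corner_exists_above)
  have "low D a \<subseteq> F"
  proof
    fix s assume "s \<in> low D a"
    then show "s \<in> F" using le_funD[OF a(2), of s] by (auto simp: low_def split: if_splits)
  qed
  then have "var_prime (low D a) \<subseteq> P"
    by (intro var_prime_subset_prime[OF primeideal_rtaD(1)[OF P]]) (auto simp: F_def)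
  then show ?thesis using that a by blast
qed

text \<open>Setting the variables of Z to 1 one after another retains the corners that are infinite
  on Z. This makes \<open>corners_connected\<close> available for the corners with finite set inside
  a given one.\<close>

lemma generic_restriction:
  assumes "generic G" "bounded_by D G" "finite Z"
  shows "\<exists>GF. generic GF \<and> bounded_by D GF \<and> (\<forall>a. corner D GF a \<longleftrightarrow> corner D G a \<and> (\<forall>x\<in>Z. D \<le> a x))"
  using assms(3)
proof (induction Z rule: finite_induct)
  case empty
  then show ?case using assms by auto
next
  case (insert x Z)
  then obtain GF where GF: "generic GF" "bounded_by D GF"
    "\<forall>a. corner D GF a \<longleftrightarrow> corner D G a \<and> (\<forall>x\<in>Z. D \<le> a x)" by blast
  then show ?case
    using generic_drop_var[of GF x] bounded_drop_var[of D GF x] corner_drop_var[of D GF x]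
    by (intro exI[of _ "drop_var x GF"]) auto
qed

text \<open>Restrict to corners whose finite set lies in that of \<open>a\<close>. There
  \<open>a\<close> has the largest size and c a smaller one, so the threshold at the size of
  \<open>a\<close> forces a step; by cardinality its upper corner has the finite set of
  \<open>a\<close>.\<close>

lemma corner_descend:
  fixes G :: "('n::finite \<Rightarrow> nat) set"
  assumes "generic G" "bounded_by D G" "corner D G a" "corner D G c" "low D c \<subset> low D a"
  obtains b s where "corner D G b" "s \<in> low D a" "low D b = low D a - {s}"
proof -
  let ?i = "card (low D a)"
  obtain GF where GF: "generic GF" "bounded_by D GF"
    "\<And>e. corner D GF e \<longleftrightarrow> corner D G e \<and> (\<forall>x\<in>- low D a. D \<le> e x)"
    using generic_restriction[OF assms(1,2), of "- low D a"] by auto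
  have GF': "corner D GF e \<longleftrightarrow> corner D G e \<and> low D e \<subseteq> low D a" for e
    unfolding GF(3) by (auto simp: low_def not_less[symmetric])
  have lt: "card (low D c) < ?i" using assms(5) by (intro psubset_card_mono) auto
  have "step_at D ?i GF"
  proof (rule ccontr)
    assume "\<not> step_at D ?i GF"
    then have "?i \<le> card (low D a) \<longleftrightarrow> ?i \<le> card (low D c)"
      by (intro corners_connected[OF GF(1,2), of UNIV])
        (use assms GF' in \<open>auto simp: supported_in_def\<close>)
    then show False using lt by simp
  qed
  then obtain e b s where e: "corner D GF e" "corner D GF b" "card (low D e) = ?i" "s \<in> low D e"
    "low D b = low D e - {s}" unfolding step_at_def by blast
  have "low D e = low D a"
    using card_subset_eq[of "low D a" "low D e"] e GF' by auto
  then show ?thesis using that[of b s] e GF' by auto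
qed

text \<open>Any corner strictly below lets \<open>corner_descend\<close> remove a single variable,
  so the chain stops only at an inclusion-minimal finite set.\<close>

lemma corner_chain:
  fixes G :: "('n::finite \<Rightarrow> nat) set"
  assumes gen: "generic G" and bnd: "bounded_by D G" and "corner D G a"
  obtains t f where "f 0 = a" "\<And>i. i \<le> t \<Longrightarrow> corner D G (f i)"
    "\<And>i. i < t \<Longrightarrow> \<exists>s\<in>low D (f i). low D (f (Suc i)) = low D (f i) - {s}"
    "\<And>c. corner D G c \<Longrightarrow> \<not> low D c \<subset> low D (f t)"
  using assms(3)
proof (induction "card (low D a)" arbitrary: a thesis rule: less_induct)
  case less
  show ?case
  proof (cases "\<exists>c. corner D G c \<and> low D c \<subset> low D a")
    case False
    then show ?thesis using less.prems(1)[of "\<lambda>_. a" 0] less.prems(2) by auto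
  next
    case True
    then obtain c where "corner D G c" "low D c \<subset> low D a" by blast
    then obtain b s where b: "corner D G b" "s \<in> low D a" "low D b = low D a - {s}"
      by (rule corner_descend[OF gen bnd less.prems(2)])
    have "card (low D b) < card (low D a)" using b by (intro psubset_card_mono) auto
    then obtain f t where f: "f 0 = b" "\<And>i. i \<le> t \<Longrightarrow> corner D G (f i)"
      "\<And>i. i < t \<Longrightarrow> \<exists>s\<in>low D (f i). low D (f (Suc i)) = low D (f i) - {s}"
      "\<And>c. corner D G c \<Longrightarrow> \<not> low D c \<subset> low D (f t)"
      using less.hyps[of b] b(1) by blast
    show ?thesis
    proof (rule less.prems(1)[of "case_nat a f" "Suc t"])
      show "corner D G (case_nat a f i)" if "i \<le> Suc t" for i
        using that f(2) less.prems(2) by (cases i) auto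
      show "\<exists>s\<in>low D (case_nat a f i). low D (case_nat a f (Suc i)) = low D (case_nat a f i) - {s}"
        if "i < Suc t" for i
        using that f(1,3) b by (cases i) auto
    qed (use f in auto)
  qed
qed

theorem theorem2p2:
  fixes M :: "('n::finite, 'k::field) mpoly set"
  assumes "generic_monomial_ideal M"
  shows
    "(\<forall>i::nat. codim mpoly_ring M < enat i \<and>
          enat i \<le> proj_dim mpoly_ring (quotient_module mpoly_ring M) \<longrightarrow>
        (\<exists>P\<in>Ass mpoly_ring (quotient_module mpoly_ring M).
           P \<notin> minimal_primes mpoly_ring M \<and> codim mpoly_ring P = enat i))
     \<and>
     (\<forall>P\<in>Ass mpoly_ring (quotient_module mpoly_ring M).
        \<exists>(t::nat) Q. Q 0 = P \<and>
          (\<forall>i\<le>t. Q i \<in> Ass mpoly_ring (quotient_module mpoly_ring M)) \<and>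
          (\<forall>i<t. Q (Suc i) \<subset> Q i \<and>
             codim mpoly_ring (Q i) = codim mpoly_ring (Q (Suc i)) + 1) \<and>
          Q t \<in> minimal_primes mpoly_ring M)"
proof -
  from assms obtain G0 where G0: "minimal_monomial_generators M G0"
    "\<And>a b. a \<in> G0 \<Longrightarrow> b \<in> G0 \<Longrightarrow> a \<noteq> b \<Longrightarrow>
       \<exists>s. Poly_Mapping.lookup a s = Poly_Mapping.lookup b s \<and> Poly_Mapping.lookup a s > 0 \<Longrightarrow>
       \<exists>c\<in>G0. \<exists>d. monom_lcm a b = c + d \<and> Poly_Mapping.keys d = Poly_Mapping.keys (monom_lcm a b)"
    unfolding generic_monomial_ideal_def by metis
  define G where "G = Poly_Mapping.lookup ` G0"
  have fin: "finite G" and M: "M = mideal (upset G)"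
    using G0(1) by (auto simp: minimal_monomial_generators_def G_def genideal_monomials)
  have gen: "generic G"
    unfolding generic_def
  proof (intro ballI impI, elim conjE)
    fix a b assume ab: "a \<in> G" "b \<in> G" "a \<noteq> b" "\<exists>s. a s = b s \<and> 0 < a s"
    then obtain a0 b0 where a0: "a0 \<in> G0" "a = Poly_Mapping.lookup a0"
      and b0: "b0 \<in> G0" "b = Poly_Mapping.lookup b0" by (auto simp: G_def)
    then obtain c d where c: "c \<in> G0" "monom_lcm a0 b0 = c + d"
      "Poly_Mapping.keys d = Poly_Mapping.keys (monom_lcm a0 b0)"
      using G0(2)[of a0 b0] ab by auto
    have lcm: "Poly_Mapping.lookup (monom_lcm a0 b0) t = max (a t) (b t)" for t
      by (simp add: monom_lcm.rep_eq a0 b0)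
    have "Poly_Mapping.lookup c t < max (a t) (b t) \<or> Poly_Mapping.lookup c t = 0" for t
    \<comment> \<open>With lcm = c + d, the exponent of c is strictly smaller on the support of d;
      off it the lcm vanishes, and c with it.\<close>
    proof (cases "t \<in> Poly_Mapping.keys d")
      case True
      then have "Poly_Mapping.lookup d t > 0" by (simp add: in_keys_iff)
      then show ?thesis using lcm[of t] c(2) by (simp add: lookup_add)
    next
      case False
      then have "Poly_Mapping.lookup (monom_lcm a0 b0) t = 0" using c(3) by (simp add: in_keys_iff)
      then show ?thesis using c(2) by (simp add: lookup_add)
    qed
    then show "\<exists>c\<in>G. \<forall>t. c t < max (a t) (b t) \<or> c t = 0" using c(1) by (auto simp: G_def)
  qed
  define D where "D = (\<Sum>g\<in>G. \<Sum>s\<in>UNIV. g s)"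
  have bnd: "bounded_by D G"
    unfolding bounded_by_def
  proof (intro ballI allI)
    fix g s assume g: "g \<in> G"
    have "g s \<le> (\<Sum>s\<in>UNIV. g s)" by (rule member_le_sum) auto
    also have "\<dots> \<le> D" unfolding D_def using member_le_sum[OF g, of "\<lambda>g. \<Sum>s\<in>UNIV. g s"] fin by auto
    finally show "g s \<le> D" .
  qed
  let ?V = "\<lambda>a. var_prime (low D a) :: ('n, 'k) mpoly set"
  have ideal_M: "ideal M mpoly_ring" unfolding M by (rule ideal_mideal[OF up_closed_upset])
  have Ass_I: "?V a \<in> Ass mpoly_ring (quotient_module mpoly_ring M)" if "corner D G a" for a
    unfolding Ass_quotient_iff[OF ideal_M]
    using var_prime_prime colon_corner[OF bnd that, symmetric] by (auto simp: M)
  have M_sub: "M \<subseteq> ?V a" if "corner D G a" for a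
  proof
    fix q assume "q \<in> M"
    then have "Poly_Mapping.single (expo a) 1 * q \<in> M" by (rule ideal_rtaD(3)[OF ideal_M])
    then show "q \<in> ?V a" using colon_corner[OF bnd that] by (auto simp: M mult.commute)
  qed
  show ?thesis
  proof (intro conjI allI impI ballI; (elim conjE)?)
    fix i assume i: "codim mpoly_ring M < enat i"
      "enat i \<le> proj_dim mpoly_ring (quotient_module mpoly_ring M)"
    from i(1) obtain P where P: "primeideal P mpoly_ring" "M \<subseteq> P" "prime_height mpoly_ring P < enat i"
      unfolding codim_def INF_less_iff by blast
    obtain c where c: "corner D G c" "?V c \<subseteq> P"
      using prime_contains_corner[OF P(1), of G D] P(2) unfolding M by blast
    have "enat (card (low D c)) \<le> prime_height mpoly_ring P"
      using prime_height_mono[OF P(1) c(2)] by (simp add: prime_height_var_prime)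
    then have c_lt: "card (low D c) < i" using P(3) by (metis enat_ord_simps(2) order_le_less_trans)
    have "\<exists>a. corner D G a \<and> i \<le> card (low D a)"
    proof (rule ccontr)
      assume "\<not> ?thesis"
      \<comment> \<open>As c has size below i, i is positive and i - 1 is a true predecessor; the
        bound on the projective dimension then contradicts the choice of i.\<close>
      then have "card (low D a) \<le> i - 1" if "corner D G a" for a using that by force
      then have "proj_dim mpoly_ring (quotient_module mpoly_ring M) \<le> enat (i - 1)"
        unfolding M by (rule proj_dim_generic_le[OF fin gen bnd])
      then have "enat i \<le> enat (i - 1)" using i(2) by (rule order_trans[rotated])
      then show False using c_lt by simp
    qed
    then obtain a where "corner D G a" "i \<le> card (low D a)" by blast
    then have "step_at D i G"
      using corners_connected[OF gen bnd, of UNIV i a c] c(1) c_lt by (auto simp: supported_in_def)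
    then obtain a b s where ab: "corner D G a" "corner D G b" "card (low D a) = i" "s \<in> low D a"
      "low D b = low D a - {s}" unfolding step_at_def by blast
    \<comment> \<open>The lower corner of the step supplies a prime over M strictly inside the upper
      one, which is therefore embedded.\<close>
    have ps: "?V b \<subset> ?V a" unfolding var_prime_psubset_iff using ab by blast
    have "?V a \<notin> minimal_primes mpoly_ring M"
    proof
      assume "?V a \<in> minimal_primes mpoly_ring M"
      then have "?V b = ?V a"
        using var_prime_prime M_sub[OF ab(2)] ps unfolding minimal_primes_def by blast
      then show False using ps by blast
    qed
    then show "\<exists>P\<in>Ass mpoly_ring (quotient_module mpoly_ring M).
        P \<notin> minimal_primes mpoly_ring M \<and> codim mpoly_ring P = enat i"
      using Ass_I[OF ab(1)] codim_var_prime ab(3) by blast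
  next
    fix P assume "P \<in> Ass mpoly_ring (quotient_module mpoly_ring M)"
    then have "primeideal P mpoly_ring \<and> (\<exists>p. P = {r. r * p \<in> M})"
      by (simp only: Ass_quotient_iff[OF ideal_M])
    then obtain p where P: "primeideal P mpoly_ring" "P = {r. r * p \<in> mideal (upset G)}"
      unfolding M by blast
    obtain a where a: "corner D G a" "P = ?V a" by (rule associated_prime_corner[OF bnd P])
    obtain t f where f: "f 0 = a" "\<And>i. i \<le> t \<Longrightarrow> corner D G (f i)"
      "\<And>i. i < t \<Longrightarrow> \<exists>s\<in>low D (f i). low D (f (Suc i)) = low D (f i) - {s}"
      "\<And>c. corner D G c \<Longrightarrow> \<not> low D c \<subset> low D (f t)"
      by (rule corner_chain[OF gen bnd a(1)]) blast
    have "?V (f (Suc i)) \<subset> ?V (f i) \<and> codim mpoly_ring (?V (f i)) = codim mpoly_ring (?V (f (Suc i))) + 1"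
      if "i < t" for i
    proof -
      obtain s where s: "s \<in> low D (f i)" "low D (f (Suc i)) = low D (f i) - {s}" using f(3)[OF \<open>i < t\<close>] by blast
      then have "low D (f i) = insert s (low D (f (Suc i)))" "s \<notin> low D (f (Suc i))" by auto
      then have "card (low D (f i)) = Suc (card (low D (f (Suc i))))" by simp
      then show ?thesis using s
        by (auto simp: var_prime_psubset_iff codim_var_prime one_enat_def)
    qed
    moreover have "?V (f t) \<in> minimal_primes mpoly_ring M"
    proof -
      \<comment> \<open>Q contains the prime of some corner c. As Q lies below the end of the chain,
        minimality there forces c and f t to have the same finite set, which squeezes Q.\<close>
      have "Q = ?V (f t)" if Q: "primeideal Q mpoly_ring" "M \<subseteq> Q" "Q \<subseteq> ?V (f t)" for Q
      proof -
        obtain c where c: "corner D G c" "?V c \<subseteq> Q"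
          using prime_contains_corner[OF Q(1), of G D] Q(2) unfolding M by blast
        have "low D c \<subseteq> low D (f t)" using c(2) Q(3) var_prime_subset_iff by blast
        then have "low D c = low D (f t)" using f(4)[OF c(1)] by blast
        then show ?thesis using c(2) Q(3) by auto
      qed
      then show ?thesis
        unfolding minimal_primes_def using M_sub[OF f(2)[OF order_refl]] var_prime_prime by blast
    qed
    ultimately show "\<exists>t Q. Q 0 = P \<and>
        (\<forall>i\<le>t. Q i \<in> Ass mpoly_ring (quotient_module mpoly_ring M)) \<and>
        (\<forall>i<t. Q (Suc i) \<subset> Q i \<and> codim mpoly_ring (Q i) = codim mpoly_ring (Q (Suc i)) + 1) \<and>
        Q t \<in> minimal_primes mpoly_ring M"
      using a f(1,2) Ass_I by (intro exI[of _ t] exI[of _ "\<lambda>i. ?V (f i)"]) auto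
  qed
qed

end
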